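(* Write $F_{n+1}=F_n*\langle t\rangle$ and identify $\mathrm{Aut}(F_n)$ with the subgroup of $\mathrm{Aut}(F_{n+1})$ consisting of automorphisms that restrict to an automorphism of $F_n$ and fix $t$. Then for every $k\ge 0$ and every $n>4k$, the induced map $H_k(\mathrm{Aut}(F_n);\mathbb{Z})\to H_k(\mathrm{Aut}(F_{n+1});\mathbb{Z})$ is an isomorphism.
   Context: $F_n$ denotes the free group of rank $n$ and $\mathrm{Aut}(F_n)$ its automorphism group. *)

theory Defs
  imports "HOL-Algebra.Bij"
begin

text \<open>A letter (i, False) is the generator x_i, (i, True) is its inverse.\<close>
type_synonym letter = "nat \<times> bool"
type_synonym word = "letter list"

definition inv_letter :: "letter \<Rightarrow> letter" where
  "inv_letter l = (fst l, \<not> snd l)"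

definition reduced :: "word \<Rightarrow> bool" where
  "reduced w \<longleftrightarrow> (\<forall>i. Suc i < length w \<longrightarrow> w ! Suc i \<noteq> inv_letter (w ! i))"

fun red_cons :: "letter \<Rightarrow> word \<Rightarrow> word" where
  "red_cons x [] = [x]"
| "red_cons x (y # ys) = (if y = inv_letter x then ys else x # y # ys)"

definition reduce :: "word \<Rightarrow> word" where
  "reduce w = foldr red_cons w []"

definition inv_word :: "word \<Rightarrow> word" where
  "inv_word w = rev (map inv_letter w)"

definition free_group :: "nat \<Rightarrow> word monoid" where
  "free_group n = \<lparr>carrier = {w. reduced w \<and> (\<forall>l\<in>set w. fst l < n)},
                   mult = (\<lambda>u v. reduce (u @ v)),
                   one = []\<rparr>"

text \<open>F_(n+1) = F_n * <t> with t = x_n. An automorphism phi of F_n is sent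
  to the automorphism of F_(n+1) acting as phi on x_0..x_(n-1) and fixing t.\<close>
definition stab_letter :: "nat \<Rightarrow> (word \<Rightarrow> word) \<Rightarrow> letter \<Rightarrow> word" where
  "stab_letter n \<phi> l =
     (if fst l < n then
        (if snd l then inv_word (\<phi> [(fst l, False)]) else \<phi> [(fst l, False)])
      else [l])"

definition stab :: "nat \<Rightarrow> (word \<Rightarrow> word) \<Rightarrow> (word \<Rightarrow> word)" where
  "stab n \<phi> = (\<lambda>w \<in> carrier (free_group (Suc n)).
                 reduce (concat (map (stab_letter n \<phi>) w)))"

text \<open>Chains in degree k: finitely supported integer combinations of k-tuples
  (lists of length k) of group elements.  Coefficients Z with trivial action.\<close>
definition chain :: "('a, 'b) monoid_scheme \<Rightarrow> nat \<Rightarrow> ('a list \<Rightarrow> int) \<Rightarrow> bool" where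
  "chain G k c \<longleftrightarrow> finite {xs. c xs \<noteq> 0} \<and>
     (\<forall>xs. c xs \<noteq> 0 \<longrightarrow> length xs = k \<and> set xs \<subseteq> carrier G)"

definition face :: "('a, 'b) monoid_scheme \<Rightarrow> nat \<Rightarrow> 'a list \<Rightarrow> 'a list" where
  "face G i xs =
     (if i = 0 then tl xs
      else if i = length xs then butlast xs
      else take (i - 1) xs @ [xs ! (i - 1) \<otimes>\<^bsub>G\<^esub> xs ! i] @ drop (i + 1) xs)"

definition bd_basis :: "('a, 'b) monoid_scheme \<Rightarrow> 'a list \<Rightarrow> 'a list \<Rightarrow> int" where
  "bd_basis G xs ys =
     (if xs = [] then 0
      else (\<Sum>i\<in>{0..length xs}. (-1) ^ i * (if face G i xs = ys then 1 else 0)))"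

definition boundary :: "('a, 'b) monoid_scheme \<Rightarrow> ('a list \<Rightarrow> int) \<Rightarrow> ('a list \<Rightarrow> int)" where
  "boundary G c = (\<lambda>ys. \<Sum>xs\<in>{xs. c xs \<noteq> 0}. c xs * bd_basis G xs ys)"

definition cycle :: "('a, 'b) monoid_scheme \<Rightarrow> nat \<Rightarrow> ('a list \<Rightarrow> int) \<Rightarrow> bool" where
  "cycle G k c \<longleftrightarrow> chain G k c \<and> boundary G c = (\<lambda>_. 0)"

definition is_boundary :: "('a, 'b) monoid_scheme \<Rightarrow> nat \<Rightarrow> ('a list \<Rightarrow> int) \<Rightarrow> bool" where
  "is_boundary G k c \<longleftrightarrow> (\<exists>b. chain G (Suc k) b \<and> boundary G b = c)"

definition push :: "('a \<Rightarrow> 'c) \<Rightarrow> ('a list \<Rightarrow> int) \<Rightarrow> ('c list \<Rightarrow> int)" where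
  "push f c = (\<lambda>ys. \<Sum>xs\<in>{xs. c xs \<noteq> 0 \<and> map f xs = ys}. c xs)"

text \<open>The induced map H_k(G;Z) \<rightarrow> H_k(H;Z), [z] \<mapsto> [f_* z], is bijective
  (i.e. an isomorphism, being a homomorphism): surjective and injective on
  cycles modulo boundaries.\<close>
definition induced_iso_Hk ::
  "('a, 'b) monoid_scheme \<Rightarrow> ('c, 'd) monoid_scheme \<Rightarrow> ('a \<Rightarrow> 'c) \<Rightarrow> nat \<Rightarrow> bool" where
  "induced_iso_Hk G H f k \<longleftrightarrow>
     (\<forall>z. cycle H k z \<longrightarrow>
        (\<exists>z'. cycle G k z' \<and> is_boundary H k (\<lambda>ys. push f z' ys - z ys))) \<and>
     (\<forall>z'. cycle G k z' \<longrightarrow> is_boundary H k (push f z') \<longrightarrow> is_boundary G k z')"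

end

theory Submission
  imports Defs "HOL-Library.Poly_Mapping" "HOL-Library.Product_Lexorder" "HOL-Algebra.Generated_Groups"
    "HOL-Combinatorics.Permutations"
begin

text \<open>
  The homology of \<open>Aut(F_n)\<close> is compared with that of \<open>Aut(F_(n-1))\<close> through the action of \<open>Aut(F_n)\<close> on
  the words of distinct vertices \<open>(x, H)\<close> of a basis \<open>B\<close>, where \<open>x \<in> B\<close> and \<open>H\<close> is the free factor generated
  by \<open>B - {x}\<close>. The action is transitive on words of length \<open>a\<close>, with stabiliser \<open>Aut(F_(n-a))\<close>.

  This complex of words is acyclic in length \<open>l\<close> as soon as \<open>n \<ge> 2 l + 1\<close>. It is the union of the complexes of
  injective words on the bases, added one basis at a time in the lexicographic order that comes from Nielsen's
  ordering of words. If a face \<open>s\<close> of \<open>B\<close> also lies in a smaller basis, then \<open>B - s\<close> is not Nielsen reduced: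
  a Nielsen reduced basis of a subgroup is its least basis. Hence an elementary move on at most two elements of
  \<open>B - s\<close> decreases \<open>B\<close>. So a new basis meets its predecessors in a union of faces each of which omits at most
  two vertices, and such a union is highly acyclic.

  The double complex of this action then shows, by induction on \<open>i\<close>, that \<open>H_i(Aut(F_n), Aut(F_(n-1))) = 0\<close>
  for \<open>n \<ge> 2 i + 2\<close>: its columns are grouped in pairs, and the pairs other than the first are acyclic by
  induction. Degree 0 is trivial for all \<open>n\<close>.
\<close>

text \<open>Recording the complement \<open>H\<close> in a vertex \<open>(x, H)\<close> serves two
  ends. The stabiliser of a word is then exactly the automorphism group of the complementary factor:
  fixing \<open>x\<close> alone would still allow \<open>y -> y x\<close>. And two bases that share
  a face \<open>s\<close> have the same complementary factor, since \<open>gen (B - s)\<close> is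
  the intersection of the complements recorded in \<open>s\<close>; this is why \<open>B - s\<close>
  and \<open>B' - s\<close> can be compared as bases of one group. The obstacle is to find a smaller
  basis that keeps nearly all vertices of \<open>B\<close>. A move that changes \<open>t\<close> by
  \<open>t'\<close> affects at most the vertices of \<open>t\<close> and \<open>t'\<close>, because
  every other complement contains both. Hence the bound two on omitted vertices, and hence the slope
  two: each intersection costs two vertices and one degree. The pairing of columns comes from signs.
  The \<open>a + 1\<close> faces of a word of length \<open>a + 1\<close> induce the same map up to
  conjugation, so their alternating sum is the stabilisation map for even \<open>a\<close> and zero
  for odd \<open>a\<close>. Words are ordered, so a stabiliser fixes every letter and no orientation
  characters appear.\<close>

abbreviation supp :: "('a \<Rightarrow>\<^sub>0 int) \<Rightarrow> 'a set"
  where "supp \<equiv> Poly_Mapping.keys"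

section \<open>Free abelian groups on sets and their induced maps\<close>

definition fmap :: "('a \<Rightarrow> 'b) \<Rightarrow> ('a \<Rightarrow>\<^sub>0 int) \<Rightarrow> ('b \<Rightarrow>\<^sub>0 int)"
  where "fmap f = frag_extend (\<lambda>x. frag_of (f x))"

lemma fmap_of [simp]: "fmap f (frag_of x) = frag_of (f x)"
  by (simp add: fmap_def)

lemma fmap_0 [simp]: "fmap f 0 = 0"
  by (simp add: fmap_def)

lemma fmap_add: "fmap f (a + b) = fmap f a + fmap f b"
  by (simp add: fmap_def frag_extend_add)

lemma fmap_diff: "fmap f (a - b) = fmap f a - fmap f b"
  by (simp add: fmap_def frag_extend_diff)

lemma fmap_minus: "fmap f (- a) = - fmap f a"
  by (simp add: fmap_def frag_extend_minus)

lemma fmap_sum: "finite I \<Longrightarrow> fmap f (sum g I) = (\<Sum>i\<in>I. fmap f (g i))"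
  by (induction I rule: finite_induct) (auto simp: fmap_add)

lemma frag_extend_of_sum: "finite I \<Longrightarrow> frag_extend f (sum g I) = (\<Sum>i\<in>I. frag_extend f (g i))"
  by (induction I rule: finite_induct) (auto simp: frag_extend_add)

lemma frag_extend_frag_extend:
  "frag_extend f (frag_extend g c) = frag_extend (\<lambda>x. frag_extend f (g x)) c"
proof -
  have "supp c \<subseteq> UNIV" by simp
  then show ?thesis
    by (induction c rule: frag_induction) (auto simp: frag_extend_diff)
qed

lemma frag_extend_fmap: "frag_extend f (fmap g c) = frag_extend (\<lambda>x. f (g x)) c"
  by (simp add: fmap_def frag_extend_frag_extend)

lemma fmap_frag_extend: "fmap f (frag_extend g c) = frag_extend (\<lambda>x. fmap f (g x)) c"
  by (simp add: fmap_def frag_extend_frag_extend)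

lemma fmap_fmap: "fmap f (fmap g c) = fmap (\<lambda>x. f (g x)) c"
  by (simp add: fmap_def frag_extend_frag_extend)

lemma frag_extend_plus:
  "frag_extend (\<lambda>x. f x + g x) c = frag_extend f c + frag_extend g c"
proof -
  have "supp c \<subseteq> UNIV" by simp
  then show ?thesis
    by (induction c rule: frag_induction) (auto simp: frag_extend_diff)
qed

lemma frag_extend_uminus:
  "frag_extend (\<lambda>x. - f x) c = - frag_extend f c"
proof -
  have "supp c \<subseteq> UNIV" by simp
  then show ?thesis
    by (induction c rule: frag_induction) (auto simp: frag_extend_diff)
qed

lemma frag_extend_minus_fun:
  "frag_extend (\<lambda>x. f x - g x) c = frag_extend f c - frag_extend g c"
  using frag_extend_plus[of f "\<lambda>x. - g x" c] by (simp add: frag_extend_uminus)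

lemma frag_cmul_diff2: "frag_cmul k (a - b) = frag_cmul k a - frag_cmul k b"
  by (rule poly_mapping_eqI) (simp add: lookup_minus algebra_simps)

lemma frag_extend_cmul_fun:
  "frag_extend (\<lambda>x. frag_cmul k (f x)) c = frag_cmul k (frag_extend f c)"
proof -
  have "supp c \<subseteq> UNIV" by simp
  then show ?thesis
    by (induction c rule: frag_induction) (auto simp: frag_extend_diff frag_cmul_diff2)
qed

lemma fmap_cmul: "fmap f (frag_cmul k c) = frag_cmul k (fmap f c)"
  by (simp add: fmap_def frag_extend_cmul)

lemma fmap_ident [simp]: "fmap (\<lambda>x. x) c = c"
  by (simp add: fmap_def flip: frag_expansion)

lemma fmap_cong: "(\<And>x. x \<in> supp c \<Longrightarrow> f x = g x) \<Longrightarrow> fmap f c = fmap g c"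
  unfolding fmap_def by (rule frag_extend_eq) simp

lemma fmap_eq_self: "(\<And>x. x \<in> supp c \<Longrightarrow> f x = x) \<Longrightarrow> fmap f c = c"
  using fmap_cong[of c f "\<lambda>x. x"] by simp

lemma supp_fmap: "supp (fmap f c) \<subseteq> f ` supp c"
  unfolding fmap_def using keys_frag_extend by fastforce

lemma supp_frag_extend:
  "(\<And>x. x \<in> supp c \<Longrightarrow> supp (f x) \<subseteq> A) \<Longrightarrow> supp (frag_extend f c) \<subseteq> A"
  using keys_frag_extend[of f c] by blast

lemma supp_fmapI: "(\<And>x. x \<in> supp c \<Longrightarrow> f x \<in> A) \<Longrightarrow> supp (fmap f c) \<subseteq> A"
  using supp_fmap[of f c] by blast

lemma supp_add: "supp a \<subseteq> A \<Longrightarrow> supp b \<subseteq> A \<Longrightarrow> supp (a + b) \<subseteq> A"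
  using Poly_Mapping.keys_add[of a b] by blast

lemma supp_diff: "supp a \<subseteq> A \<Longrightarrow> supp b \<subseteq> A \<Longrightarrow> supp (a - b) \<subseteq> A"
  using keys_diff[of a b] by blast

lemma supp_sum: "(\<And>i. i \<in> I \<Longrightarrow> supp (f i) \<subseteq> A) \<Longrightarrow> supp (sum f I) \<subseteq> A"
  using keys_sum[of f I] by blast

lemma supp_image_fmap:
  assumes "supp c \<subseteq> f ` A"
  obtains b where "supp b \<subseteq> A" "c = fmap f b"
proof
  have *: "inv_into A f x \<in> A" "f (inv_into A f x) = x" if "x \<in> supp c" for x
    using assms that by (auto intro: inv_into_into f_inv_into_f)
  show "supp (fmap (inv_into A f) c) \<subseteq> A"
    by (rule supp_fmapI) (use * in auto)
  show "c = fmap f (fmap (inv_into A f) c)"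
    using * by (simp add: fmap_fmap fmap_eq_self)
qed

lemma supp_Un_split:
  assumes "supp c \<subseteq> A \<union> B"
  obtains a b where "supp a \<subseteq> A" "supp b \<subseteq> B - A" "c = a + b"
proof -
  have "supp c \<subseteq> A \<union> (B - A)" using assms by blast
  from frag_split[OF this] show ?thesis using that by metis
qed

lemma fmap_inj_on_eq:
  assumes "fmap f a = fmap f b" "inj_on f A" "supp a \<subseteq> A" "supp b \<subseteq> A"
  shows "a = b"
proof -
  have "fmap (inv_into A f) (fmap f a) = fmap (inv_into A f) (fmap f b)"
    using assms(1) by simp
  moreover have "fmap (inv_into A f) (fmap f a) = a"
    unfolding fmap_fmap using assms by (intro fmap_eq_self) auto
  moreover have "fmap (inv_into A f) (fmap f b) = b"
    unfolding fmap_fmap using assms by (intro fmap_eq_self) auto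
  ultimately show ?thesis by simp
qed

lemma disjoint_supp_add_eq_0:
  assumes "a + b = 0" "supp a \<inter> supp b = {}"
  shows "a = 0" "b = 0"
proof -
  have "supp a = supp b"
    using assms(1) by (metis add_eq_0_iff keys_minus)
  then show "a = 0" "b = 0" using assms(2) by auto
qed

section \<open>The complex of words with deletion of letters\<close>

text \<open>The augmented complex, graded by length: a word of length \<open>l\<close> is a simplex
  of dimension \<open>l - 1\<close>, and the empty word generates the augmentation. The recursion
  produces the alternating signs without indices.\<close>

fun wbd :: "'v list \<Rightarrow> 'v list \<Rightarrow>\<^sub>0 int" where
  "wbd [] = 0"
| "wbd (v # w) = frag_of w - fmap (Cons v) (wbd w)"

abbreviation wbdry :: "('v list \<Rightarrow>\<^sub>0 int) \<Rightarrow> ('v list \<Rightarrow>\<^sub>0 int)"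
  where "wbdry \<equiv> frag_extend wbd"

lemma wbdry_Cons: "wbdry (fmap (Cons v) c) = c - fmap (Cons v) (wbdry c)"
  by (simp add: frag_extend_fmap frag_extend_minus_fun fmap_frag_extend flip: fmap_def)

lemma wbdry_wbd: "wbdry (wbd w) = 0"
  by (induction w) (auto simp: frag_extend_diff wbdry_Cons)

lemma wbdry_wbdry: "wbdry (wbdry c) = 0"
  by (simp add: frag_extend_frag_extend wbdry_wbd frag_extend_eq_0)

text \<open>The Leibniz rule for concatenation. It separates the faces that delete inside the prefix
  from those that delete inside the rest.\<close>

lemma wbd_append:
  "wbd (p @ w) = fmap (\<lambda>q. q @ w) (wbd p) + frag_cmul ((-1) ^ length p) (fmap ((@) p) (wbd w))"
proof (induction p)
  case (Cons v p)
  show ?case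
    by (simp add: Cons.IH fmap_diff fmap_fmap fmap_add fmap_cmul)
qed (simp add: fmap_def flip: frag_expansion)

definition delclosed :: "'v list set \<Rightarrow> bool"
  where "delclosed W \<longleftrightarrow> (\<forall>u v w. u @ v # w \<in> W \<longrightarrow> u @ w \<in> W)"

lemma delclosedD: "delclosed W \<Longrightarrow> u @ v # w \<in> W \<Longrightarrow> u @ w \<in> W"
  by (auto simp: delclosed_def)

lemma in_supp_wbdD: "x \<in> supp (wbd w) \<Longrightarrow> \<exists>u v t. w = u @ v # t \<and> x = u @ t"
proof (induction w arbitrary: x)
  case (Cons v w)
  then have "x \<in> {w} \<union> Cons v ` supp (wbd w)"
    using supp_fmap[of "Cons v" "wbd w"] keys_diff[of "frag_of w" "fmap (Cons v) (wbd w)"]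
    by (auto simp: keys_frag_of)
  then consider "x = w" | y where "y \<in> supp (wbd w)" "x = v # y" by auto
  then show ?case
  proof cases
    case 1 then show ?thesis by (intro exI[of _ "[]"]) auto
  next
    case 2
    then obtain u v' t where "w = u @ v' # t" "y = u @ t" using Cons.IH by blast
    then show ?thesis using 2 by (intro exI[of _ "v # u"]) auto
  qed
qed simp

lemma supp_wbd: "delclosed W \<Longrightarrow> w \<in> W \<Longrightarrow> supp (wbd w) \<subseteq> {x \<in> W. Suc (length x) = length w}"
  using in_supp_wbdD delclosedD by fastforce

definition wchain :: "'v list set \<Rightarrow> nat \<Rightarrow> ('v list \<Rightarrow>\<^sub>0 int) \<Rightarrow> bool"
  where "wchain W l c \<longleftrightarrow> supp c \<subseteq> {w \<in> W. length w = l}"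

lemma wchain_add: "wchain W l a \<Longrightarrow> wchain W l b \<Longrightarrow> wchain W l (a + b)"
  by (simp add: wchain_def supp_add)

lemma wchain_diff: "wchain W l a \<Longrightarrow> wchain W l b \<Longrightarrow> wchain W l (a - b)"
  by (simp add: wchain_def supp_diff)

lemma wchain_minus: "wchain W l (- a) = wchain W l a"
  by (simp add: wchain_def)

lemma wchain_0 [simp]: "wchain W l 0"
  by (simp add: wchain_def)

lemma wchain_mono: "wchain W l c \<Longrightarrow> W \<subseteq> W' \<Longrightarrow> wchain W' l c"
  by (auto simp: wchain_def)

lemma wchain_wbdry: "delclosed W \<Longrightarrow> wchain W (Suc l) c \<Longrightarrow> wchain W l (wbdry c)"
  unfolding wchain_def by (rule supp_frag_extend) (use supp_wbd in fastforce)

lemma wbdry_wchain_0: "wchain W 0 c \<Longrightarrow> wbdry c = 0"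
  unfolding wchain_def by (rule frag_extend_eq_0) auto

text \<open>For deletion-closed \<open>W\<close> this is the vanishing of reduced homology in
  dimension \<open>l - 1\<close>. For \<open>l = 0\<close> it says that the empty word, if present,
  is a boundary.\<close>

definition acyc :: "'v list set \<Rightarrow> nat \<Rightarrow> bool" where
  "acyc W l \<longleftrightarrow> (\<forall>c. wchain W l c \<longrightarrow> wbdry c = 0 \<longrightarrow> (\<exists>b. wchain W (Suc l) b \<and> wbdry b = c))"

lemma acycE:
  assumes "acyc W l" "wchain W l c" "wbdry c = 0"
  obtains b where "wchain W (Suc l) b" "wbdry b = c"
  using assms by (auto simp: acyc_def)

text \<open>Mayer-Vietoris on chains: the boundary of the \<open>A\<close>-part of a cycle equals
  minus that of the \<open>B\<close>-part, so it lies in \<open>A \<inter> B\<close>. A filling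
  \<open>y\<close> there turns both parts into cycles. In length 0 that boundary is zero, so the
  condition on the intersection starts at \<open>0 < l\<close>.\<close>

lemma acyc_Un:
  assumes "delclosed A" "delclosed B" "acyc A l" "acyc B l" "0 < l \<Longrightarrow> acyc (A \<inter> B) (l - 1)"
  shows "acyc (A \<union> B) l"
  unfolding acyc_def
proof (intro allI impI)
  fix c :: "'a list \<Rightarrow>\<^sub>0 int"
  assume c: "wchain (A \<union> B) l c" "wbdry c = 0"
  have "supp c \<subseteq> {w \<in> A. length w = l} \<union> {w \<in> B. length w = l}"
    using c by (auto simp: wchain_def)
  then obtain a b where ab: "supp a \<subseteq> {w \<in> A. length w = l}" "supp b \<subseteq> {w \<in> B. length w = l}" "c = a + b"
    by (elim supp_Un_split) (metis (no_types, lifting) Diff_subset order_trans)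
  then have a: "wchain A l a" and b: "wchain B l b" by (auto simp: wchain_def)
  have neg: "wbdry a = - wbdry b"
    using c(2) ab(3) by (simp add: frag_extend_add add_eq_0_iff2)
  have "\<exists>y. wchain (A \<inter> B) l y \<and> wbdry y = wbdry a"
  proof (cases l)
    case 0
    then show ?thesis using wbdry_wchain_0 a by (intro exI[of _ 0]) auto
  next
    case (Suc l')
    have "wchain A l' (wbdry a)" using wchain_wbdry assms a Suc by blast
    moreover have "wchain B l' (wbdry a)" using wchain_wbdry assms b Suc neg wchain_minus by metis
    ultimately have "wchain (A \<inter> B) l' (wbdry a)" by (auto simp: wchain_def)
    then show ?thesis using assms(5) Suc wbdry_wbdry by (auto elim: acycE)
  qed
  then obtain y where y: "wchain (A \<inter> B) l y" "wbdry y = wbdry a" by blast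
  have "wchain A l (a - y)" using a y by (meson Int_lower1 wchain_diff wchain_mono)
  then obtain a' where a': "wchain A (Suc l) a'" "wbdry a' = a - y"
    using assms(3) y by (auto elim: acycE simp: frag_extend_diff)
  have "wchain B l (b + y)" using b y by (meson Int_lower2 wchain_add wchain_mono)
  then obtain b' where b': "wchain B (Suc l) b'" "wbdry b' = b + y"
    using assms(4) y neg by (auto elim: acycE simp: frag_extend_add)
  have "wchain (A \<union> B) (Suc l) (a' + b')"
    using a' b' by (meson Un_upper1 Un_upper2 wchain_add wchain_mono)
  moreover have "wbdry (a' + b') = c" using a' b' ab by (simp add: frag_extend_add)
  ultimately show "\<exists>b. wchain (A \<union> B) (Suc l) b \<and> wbdry b = c" by blast
qed

text \<open>Modulo \<open>W\<close> the new words form a copy of the complex of \<open>V\<close>,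
  shifted by the length of \<open>p\<close>, because every deletion inside \<open>p\<close> falls
  into \<open>W\<close>. So the new part of a cycle is filled first, using \<open>V\<close>; what
  remains is a cycle of \<open>W\<close>.\<close>

lemma acyc_attach_prefix:
  assumes W: "delclosed W" "acyc W l"
    and V: "delclosed V" "length p \<le> l \<Longrightarrow> acyc V (l - length p)"
    and disj: "\<And>v. v \<in> V \<Longrightarrow> p @ v \<notin> W"
    and del: "\<And>u a t v. p = u @ a # t \<Longrightarrow> v \<in> V \<Longrightarrow> u @ t @ v \<in> W"
  shows "acyc (W \<union> (@) p ` V) l"
  unfolding acyc_def
proof (intro allI impI)
  let ?W = "W \<union> (@) p ` V"
  let ?s = "(-1) ^ length p :: int"
  fix c :: "'a list \<Rightarrow>\<^sub>0 int"
  assume c: "wchain ?W l c" "wbdry c = 0"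
  have "supp c \<subseteq> {w \<in> W. length w = l} \<union> (@) p ` {v \<in> V. length p + length v = l}"
    using c by (auto simp: wchain_def)
  then obtain a b where ab: "supp a \<subseteq> {w \<in> W. length w = l}"
      "supp b \<subseteq> (@) p ` {v \<in> V. length p + length v = l}" "c = a + b"
    by (elim supp_Un_split) (metis (no_types, lifting) Diff_subset order_trans)
  obtain y where y: "supp y \<subseteq> {v \<in> V. length p + length v = l}" "b = fmap ((@) p) y"
    using supp_image_fmap[OF ab(2)] by blast
  \<comment> \<open>The faces of \<open>p @ v\<close> that delete a letter of
    \<open>p\<close>.\<close>
  define del where "del z = frag_extend (\<lambda>w. fmap (\<lambda>q. q @ w) (wbd p)) z" for z
  have bdp: "wbdry (fmap ((@) p) z) = del z + frag_cmul ?s (fmap ((@) p) (wbdry z))" for z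
    by (simp add: frag_extend_fmap wbd_append frag_extend_plus frag_extend_cmul_fun del_def fmap_frag_extend)
  have supp_del: "supp (del z) \<subseteq> {w \<in> W. Suc (length w) = length p + n}"
    if "supp z \<subseteq> {v \<in> V. length v = n}" for z n
    unfolding del_def
  proof (intro supp_frag_extend supp_fmapI)
    fix x q assume x: "x \<in> supp z" "q \<in> supp (wbd p)"
    then obtain u a t where "p = u @ a # t" "q = u @ t" using in_supp_wbdD by blast
    then show "q @ x \<in> {w \<in> W. Suc (length w) = length p + n}"
      using x that del by auto
  qed
  have eq: "(wbdry a + del y) + frag_cmul ?s (fmap ((@) p) (wbdry y)) = 0"
    using c ab y by (simp add: frag_extend_add bdp algebra_simps)
  have yV: "wchain V (l - length p) y" using y by (auto simp: wchain_def)
  have suppW: "supp (wbdry a + del y) \<subseteq> W"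
  proof (rule supp_add)
    show "supp (wbdry a) \<subseteq> W"
      by (rule supp_frag_extend) (use ab supp_wbd[OF W(1)] in blast)
    have "supp y \<subseteq> {v \<in> V. length v = l - length p}" using y by auto
    then show "supp (del y) \<subseteq> W" using supp_del by blast
  qed
  have suppy: "supp (frag_cmul ?s (fmap ((@) p) (wbdry y))) \<subseteq> (@) p ` V"
  proof -
    have "supp (wbdry y) \<subseteq> V"
      by (rule supp_frag_extend) (use y supp_wbd[OF V(1)] in blast)
    then have "supp (fmap ((@) p) (wbdry y)) \<subseteq> (@) p ` V"
      by (intro supp_fmapI) auto
    then show ?thesis using keys_cmul by blast
  qed
  \<comment> \<open>The boundary splits into words of \<open>W\<close> and words with prefix
    \<open>p\<close> outside \<open>W\<close>; the two parts vanish separately.\<close>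
  have "frag_cmul ?s (fmap ((@) p) (wbdry y)) = 0"
    using disjoint_supp_add_eq_0(2)[OF eq] suppW suppy disj by blast
  then have "fmap ((@) p) (wbdry y) = 0" by simp
  then have dy: "wbdry y = 0"
    using fmap_inj_on_eq[of "(@) p" "wbdry y" 0 UNIV] by (auto simp: inj_on_def)
  have "\<exists>x. wchain V (Suc (l - length p)) x \<and> wbdry x = y"
  proof (cases "length p \<le> l")
    case True then show ?thesis using V(2) yV dy by (auto elim: acycE)
  next
    case False
    then have "supp y = {}" using y by auto
    then show ?thesis by (intro exI[of _ 0]) auto
  qed
  then obtain x where x: "wchain V (Suc (l - length p)) x" "wbdry x = y" by blast
  \<comment> \<open>If \<open>p\<close> is longer than \<open>l\<close>, the truncated difference
    \<open>l - length p\<close> carries no meaning. Then \<open>y = 0\<close>, and its filling is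
    replaced by 0.\<close>
  define x' where "x' = (if length p \<le> l then x else 0)"
  have x': "supp x' \<subseteq> {v \<in> V. length v = Suc (l - length p)}" "wbdry x' = y"
    "length p \<le> l \<or> x' = 0"
  proof -
    have "y = 0" if "\<not> length p \<le> l"
    proof -
      have "supp y = {}" using y that by auto
      then show ?thesis by simp
    qed
    then show "supp x' \<subseteq> {v \<in> V. length v = Suc (l - length p)}" "wbdry x' = y"
      "length p \<le> l \<or> x' = 0"
      using x by (auto simp: x'_def wchain_def)
  qed
  \<comment> \<open>The sign cancels the one from the Leibniz rule, so \<open>b1\<close> bounds
    \<open>b\<close> up to words of \<open>W\<close>.\<close>
  define b1 where "b1 = frag_cmul ?s (fmap ((@) p) x')"
  have sq: "?s * ?s = 1" by (simp flip: power_mult_distrib)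
  have db1: "wbdry b1 = frag_cmul ?s (del x') + b"
    by (simp add: b1_def frag_extend_cmul bdp x' frag_cmul_distrib2 sq y)
  have wb1: "wchain ?W (Suc l) b1"
  proof -
    have "supp (fmap ((@) p) x') \<subseteq> {w \<in> ?W. length w = Suc l}"
      by (rule supp_fmapI) (use x' in auto)
    then show ?thesis unfolding b1_def wchain_def using keys_cmul by blast
  qed
  have "wchain W l (frag_cmul ?s (del x'))"
  proof -
    have "supp (del x') \<subseteq> {w \<in> W. length w = l}"
      using supp_del[OF x'(1)] x'(3) by (auto simp: del_def)
    then show ?thesis unfolding wchain_def using keys_cmul by blast
  qed
  then have "wchain W l (c - wbdry b1)"
    unfolding db1 ab(3) using ab(1) wchain_diff[of W l a] by (simp add: wchain_def)
  moreover have "wbdry (c - wbdry b1) = 0"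
    by (simp add: frag_extend_diff c wbdry_wbdry)
  ultimately obtain b2 where b2: "wchain W (Suc l) b2" "wbdry b2 = c - wbdry b1"
    using W(2) by (auto elim: acycE)
  then have "wchain ?W (Suc l) (b1 + b2)" "wbdry (b1 + b2) = c"
    using wb1 wchain_mono[of W] by (auto intro!: wchain_add simp: frag_extend_add)
  then show "\<exists>b. wchain ?W (Suc l) b \<and> wbdry b = c" by blast
qed

lemma delclosed_UN: "(\<And>i. i \<in> I \<Longrightarrow> delclosed (A i)) \<Longrightarrow> delclosed (\<Union>i\<in>I. A i)"
  unfolding delclosed_def by blast

lemma delclosed_attach_prefix:
  assumes "delclosed W" "delclosed V"
    and del: "\<And>u a t v. p = u @ a # t \<Longrightarrow> v \<in> V \<Longrightarrow> u @ t @ v \<in> W"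
  shows "delclosed (W \<union> (@) p ` V)"
  unfolding delclosed_def
proof (intro allI impI)
  fix u a w assume "u @ a # w \<in> W \<union> (@) p ` V"
  then consider "u @ a # w \<in> W" | v where "v \<in> V" "u @ a # w = p @ v" by auto
  then show "u @ w \<in> W \<union> (@) p ` V"
  proof cases
    case 1 then show ?thesis using delclosedD[OF assms(1)] by blast
  next
    case 2
    from 2(2) consider us where "u = p @ us" "us @ a # w = v" | us where "u @ us = p" "a # w = us @ v"
      by (auto simp: append_eq_append_conv2)
    then show ?thesis
    proof cases
      case 1
      then have "us @ w \<in> V" using 2 delclosedD[OF assms(2), of us a w] by simp
      then show ?thesis using 1 by auto
    next
      case 2
      show ?thesis
      proof (cases us)
        case Nil
        then have "w \<in> V" using 2 \<open>v \<in> V\<close> delclosedD[OF assms(2), of "[]" a w] by simp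
        then show ?thesis using 2 Nil by auto
      next
        case (Cons b t)
        then show ?thesis using 2 del[of u a t v] \<open>v \<in> V\<close> by auto
      qed
    qed
  qed
qed

section \<open>Injective words\<close>

definition inj_words :: "'v set \<Rightarrow> 'v list set"
  where "inj_words S = {w. distinct w \<and> set w \<subseteq> S}"

lemma delclosed_inj_words: "delclosed (inj_words S)"
  by (auto simp: delclosed_def inj_words_def)

lemma set_drop_delete: "set (drop m (u @ t)) \<subseteq> set (drop m (u @ x # t))"
proof -
  have "set (drop (m - length u) t) \<subseteq> set (drop (m - length u) (x # t))"
    using set_drop_subset_set_drop[of "m - length u" "Suc (m - length u)" "x # t"] by simp
  then show ?thesis by auto
qed

lemma finite_inj_words: "finite S \<Longrightarrow> finite (inj_words S)"
  unfolding inj_words_def by (rule finite_subset[OF _ finite_subset_distinct]) auto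

text \<open>Prefixing \<open>a\<close> contracts the complex. Write a cycle as
  \<open>z + a y\<close> with \<open>a\<close> absent from \<open>z\<close> and \<open>y\<close>.
  The part of its boundary without \<open>a\<close> vanishes by itself, so the boundary of
  \<open>z\<close> is \<open>- y\<close>, and the boundary of \<open>a z\<close> is
  \<open>z + a y\<close>.\<close>

lemma acyc_cone:
  assumes "a \<in> S"
  shows "acyc {w \<in> inj_words S. a \<notin> set (drop (Suc 0) w)} l"
  unfolding acyc_def
proof (intro allI impI)
  let ?W = "{w \<in> inj_words S. a \<notin> set (drop (Suc 0) w)}"
  let ?V = "inj_words (S - {a})"
  fix c assume c: "wchain ?W l c" "wbdry c = 0"
  have "{w \<in> ?W. length w = l} \<subseteq> {w \<in> ?V. length w = l} \<union> Cons a ` {v \<in> ?V. Suc (length v) = l}"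
  proof
    fix w assume "w \<in> {w \<in> ?W. length w = l}"
    then show "w \<in> {w \<in> ?V. length w = l} \<union> Cons a ` {v \<in> ?V. Suc (length v) = l}"
      by (cases w) (auto simp: inj_words_def image_iff)
  qed
  then have "supp c \<subseteq> {w \<in> ?V. length w = l} \<union> Cons a ` {v \<in> ?V. Suc (length v) = l}"
    using c by (auto simp: wchain_def)
  then obtain z y' where z: "supp z \<subseteq> {w \<in> ?V. length w = l}"
    and y': "supp y' \<subseteq> Cons a ` {v \<in> ?V. Suc (length v) = l}" "c = z + y'"
    by (elim supp_Un_split) (metis (no_types, lifting) Diff_subset order_trans)
  obtain y where y: "supp y \<subseteq> {v \<in> ?V. Suc (length v) = l}" "c = z + fmap (Cons a) y"
    using supp_image_fmap[OF y'(1)] y'(2) by blast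
  have "wbdry z + (y - fmap (Cons a) (wbdry y)) = 0"
    using c(2) y(2) by (simp add: frag_extend_add wbdry_Cons)
  then have eq: "(wbdry z + y) + - fmap (Cons a) (wbdry y) = 0"
    by (simp add: add_diff_eq)
  have dV: "supp (wbdry d) \<subseteq> ?V" if "supp d \<subseteq> ?V" for d
    by (rule supp_frag_extend) (use that supp_wbd[OF delclosed_inj_words] in blast)
  have "supp (wbdry z + y) \<subseteq> ?V"
    by (rule supp_add) (use dV[of z] z y in blast)+
  moreover have "supp (- fmap (Cons a) (wbdry y)) \<subseteq> Cons a ` UNIV"
    using supp_fmap[of "Cons a" "wbdry y"] by auto
  moreover have "a # x \<notin> ?V" for x by (auto simp: inj_words_def)
  ultimately have "supp (wbdry z + y) \<inter> supp (- fmap (Cons a) (wbdry y)) = {}"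
    by blast
  from disjoint_supp_add_eq_0(1)[OF eq this] have "wbdry z = - y"
    by (simp add: add_eq_0_iff2)
  then have "wbdry (fmap (Cons a) z) = c"
    by (simp add: wbdry_Cons y fmap_minus)
  moreover have "wchain ?W (Suc l) (fmap (Cons a) z)"
    unfolding wchain_def by (rule supp_fmapI) (use z assms in \<open>auto simp: inj_words_def\<close>)
  ultimately show "\<exists>b. wchain ?W (Suc l) b \<and> wbdry b = c" by blast
qed

text \<open>Fix a letter \<open>a\<close>. The words without \<open>a\<close> or beginning with \<open>a\<close> form a cone; the remaining
  words \<open>u a v\<close> are attached in order of increasing length of \<open>u\<close>.\<close>

lemma acyc_inj_words:
  assumes "finite S" "l < card S"
  shows "acyc (inj_words S) l"
  using assms
proof (induction "card S" arbitrary: S l rule: less_induct)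
  case less
  then obtain a where a: "a \<in> S" by fastforce
  \<comment> \<open>In \<open>L k\<close> the letter \<open>a\<close> may occur only among the first
    \<open>k + 1\<close> letters; \<open>L 0\<close> is the cone.\<close>
  define L where "L k = {w \<in> inj_words S. a \<notin> set (drop (Suc k) w)}" for k
  define St where "St u = (@) (u @ [a]) ` inj_words (S - {a} - set u)" for u
  have delL: "delclosed (L k)" for k
    unfolding delclosed_def
  proof (intro allI impI)
    fix u v w assume *: "u @ v # w \<in> L k"
    then have "u @ w \<in> inj_words S"
      using delclosedD[OF delclosed_inj_words, of u v w] by (auto simp: L_def)
    then show "u @ w \<in> L k"
      using * set_drop_delete[of "Suc k" u w v] by (auto simp: L_def)
  qed
  have "acyc (L k) l" for k
  proof (induction k)
    case 0
    show ?case unfolding L_def by (rule acyc_cone[OF a])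
  next
    case (Suc k)
    define U where "U = {u \<in> inj_words (S - {a}). length u = Suc k}"
    have "finite U" unfolding U_def using finite_inj_words[of "S - {a}"] less.prems by simp
    have step: "delclosed (L k \<union> (\<Union>u\<in>Q. St u)) \<and> acyc (L k \<union> (\<Union>u\<in>Q. St u)) l"
      if "finite Q" "Q \<subseteq> U" for Q
      using that
    proof (induction Q rule: finite_induct)
      case empty
      then show ?case using delL Suc by simp
    next
      case (insert u Q)
      let ?W = "L k \<union> (\<Union>u\<in>Q. St u)"
      let ?V = "inj_words (S - {a} - set u)"
      have u: "distinct u" "set u \<subseteq> S - {a}" "length u = Suc k"
        using insert by (auto simp: U_def inj_words_def)
      have eq: "L k \<union> (\<Union>u\<in>insert u Q. St u) = ?W \<union> (@) (u @ [a]) ` ?V"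
        by (auto simp: St_def)
      have W: "delclosed ?W" "acyc ?W l" using insert by auto
      \<comment> \<open>Deleting a letter of \<open>u a\<close> either removes \<open>a\<close> or
        moves it forward to position \<open>k\<close>; both results lie in
        \<open>L k\<close>.\<close>
      have del: "u' @ t @ v \<in> ?W" if "u @ [a] = u' @ x # t" "v \<in> ?V" for u' x t v
      proof -
        have "u' @ t @ v \<in> L k"
        proof (cases t rule: rev_cases)
          case Nil
          then show ?thesis using that u by (auto simp: L_def inj_words_def dest: in_set_dropD)
        next
          case (snoc t' b)
          then have "u = u' @ x # t'" "b = a" using that by auto
          moreover have "length u' + length t' = k" using u calculation by auto
          ultimately show ?thesis using that u snoc a by (auto simp: L_def inj_words_def dest: in_set_dropD)
        qed
        then show ?thesis by blast
      qed
      have disj: "(u @ [a]) @ v \<notin> ?W" if "v \<in> ?V" for v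
      proof
        assume "(u @ [a]) @ v \<in> ?W"
        then consider "(u @ [a]) @ v \<in> L k" | u' where "u' \<in> Q" "(u @ [a]) @ v \<in> St u'" by blast
        then show False
        proof cases
          case 1 then show ?thesis using u by (auto simp: L_def)
        next
          case 2
          then have "length u' = length u" using insert by (auto simp: U_def)
          then show ?thesis using 2 insert by (auto simp: St_def)
        qed
      qed
      \<comment> \<open>The prefix has length \<open>k + 2\<close>, and exactly \<open>k + 2\<close>
        letters are used up. So the strict inequality \<open>l < card S\<close> is
        inherited.\<close>
      have IH: "acyc ?V (l - length (u @ [a]))" if "length (u @ [a]) \<le> l"
      proof (rule less.hyps)
        have "card (S - {a} - set u) = card S - 1 - Suc k"
          using less.prems u a by (simp add: card_Diff_subset distinct_card)
        then show "card (S - {a} - set u) < card S" "l - length (u @ [a]) < card (S - {a} - set u)"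
          using less.prems u that by auto
      qed (use less.prems in auto)
      show ?case unfolding eq
      proof
        show "delclosed (?W \<union> (@) (u @ [a]) ` ?V)"
          by (rule delclosed_attach_prefix[OF W(1) delclosed_inj_words]) (rule del)
        show "acyc (?W \<union> (@) (u @ [a]) ` ?V) l"
          by (rule acyc_attach_prefix[OF W delclosed_inj_words IH disj]) (assumption | rule del)+
      qed
    qed
    have "L (Suc k) = L k \<union> (\<Union>u\<in>U. St u)"
    proof (intro equalityI subsetI)
      fix w assume w: "w \<in> L (Suc k)"
      show "w \<in> L k \<union> (\<Union>u\<in>U. St u)"
      proof (cases "w \<in> L k")
        case False
        then have aw: "a \<in> set (drop (Suc k) w)" "a \<notin> set (drop (Suc (Suc k)) w)"
          using w by (auto simp: L_def)
        then have len: "Suc k < length w" by (metis drop_all emptyE leI list.set(1))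
        define p q where "p = take (Suc k) w" and "q = drop (Suc (Suc k)) w"
        have "w = p @ w ! Suc k # q"
          unfolding p_def q_def using len id_take_nth_drop by blast
        moreover have "w ! Suc k = a"
          using aw len by (metis Cons_nth_drop_Suc set_ConsD)
        ultimately have eq: "w = p @ a # q" by simp
        have "distinct w" "set w \<subseteq> S" using w by (auto simp: L_def inj_words_def)
        moreover have "length p = Suc k" using len by (simp add: p_def)
        ultimately have "p \<in> U" "q \<in> inj_words (S - {a} - set p)"
          unfolding eq by (auto simp: U_def inj_words_def)
        moreover have "w = (p @ [a]) @ q" using eq by simp
        ultimately have "p \<in> U" "w \<in> St p" unfolding St_def by blast+
        then show ?thesis by blast
      qed auto
    next
      fix w assume "w \<in> L k \<union> (\<Union>u\<in>U. St u)"
      then consider "w \<in> L k" | u v where "u \<in> U" "w = u @ a # v" "v \<in> inj_words (S - {a} - set u)"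
        by (auto simp: St_def)
      then show "w \<in> L (Suc k)"
      proof cases
        case 1
        then show ?thesis
          using set_drop_subset_set_drop[of "Suc k" "Suc (Suc k)" w] by (auto simp: L_def)
      next
        case 2 then show ?thesis using a by (auto simp: L_def U_def inj_words_def dest: in_set_dropD)
      qed
    qed
    then show ?case using step[OF \<open>finite U\<close>] by auto
  qed
  moreover have "L (card S) = inj_words S"
  proof -
    have "length w \<le> card S" if "w \<in> inj_words S" for w
      using that card_mono[OF less.prems(1), of "set w"] by (simp add: inj_words_def distinct_card)
    then have "drop (Suc (card S)) w = []" if "w \<in> inj_words S" for w
      using that by (simp add: le_SucI)
    then show ?thesis by (auto simp: L_def)
  qed
  ultimately show ?case by metis
qed

text \<open>Mayer-Vietoris, one face at a time. The face \<open>V - T\<close> meets the others in a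
  family of the same shape on the vertex set \<open>V - T\<close>. That set has at least
  \<open>2 * l + 1 = 2 * (l - 1) + 3\<close> elements: two vertices are lost, but one degree as
  well.\<close>

lemma acyc_UN_inj_words:
  assumes "finite \<T>" "\<T> \<noteq> {}" "\<And>T. T \<in> \<T> \<Longrightarrow> finite T \<and> card T \<le> 2"
    and "finite V" "2 * l + 3 \<le> card V"
  shows "acyc (\<Union>T\<in>\<T>. inj_words (V - T)) l"
  using assms
proof (induction \<T> arbitrary: V l rule: finite_ne_induct)
  case (singleton T)
  have "card V - 2 \<le> card (V - T)"
    using singleton diff_card_le_card_Diff[of T V] by fastforce
  then show ?case using singleton by (auto intro!: acyc_inj_words)
next
  case (insert T \<T>)
  have T: "card V - 2 \<le> card (V - T)"
    using insert.prems diff_card_le_card_Diff[of T V] by fastforce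
  have "acyc (inj_words (V - T) \<union> (\<Union>T\<in>\<T>. inj_words (V - T))) l"
  proof (rule acyc_Un)
    show "acyc (inj_words (V - T)) l"
      using insert.prems T by (intro acyc_inj_words) auto
    show "acyc (\<Union>T\<in>\<T>. inj_words (V - T)) l"
      using insert by auto
    assume "0 < l"
    have "acyc (\<Union>T'\<in>\<T>. inj_words (V - T - T')) (l - 1)"
      using insert.prems T \<open>0 < l\<close> by (intro insert.IH) auto
    moreover have "inj_words (V - T) \<inter> (\<Union>T\<in>\<T>. inj_words (V - T)) = (\<Union>T'\<in>\<T>. inj_words (V - T - T'))"
      by (auto simp: inj_words_def)
    ultimately show "acyc (inj_words (V - T) \<inter> (\<Union>T\<in>\<T>. inj_words (V - T))) (l - 1)" by simp
  qed (intro delclosed_inj_words delclosed_UN)+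
  then show ?case by simp
qed

section \<open>Gluing simplices in a well-founded order\<close>

lemma acyc_directed:
  assumes "\<And>c. wchain W l c \<Longrightarrow> wbdry c = 0 \<Longrightarrow> \<exists>W'. W' \<subseteq> W \<and> wchain W' l c \<and> acyc W' l"
  shows "acyc W l"
  unfolding acyc_def
proof (intro allI impI)
  fix c assume c: "wchain W l c" "wbdry c = 0"
  then obtain W' where "W' \<subseteq> W" "wchain W' l c" "acyc W' l" using assms by blast
  then show "\<exists>b. wchain W (Suc l) b \<and> wbdry b = c"
    using c wchain_mono by (metis acyc_def)
qed

lemma total_wf_finite_max:
  fixes lt :: "'b \<Rightarrow> 'b \<Rightarrow> bool"
  assumes "finite A" "A \<noteq> {}" "wf {(x, y). x \<in> F \<and> y \<in> F \<and> lt x y}" "A \<subseteq> F"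
    and total: "\<And>x y. x \<in> F \<Longrightarrow> y \<in> F \<Longrightarrow> x \<noteq> y \<Longrightarrow> lt x y \<or> lt y x"
  shows "\<exists>m\<in>A. \<forall>x\<in>A. x = m \<or> lt x m"
proof -
  define r where "r = {(x, y). x \<in> A \<and> y \<in> A \<and> lt x y}"
  have "r \<subseteq> {(x, y). x \<in> F \<and> y \<in> F \<and> lt x y}" using assms(4) by (auto simp: r_def)
  then have "acyclic r" using assms(3) wf_subset wf_acyclic by blast
  moreover have "finite r"
    by (rule finite_subset[of _ "A \<times> A"]) (use assms(1) in \<open>auto simp: r_def\<close>)
  ultimately have "wf (r\<inverse>)" by (rule finite_acyclic_wf_converse[rotated])
  then obtain m where m: "m \<in> A" "\<And>y. (y, m) \<in> r\<inverse> \<Longrightarrow> y \<notin> A"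
    using assms(2) unfolding wf_eq_minimal by blast
  have "x = m \<or> lt x m" if "x \<in> A" for x
  proof -
    have "\<not> lt m x" using m(1) m(2)[of x] that by (auto simp: r_def)
    then show ?thesis using total[of x m] assms(4) m(1) that by blast
  qed
  then show ?thesis using m(1) by blast
qed

text \<open>The hypothesis \<open>red\<close> says that a new facet \<open>b\<close> meets its
  predecessors in a union of faces \<open>V b - T\<close> with at most two vertices omitted.
  \<open>acyc_UN_inj_words\<close> makes this union acyclic in length \<open>l - 1\<close>, since
  \<open>2 * l + 1 = 2 * (l - 1) + 3\<close>, and \<open>acyc_Un\<close> attaches the facet.\<close>

lemma acyc_facets:
  fixes V :: "'b \<Rightarrow> 'v set" and lt :: "'b \<Rightarrow> 'b \<Rightarrow> bool"
  assumes wf: "wf {(x, y). x \<in> F \<and> y \<in> F \<and> lt x y}"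
    and total: "\<And>x y. x \<in> F \<Longrightarrow> y \<in> F \<Longrightarrow> x \<noteq> y \<Longrightarrow> lt x y \<or> lt y x"
    and V: "\<And>b. b \<in> F \<Longrightarrow> finite (V b)" "\<And>b. b \<in> F \<Longrightarrow> 2 * l + 1 \<le> card (V b)"
    and red: "\<And>b b' w. b \<in> F \<Longrightarrow> b' \<in> F \<Longrightarrow> lt b' b \<Longrightarrow> w \<in> inj_words (V b) \<Longrightarrow> w \<in> inj_words (V b')
      \<Longrightarrow> \<exists>T b''. b'' \<in> F \<and> lt b'' b \<and> T \<subseteq> V b \<and> card T \<le> 2 \<and> set w \<inter> T = {} \<and> V b - T \<subseteq> V b''"
    and "F \<noteq> {}"
  shows "acyc (\<Union>b\<in>F. inj_words (V b)) l"
proof -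
  define W where "W b = (\<Union>b'\<in>{b'\<in>F. lt b' b}. inj_words (V b'))" for b
  \<comment> \<open>A cycle involves finitely many facets and so lives in
    \<open>W m \<union> inj_words (V m)\<close> for the largest of them, \<open>m\<close>. This also
    covers families without a last facet, where no single attachment is available.\<close>
  have union: "acyc (\<Union>b\<in>A. inj_words (V b)) l"
    if A: "A \<subseteq> F" "A \<noteq> {}" "\<And>b. b \<in> A \<Longrightarrow> acyc (W b \<union> inj_words (V b)) l"
       "\<And>b. b \<in> A \<Longrightarrow> W b \<subseteq> (\<Union>b\<in>A. inj_words (V b))" for A
  proof (rule acyc_directed)
    fix c assume c: "wchain (\<Union>b\<in>A. inj_words (V b)) l c"
    have "\<forall>w\<in>supp c. \<exists>b\<in>A. w \<in> inj_words (V b)" using c by (auto simp: wchain_def)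
    then obtain f where f: "\<And>w. w \<in> supp c \<Longrightarrow> f w \<in> A \<and> w \<in> inj_words (V (f w))" by metis
    obtain b0 where "b0 \<in> A" using A by blast
    have "\<exists>m\<in>insert b0 (f ` supp c). \<forall>x\<in>insert b0 (f ` supp c). x = m \<or> lt x m"
      by (rule total_wf_finite_max[OF _ _ wf _ total]) (use \<open>b0 \<in> A\<close> A f in auto)
    then obtain m where m: "m \<in> insert b0 (f ` supp c)" "\<And>w. w \<in> supp c \<Longrightarrow> f w = m \<or> lt (f w) m" by blast
    have "m \<in> A" using m f \<open>b0 \<in> A\<close> by auto
    have "wchain (W m \<union> inj_words (V m)) l c"
      unfolding wchain_def
    proof
      fix w assume w: "w \<in> supp c"
      have "w \<in> inj_words (V (f w))" "f w \<in> F" using f[OF w] A(1) by auto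
      then have "w \<in> W m \<union> inj_words (V m)" using m(2)[OF w] by (auto simp: W_def)
      then show "w \<in> {w \<in> W m \<union> inj_words (V m). length w = l}"
        using c w by (auto simp: wchain_def)
    qed
    then show "\<exists>W'\<subseteq>\<Union>b\<in>A. inj_words (V b). wchain W' l c \<and> acyc W' l"
      using A \<open>m \<in> A\<close> by (intro exI[of _ "W m \<union> inj_words (V m)"]) blast
  qed
  \<comment> \<open>Otherwise \<open>{x, y, z}\<close> would have no minimal element.\<close>
  have trans: "lt x z" if "x \<in> F" "y \<in> F" "z \<in> F" "lt x y" "lt y z" for x y z
  proof (rule ccontr)
    assume "\<not> lt x z"
    obtain m where "m \<in> {x, y, z}" "\<And>u. (u, m) \<in> {(x, y). x \<in> F \<and> y \<in> F \<and> lt x y} \<Longrightarrow> u \<notin> {x, y, z}"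
      using wf wfE_min'[of _ "{x, y, z}"] by (metis (no_types, lifting) insert_not_empty)
    then show False using that \<open>\<not> lt x z\<close> total[of x z] by auto
  qed
  have "acyc (W b \<union> inj_words (V b)) l" if "b \<in> F" for b
    using wf that
  proof (induction b rule: wf_induct_rule)
    case (less b)
    have acV: "acyc (inj_words (V b)) l" using V less.prems by (intro acyc_inj_words) force+
    show ?case
    proof (cases "{b'\<in>F. lt b' b} = {}")
      case True
      have "W b = {}" unfolding W_def True by simp
      then show ?thesis using acV by simp
    next
      case False
      have "acyc (W b) l"
        unfolding W_def
      proof (rule union)
        fix b' assume "b' \<in> {b' \<in> F. lt b' b}"
        then show "acyc (W b' \<union> inj_words (V b')) l" using less by auto
        show "W b' \<subseteq> (\<Union>b\<in>{b' \<in> F. lt b' b}. inj_words (V b))"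
          using trans[of _ b' b] \<open>b' \<in> _\<close> less.prems by (auto simp: W_def)
      qed (use False in auto)
      moreover have "acyc (W b \<inter> inj_words (V b)) (l - 1)" if "0 < l"
      proof -
        define \<T> where "\<T> = {T. T \<subseteq> V b \<and> card T \<le> 2 \<and> (\<exists>b''\<in>F. lt b'' b \<and> V b - T \<subseteq> V b'')}"
        have "W b \<inter> inj_words (V b) = (\<Union>T\<in>\<T>. inj_words (V b - T))"
        proof (intro equalityI subsetI)
          fix w assume "w \<in> W b \<inter> inj_words (V b)"
          then obtain b' where "b' \<in> F" "lt b' b" "w \<in> inj_words (V b)" "w \<in> inj_words (V b')"
            by (auto simp: W_def)
          then obtain T b'' where T: "b'' \<in> F" "lt b'' b" "T \<subseteq> V b" "card T \<le> 2" "set w \<inter> T = {}" "V b - T \<subseteq> V b''"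
            using red[of b b' w] less.prems by blast
          then have "w \<in> inj_words (V b - T)" using \<open>w \<in> inj_words (V b)\<close> by (auto simp: inj_words_def)
          then show "w \<in> (\<Union>T\<in>\<T>. inj_words (V b - T))" using T by (auto simp: \<T>_def)
        next
          fix w assume "w \<in> (\<Union>T\<in>\<T>. inj_words (V b - T))"
          then obtain T b'' where "b'' \<in> F" "lt b'' b" "V b - T \<subseteq> V b''" "w \<in> inj_words (V b - T)"
            by (auto simp: \<T>_def)
          then show "w \<in> W b \<inter> inj_words (V b)"
            by (auto simp: W_def inj_words_def)
        qed
        moreover have "acyc (\<Union>T\<in>\<T>. inj_words (V b - T)) (l - 1)"
        proof (rule acyc_UN_inj_words)
          show "finite \<T>" using V(1)[OF less.prems] by (simp add: \<T>_def)
          show "finite T \<and> card T \<le> 2" if "T \<in> \<T>" for T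
            using that V(1)[OF less.prems] finite_subset by (auto simp: \<T>_def)
          \<comment> \<open>The empty word lies in every facet, so \<open>red\<close> applied to it
            yields a member of the family.\<close>
          obtain b' where "b' \<in> F" "lt b' b" using False by blast
          then show "\<T> \<noteq> {}"
            using red[of b b' "[]"] less.prems by (auto simp: \<T>_def inj_words_def)
        qed (use V[OF less.prems] that in auto)
        ultimately show ?thesis by simp
      qed
      moreover have "delclosed (W b)" unfolding W_def by (intro delclosed_UN delclosed_inj_words)
      ultimately show ?thesis using acV by (intro acyc_Un delclosed_inj_words)
    qed
  qed
  then show ?thesis using \<open>F \<noteq> {}\<close> by (intro union) (auto simp: W_def)
qed

section \<open>Free groups as groups of reduced words\<close>

lemma inv_letter_inv_letter [simp]: "inv_letter (inv_letter x) = x"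
  by (simp add: inv_letter_def)

lemma inv_letter_neq [simp]: "inv_letter x \<noteq> x" "x \<noteq> inv_letter x"
  by (auto simp: inv_letter_def prod_eq_iff)

lemma fst_inv_letter [simp]: "fst (inv_letter x) = fst x"
  by (simp add: inv_letter_def)

lemma inv_letter_eq_iff [simp]: "inv_letter x = inv_letter y \<longleftrightarrow> x = y"
  by (metis inv_letter_inv_letter)

lemma reduced_Nil [simp]: "reduced []"
  by (simp add: reduced_def)

lemma reduced_single [simp]: "reduced [x]"
  by (simp add: reduced_def)

lemma reduced_Cons_Cons [simp]: "reduced (x # y # w) \<longleftrightarrow> y \<noteq> inv_letter x \<and> reduced (y # w)"
proof
  assume *: "reduced (x # y # w)"
  have "y \<noteq> inv_letter x"
    using *[unfolded reduced_def, rule_format, of 0] by simp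
  moreover have "reduced (y # w)"
    unfolding reduced_def
  proof (intro allI impI)
    fix i assume "Suc i < length (y # w)"
    then show "(y # w) ! Suc i \<noteq> inv_letter ((y # w) ! i)"
      using *[unfolded reduced_def, rule_format, of "Suc i"] by simp
  qed
  ultimately show "y \<noteq> inv_letter x \<and> reduced (y # w)" ..
next
  assume *: "y \<noteq> inv_letter x \<and> reduced (y # w)"
  show "reduced (x # y # w)"
    unfolding reduced_def
  proof (intro allI impI)
    fix i assume i: "Suc i < length (x # y # w)"
    show "(x # y # w) ! Suc i \<noteq> inv_letter ((x # y # w) ! i)"
    proof (cases i)
      case (Suc j)
      then show ?thesis using i * [THEN conjunct2, unfolded reduced_def, rule_format, of j] by simp
    qed (use * in simp)
  qed
qed

lemma reduced_append:
  "reduced (u @ v) \<longleftrightarrow> reduced u \<and> reduced v \<and> (u \<noteq> [] \<longrightarrow> v \<noteq> [] \<longrightarrow> hd v \<noteq> inv_letter (last u))"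
proof (induction u)
  case (Cons x u)
  show ?case
  proof (cases u)
    case Nil
    then show ?thesis by (cases v) auto
  next
    case (Cons y u')
    then show ?thesis using Cons.IH by auto
  qed
qed simp

lemma reduced_append_overlap:
  "reduced (u @ k) \<Longrightarrow> reduced (k @ v) \<Longrightarrow> k \<noteq> [] \<Longrightarrow> reduced (u @ k @ v)"
  by (auto simp: reduced_append)

lemma reduced_red_cons: "reduced w \<Longrightarrow> reduced (red_cons x w)"
proof (cases w)
  case (Cons y ys)
  assume "reduced w"
  moreover have "reduced ys" using \<open>reduced w\<close> Cons reduced_append[of "[y]" ys] by simp
  ultimately show ?thesis using Cons by auto
qed simp

lemma red_cons_inv: "reduced w \<Longrightarrow> red_cons (inv_letter x) (red_cons x w) = w"
proof (cases w)
  case (Cons y ys)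
  assume "reduced w"
  then show ?thesis using Cons by (cases ys) auto
qed simp

lemma reduced_foldr: "reduced w \<Longrightarrow> reduced (foldr red_cons u w)"
  by (induction u) (auto simp: reduced_red_cons)

lemma reduced_reduce [simp]: "reduced (reduce w)"
  by (simp add: reduce_def reduced_foldr)

lemma reduce_Nil [simp]: "reduce [] = []"
  by (simp add: reduce_def)

lemma reduce_Cons: "reduce (x # w) = red_cons x (reduce w)"
  by (simp add: reduce_def)

lemma reduce_reduced: "reduced w \<Longrightarrow> reduce w = w"
proof (induction w)
  case (Cons x w)
  have "reduced w" using Cons.prems reduced_append[of "[x]" w] by simp
  then show ?case using Cons by (cases w) (auto simp: reduce_Cons)
qed simp

lemma reduce_append: "reduce (u @ v) = foldr red_cons u (reduce v)"
  by (simp add: reduce_def)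

text \<open>Van der Waerden's trick: each letter acts on reduced words by \<open>red_cons\<close>,
  and the inverse letter undoes this. So cancelling a pair in \<open>u\<close> does not change the
  action of \<open>u\<close>. Associativity of the product follows from this.\<close>

lemma foldr_reduce: "reduced w \<Longrightarrow> foldr red_cons (reduce u) w = foldr red_cons u w"
proof (induction u)
  case (Cons x u)
  show ?case
  proof (cases "reduce u")
    case Nil
    then show ?thesis using Cons by (simp add: reduce_Cons)
  next
    case (Cons y ys)
    have "foldr red_cons u w = red_cons y (foldr red_cons ys w)"
      using Cons.IH[OF Cons.prems] Cons by simp
    then show ?thesis
      using Cons red_cons_inv[of "foldr red_cons ys w" "inv_letter x"] Cons.prems
      by (auto simp: reduce_Cons reduced_foldr)
  qed
qed simp

lemma reduce_reduce_left [simp]: "reduce (reduce u @ v) = reduce (u @ v)"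
  by (simp add: reduce_append foldr_reduce)

lemma reduce_reduce_right [simp]: "reduce (u @ reduce v) = reduce (u @ v)"
  by (simp add: reduce_append reduce_reduced)

lemma reduce_reduce [simp]: "reduce (reduce u) = reduce u"
  by (simp add: reduce_reduced)

lemma inv_word_Nil [simp]: "inv_word [] = []"
  by (simp add: inv_word_def)

lemma inv_word_eq_Nil [simp]: "inv_word w = [] \<longleftrightarrow> w = []"
  by (simp add: inv_word_def)

lemma inv_word_append [simp]: "inv_word (u @ v) = inv_word v @ inv_word u"
  by (simp add: inv_word_def)

lemma inv_word_Cons: "inv_word (x # v) = inv_word v @ [inv_letter x]"
  by (simp add: inv_word_def)

lemma inv_word_inv_word [simp]: "inv_word (inv_word w) = w"
  by (simp add: inv_word_def rev_map comp_def)

lemma inv_word_eq_iff [simp]: "inv_word u = inv_word v \<longleftrightarrow> u = v"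
  by (metis inv_word_inv_word)

lemma length_inv_word [simp]: "length (inv_word w) = length w"
  by (simp add: inv_word_def)

lemma set_inv_word: "set (inv_word w) = inv_letter ` set w"
  by (simp add: inv_word_def)

lemma reduced_inv_word_if: "reduced w \<Longrightarrow> reduced (inv_word w)"
proof (induction w)
  case (Cons x w)
  have "reduced w" using Cons.prems reduced_append[of "[x]" w] by simp
  moreover have "last (inv_word w) = inv_letter (hd w)" if "w \<noteq> []"
    using that by (simp add: inv_word_def last_rev hd_map)
  ultimately show ?case
    using Cons by (cases w) (auto simp: inv_word_Cons reduced_append)
qed simp

lemma reduced_inv_word [simp]: "reduced (inv_word w) \<longleftrightarrow> reduced w"
  by (metis reduced_inv_word_if inv_word_inv_word)

lemma foldr_inv_word: "reduced v \<Longrightarrow> foldr red_cons (inv_word w) (foldr red_cons w v) = v"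
  by (induction w) (auto simp: inv_word_Cons red_cons_inv reduced_foldr)

lemma reduce_inv_word_cancel [simp]: "reduce (inv_word w @ w @ v) = reduce v"
  by (simp add: reduce_append foldr_inv_word)

lemma reduce_inv_word_cancel' [simp]: "reduce (w @ inv_word w @ v) = reduce v"
  using reduce_inv_word_cancel[of "inv_word w" v] by simp

lemma reduce_inv_word_left [simp]: "reduce (inv_word w @ w) = []"
  using reduce_inv_word_cancel[of w "[]"] by simp

lemma reduce_inv_word_right [simp]: "reduce (w @ inv_word w) = []"
  using reduce_inv_word_cancel'[of w "[]"] by simp

lemma reduce_cancel_mid: "reduce (u @ b @ inv_word b @ v) = reduce (u @ v)"
  by (metis reduce_inv_word_cancel' reduce_reduce_right)

lemma inv_word_reduce: "inv_word (reduce w) = reduce (inv_word w)"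
proof -
  have "reduce (inv_word w) = reduce (inv_word w @ w @ inv_word (reduce w))"
    by (metis append.assoc append_Nil2 reduce_inv_word_right reduce_reduce_left reduce_reduce_right)
  then show ?thesis by (simp add: reduce_reduced)
qed

lemma set_red_cons: "set (red_cons x w) \<subseteq> insert x (set w)"
  by (cases w) auto

lemma set_reduce: "set (reduce w) \<subseteq> set w"
proof (induction w)
  case (Cons x w)
  then show ?case using set_red_cons[of x "reduce w"] by (auto simp: reduce_Cons)
qed simp

lemma in_free_group: "w \<in> carrier (free_group n) \<longleftrightarrow> reduced w \<and> (\<forall>l\<in>set w. fst l < n)"
  by (simp add: free_group_def)

lemma mult_free_group [simp]: "u \<otimes>\<^bsub>free_group n\<^esub> v = reduce (u @ v)"
  by (simp add: free_group_def)

lemma one_free_group [simp]: "\<one>\<^bsub>free_group n\<^esub> = []"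
  by (simp add: free_group_def)

lemma reduce_in_free_group: "(\<And>l. l \<in> set w \<Longrightarrow> fst l < n) \<Longrightarrow> reduce w \<in> carrier (free_group n)"
  using set_reduce by (auto simp: in_free_group)

lemma inv_word_in_free_group: "w \<in> carrier (free_group n) \<Longrightarrow> inv_word w \<in> carrier (free_group n)"
  by (auto simp: in_free_group set_inv_word)

lemma group_free_group: "group (free_group n)"
proof (rule groupI)
  fix x y z assume xyz: "x \<in> carrier (free_group n)" "y \<in> carrier (free_group n)" "z \<in> carrier (free_group n)"
  show "x \<otimes>\<^bsub>free_group n\<^esub> y \<in> carrier (free_group n)"
    using xyz set_reduce[of "x @ y"] by (fastforce simp: in_free_group)
  show "x \<otimes>\<^bsub>free_group n\<^esub> y \<otimes>\<^bsub>free_group n\<^esub> z = x \<otimes>\<^bsub>free_group n\<^esub> (y \<otimes>\<^bsub>free_group n\<^esub> z)"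
    by simp
  show "\<one>\<^bsub>free_group n\<^esub> \<otimes>\<^bsub>free_group n\<^esub> x = x"
    using xyz by (simp add: in_free_group reduce_reduced)
  show "\<exists>y\<in>carrier (free_group n). y \<otimes>\<^bsub>free_group n\<^esub> x = \<one>\<^bsub>free_group n\<^esub>"
    using xyz inv_word_in_free_group by (intro bexI[of _ "inv_word x"]) auto
qed (simp add: in_free_group)

lemma inv_free_group: "w \<in> carrier (free_group n) \<Longrightarrow> inv\<^bsub>free_group n\<^esub> w = inv_word w"
  by (rule group.inv_equality[OF group_free_group]) (auto simp: inv_word_in_free_group)

section \<open>Nielsen reduction\<close>

lemma cancellation:
  assumes "reduced s" "reduced t"
  obtains a b c where "s = a @ b" "t = inv_word b @ c" "reduced (a @ c)"
  using assms
proof (induction s arbitrary: t thesis rule: rev_induct)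
  case Nil
  then show ?case by (metis append_Nil inv_word_Nil)
next
  case (snoc x s)
  show ?case
  proof (cases "t \<noteq> [] \<and> hd t = inv_letter x")
    case True
    then obtain t' where t: "t = inv_letter x # t'" by (cases t) auto
    then have "reduced t'" using snoc.prems(3) reduced_append[of "[inv_letter x]" t'] by simp
    moreover have "reduced s" using snoc.prems(2) reduced_append by blast
    ultimately obtain a b c where "s = a @ b" "t' = inv_word b @ c" "reduced (a @ c)"
      using snoc.IH by metis
    then show ?thesis using t snoc.prems(1)[of a "b @ [x]" c] by (simp add: inv_word_Cons)
  next
    case False
    then have "reduced ((s @ [x]) @ t)"
      using reduced_append[of "s @ [x]" t] snoc.prems(2,3) by auto
    then show ?thesis using snoc.prems(1)[of "s @ [x]" "[]" t] by simp
  qed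
qed

section \<open>Nielsen's order on words\<close>

definition letter_code :: "letter \<Rightarrow> nat"
  where "letter_code l = 2 * fst l + (if snd l then 1 else 0)"

text \<open>The word read as a numeral in base \<open>m\<close>. For \<open>m = 2 * n\<close> it
  orders the words of a fixed length over \<open>n\<close> generators lexicographically.\<close>

fun wval :: "nat \<Rightarrow> word \<Rightarrow> nat" where
  "wval m [] = 0"
| "wval m (x # w) = letter_code x * m ^ length w + wval m w"

lemma wval_append: "wval m (u @ v) = wval m u * m ^ length v + wval m v"
  by (induction u) (auto simp: algebra_simps power_add)

lemma letter_code_inj: "letter_code x = letter_code y \<Longrightarrow> x = y"
  by (cases x; cases y) (auto simp: letter_code_def split: if_splits, presburger+)

lemma letter_code_less: "fst x < n \<Longrightarrow> letter_code x < 2 * n"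
  by (auto simp: letter_code_def)

lemma wval_less: "(\<And>l. l \<in> set w \<Longrightarrow> fst l < n) \<Longrightarrow> wval (2 * n) w < (2 * n) ^ length w"
proof (induction w)
  case (Cons x w)
  have "letter_code x * (2 * n) ^ length w + wval (2 * n) w < (letter_code x + 1) * (2 * n) ^ length w"
    using Cons by simp
  also have "\<dots> \<le> (2 * n) * (2 * n) ^ length w"
    using letter_code_less[of x n] Cons.prems by (intro mult_right_mono) auto
  finally show ?case by simp
qed simp

lemma wval_inj:
  assumes "length u = length v" "wval (2 * n) u = wval (2 * n) v"
    "\<And>l. l \<in> set u \<Longrightarrow> fst l < n" "\<And>l. l \<in> set v \<Longrightarrow> fst l < n"
  shows "u = v"
  using assms
proof (induction u v rule: list_induct2)
  case (Cons x u y v)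
  define M where "M = (2 * n) ^ length u"
  have lt: "wval (2 * n) u < M" "wval (2 * n) v < M"
    using wval_less[of u n] wval_less[of v n] Cons by (auto simp: M_def)
  have eq: "letter_code x * M + wval (2 * n) u = letter_code y * M + wval (2 * n) v"
    using Cons by (simp add: M_def)
  have "letter_code x = letter_code y"
    using arg_cong[OF eq, of "\<lambda>z. z div M"] lt by simp
  then show ?case using eq Cons letter_code_inj by auto
qed simp

definition half :: "word \<Rightarrow> word"
  where "half w = take ((length w + 1) div 2) w"

text \<open>Nielsen's tie-break between words of equal length compares their initial halves and
  those of their inverses. Here the two values are added: the sum is invariant under inversion, and
  it is strictly monotone when only one half changes.\<close>

definition half_weight :: "nat \<Rightarrow> word \<Rightarrow> nat"
  where "half_weight m w = wval m (half w) + wval m (half (inv_word w))"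

lemma half_weight_inv_word [simp]: "half_weight m (inv_word w) = half_weight m w"
  by (simp add: half_weight_def)

text \<open>A prefix of at most half the length lies inside the first half, and the other half is
  read off from \<open>q\<close> alone. So exchanging \<open>p\<close> for \<open>l\<close> changes
  one summand only.\<close>

lemma half_weight_le_iff:
  assumes "length l = length p" "length p \<le> length q" "0 < m"
  shows "half_weight m (p @ q) \<le> half_weight m (l @ q) \<longleftrightarrow> wval m p \<le> wval m l"
proof -
  define j where "j = (length p + length q + 1) div 2"
  have j: "length p \<le> j" "j \<le> length q" using assms by (auto simp: j_def)
  have 1: "half (x @ q) = x @ take (j - length p) q" if "length x = length p" for x
    using that j by (simp add: half_def j_def)
  have 2: "half (inv_word (x @ q)) = take j (inv_word q)" if "length x = length p" for x
    using that j by (simp add: half_def j_def algebra_simps)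
  show ?thesis
    using assms by (simp add: half_weight_def 1 2 wval_append del: inv_word_append)
qed

lemma half_weight_le_iff':
  assumes "length b = length c" "length b \<le> length a" "0 < m"
  shows "half_weight m (a @ b) \<le> half_weight m (a @ c) \<longleftrightarrow> wval m (inv_word b) \<le> wval m (inv_word c)"
  using half_weight_le_iff[of "inv_word c" "inv_word b" "inv_word a" m] assms
  by (metis half_weight_inv_word inv_word_append length_inv_word)

definition nlen :: "nat \<Rightarrow> word \<Rightarrow> nat \<times> nat"
  where "nlen n w = (length w, half_weight (2 * n) w)"

lemma nlen_inv_word [simp]: "nlen n (inv_word w) = nlen n w"
  by (simp add: nlen_def)

text \<open>\<open>nlen\<close> cannot tell a word from its inverse. The last component can, and it
  makes the rank injective, so that bases may be compared element by element.\<close>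

definition nrank :: "nat \<Rightarrow> word \<Rightarrow> (nat \<times> nat) \<times> nat"
  where "nrank n w = (nlen n w, wval (2 * n) w)"

lemma nrank_inj:
  assumes "nrank n u = nrank n v" "u \<in> carrier (free_group n)" "v \<in> carrier (free_group n)"
  shows "u = v"
  using assms by (intro wval_inj[of u v n]) (auto simp: nrank_def nlen_def in_free_group)

text \<open>The invariant carried along a product of elements of a Nielsen reduced set: \<open>u\<close> is the product so
  far, \<open>s\<close> its last factor, and \<open>q\<close> the final segment of \<open>s\<close> that has survived in \<open>u\<close>.\<close>

definition nielsen_inv :: "nat \<Rightarrow> word \<Rightarrow> word \<Rightarrow> bool" where
  "nielsen_inv n u s \<longleftrightarrow> (\<exists>l p q. u = l @ q \<and> s = p @ q \<and> length p \<le> length l \<and>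
     (length p = length l \<longrightarrow> wval (2 * n) p \<le> wval (2 * n) l) \<and> length p \<le> length q \<and>
     (length p = length q \<longrightarrow> wval (2 * n) p < wval (2 * n) (inv_word q)))"

lemma nielsen_inv_refl: "s \<noteq> [] \<Longrightarrow> nielsen_inv n s s"
  unfolding nielsen_inv_def by (intro exI[of _ "[]"] exI[of _ s]) auto

lemma nielsen_inv_nlen:
  assumes "nielsen_inv n u s" "u \<in> carrier (free_group n)" "s \<in> carrier (free_group n)" "0 < n"
  shows "u = s \<or> nlen n s < nlen n u"
proof -
  obtain l p q where *: "u = l @ q" "s = p @ q" "length p \<le> length l"
     "length p = length l \<longrightarrow> wval (2 * n) p \<le> wval (2 * n) l" "length p \<le> length q"
    using assms(1) by (auto simp: nielsen_inv_def)
  show ?thesis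
  proof (cases "length p = length l")
    case True
    show ?thesis
    proof (cases "wval (2 * n) p = wval (2 * n) l")
      case True
      then have "p = l"
        using \<open>length p = length l\<close> * assms by (intro wval_inj[of p l n]) (auto simp: in_free_group)
      then show ?thesis using * by simp
    next
      case False
      then have "\<not> wval (2 * n) l \<le> wval (2 * n) p" using * True by simp
      then have "half_weight (2 * n) s < half_weight (2 * n) u"
        using half_weight_le_iff[of p l q "2 * n"] True * assms(4) by simp
      then show ?thesis using * True by (simp add: nlen_def)
    qed
  next
    case False
    then show ?thesis using * by (simp add: nlen_def)
  qed
qed

text \<open>Nielsen's conditions, meant for a set closed under inverses, with \<open>nlen\<close> in
  place of the length. The usual third condition, that no factor is swallowed by its two neighbours,
  is not listed: the tie-break in \<open>nlen\<close> enforces it.\<close>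

definition nielsen_symmetric :: "nat \<Rightarrow> word set \<Rightarrow> bool" where
  "nielsen_symmetric n S \<longleftrightarrow> S \<subseteq> carrier (free_group n) \<and> [] \<notin> S \<and>
     (\<forall>s\<in>S. \<forall>t\<in>S. t \<noteq> inv_word s \<longrightarrow> nlen n s \<le> nlen n (reduce (s @ t)) \<and> nlen n t \<le> nlen n (reduce (s @ t)))"

text \<open>Let \<open>b\<close> be what cancels between \<open>s\<close> and \<open>t\<close>.
  Reducedness of the pair keeps \<open>b\<close> within half of \<open>s\<close> and half of
  \<open>t\<close>, while the invariant says that at most half of \<open>s\<close> was lost on its
  left. A nonempty middle piece \<open>k\<close> of \<open>s\<close> therefore survives and shields
  the earlier part of the product from \<open>t\<close>; the only danger is that both losses are
  exact halves.\<close>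

lemma nielsen_inv_step:
  assumes "nielsen_inv n u s" "u \<in> carrier (free_group n)" "nielsen_symmetric n S" "s \<in> S" "t \<in> S"
    "t \<noteq> inv_word s" "0 < n"
  shows "nielsen_inv n (reduce (u @ t)) t \<and> nlen n u < nlen n (reduce (u @ t))"
proof -
  let ?v = "wval (2 * n)"
  have st: "s \<in> carrier (free_group n)" "t \<in> carrier (free_group n)" "t \<noteq> []"
    and ge: "nlen n s \<le> nlen n (reduce (s @ t))" "nlen n t \<le> nlen n (reduce (s @ t))"
    using assms by (auto simp: nielsen_symmetric_def)
  obtain a b c where abc: "s = a @ b" "t = inv_word b @ c" "reduced (a @ c)"
    using cancellation[of s t] st by (metis in_free_group)
  have "reduce (s @ t) = a @ c"
    using abc by (simp add: reduce_cancel_mid reduce_reduced)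
  then have ge: "nlen n s \<le> nlen n (a @ c)" "nlen n t \<le> nlen n (a @ c)" using ge by auto
  have len: "length b \<le> length a" "length b \<le> length c"
    using ge abc by (auto simp: nlen_def)
  have bc: "?v (inv_word b) < ?v (inv_word c)" if "length c = length b"
  proof -
    have "half_weight (2 * n) (a @ b) \<le> half_weight (2 * n) (a @ c)"
      using ge(1) abc that by (simp add: nlen_def)
    then have "?v (inv_word b) \<le> ?v (inv_word c)"
      using half_weight_le_iff'[of b c a "2 * n"] that len assms(7) by simp
    moreover have "?v (inv_word b) \<noteq> ?v (inv_word c)"
    proof
      assume "?v (inv_word b) = ?v (inv_word c)"
      then have "inv_word b = inv_word c"
      proof (intro wval_inj[of "inv_word b" "inv_word c" n])
        have "\<forall>l\<in>set b. fst l < n" "\<forall>l\<in>set c. fst l < n" using st abc by (auto simp: in_free_group)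
        then show "\<And>l. l \<in> set (inv_word b) \<Longrightarrow> fst l < n" "\<And>l. l \<in> set (inv_word c) \<Longrightarrow> fst l < n"
          by (metis fst_inv_letter imageE set_inv_word)+
      qed (use that in auto)
      then have "t = inv_word b @ b" using abc by simp
      then have "reduce t = []" by simp
      then show False using st by (simp add: in_free_group reduce_reduced)
    qed
    ultimately show ?thesis by simp
  qed
  have ba: "?v (inv_word b) \<le> ?v a" if "length a = length b"
    using ge(2) abc that len half_weight_le_iff[of a "inv_word b" c "2 * n"] assms(7) by (simp add: nlen_def)
  obtain l p q where lpq: "u = l @ q" "s = p @ q" "length p \<le> length l"
     "length p = length l \<longrightarrow> ?v p \<le> ?v l" "length p \<le> length q"
     "length p = length q \<longrightarrow> ?v p < ?v (inv_word q)"
    using assms(1) by (auto simp: nielsen_inv_def)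
  have "length p + length q = length a + length b" using lpq abc by (metis length_append)
  then have "length p \<le> length a" using lpq len by linarith
  \<comment> \<open>If both halves of \<open>s\<close> were lost, then \<open>p = a\<close> and
    \<open>q = b\<close>. The invariant would give \<open>wval p < wval (inv_word b)\<close> and the
    pair condition \<open>wval (inv_word b) \<le> wval a\<close>, a contradiction.\<close>
  have "length p < length a"
  proof (rule ccontr)
    assume "\<not> length p < length a"
    then have "length p = length a" using \<open>length p \<le> length a\<close> by simp
    then have "p = a" "q = b" using lpq abc by (metis append_eq_append_conv)+
    then show False using lpq ba len by simp
  qed
  then obtain k where k: "a = p @ k" "q = k @ b" "k \<noteq> []"
    using lpq(2) abc(1) by (auto simp: append_eq_append_conv2)
  have red: "reduced (l @ k @ c)"
    using reduced_append_overlap[of l k c] abc k lpq assms(2)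
    by (auto simp: in_free_group reduced_append)
  have eq: "reduce (u @ t) = (l @ k) @ c"
    using lpq k abc reduce_cancel_mid[of "l @ k" b c] red by (simp add: reduce_reduced)
  have "nielsen_inv n ((l @ k) @ c) t"
    unfolding nielsen_inv_def
  proof (intro exI conjI impI)
    show "t = inv_word b @ c" by fact
    show "length (inv_word b) \<le> length (l @ k)" "length (inv_word b) \<le> length c"
      using len k lpq by auto
    show "?v (inv_word b) < ?v (inv_word c)" if "length (inv_word b) = length c"
      using bc that by simp
    show "?v (inv_word b) \<le> ?v (l @ k)" if "length (inv_word b) = length (l @ k)"
    proof -
      have *: "length p = length l" "length a = length b" using that len k lpq by auto
      then have "?v (inv_word b) \<le> ?v (p @ k)" using ba k by simp
      also have "\<dots> \<le> ?v (l @ k)" using lpq * by (simp add: wval_append)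
      finally show ?thesis .
    qed
  qed simp
  moreover have "nlen n u < nlen n ((l @ k) @ c)"
  proof (cases "length c = length b")
    case True
    have "\<not> half_weight (2 * n) ((l @ k) @ c) \<le> half_weight (2 * n) ((l @ k) @ b)"
      using half_weight_le_iff'[of c b "l @ k" "2 * n"] True bc len k lpq assms(7) by simp
    then show ?thesis using lpq k True by (simp add: nlen_def)
  next
    case False
    then show ?thesis using lpq k len by (simp add: nlen_def)
  qed
  ultimately show ?thesis by (simp add: eq)
qed

lemma concat_in_free_group:
  "set xs \<subseteq> carrier (free_group n) \<Longrightarrow> reduce (concat xs) \<in> carrier (free_group n)"
  by (rule reduce_in_free_group) (fastforce simp: in_free_group)

text \<open>\<open>nlen\<close> of the partial products strictly increases, and each factor is at
  most the partial product that it ends. So every factor except the last is strictly below the whole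
  product.\<close>

lemma nielsen_product:
  assumes "nielsen_symmetric n S" "0 < n" "xs \<noteq> []" "set xs \<subseteq> S"
    "\<And>i. Suc i < length xs \<Longrightarrow> xs ! Suc i \<noteq> inv_word (xs ! i)"
  shows "nielsen_inv n (reduce (concat xs)) (last xs) \<and> (\<forall>s\<in>set (butlast xs). nlen n s < nlen n (reduce (concat xs)))"
  using assms(3-)
proof (induction xs rule: rev_nonempty_induct)
  case (single x)
  then have "x \<noteq> []" "reduced x"
    using assms(1) by (auto simp: nielsen_symmetric_def in_free_group subset_eq)
  then show ?case using nielsen_inv_refl by (simp add: reduce_reduced)
next
  case (snoc t xs)
  let ?u = "reduce (concat xs)"
  have IH: "nielsen_inv n ?u (last xs)" "\<And>s. s \<in> set (butlast xs) \<Longrightarrow> nlen n s < nlen n ?u"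
  proof -
    have "xs ! Suc i \<noteq> inv_word (xs ! i)" if "Suc i < length xs" for i
      using snoc.prems(2)[of i] that by (simp add: nth_append)
    then show "nielsen_inv n ?u (last xs)" "\<And>s. s \<in> set (butlast xs) \<Longrightarrow> nlen n s < nlen n ?u"
      using snoc by auto
  qed
  have S: "S \<subseteq> carrier (free_group n)" using assms(1) by (auto simp: nielsen_symmetric_def)
  have uc: "?u \<in> carrier (free_group n)" using snoc.prems S by (intro concat_in_free_group) auto
  have l: "last xs \<in> S" "t \<in> S" using snoc by (auto simp: subset_eq)
  have "t \<noteq> inv_word (last xs)"
    using snoc.prems(2)[of "length xs - 1"] snoc.hyps by (simp add: nth_append last_conv_nth)
  then have step: "nielsen_inv n (reduce (?u @ t)) t" "nlen n ?u < nlen n (reduce (?u @ t))"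
    using nielsen_inv_step[OF IH(1) uc assms(1) l _ assms(2)] by auto
  have "nlen n (last xs) \<le> nlen n ?u"
    using nielsen_inv_nlen[OF IH(1) uc _ assms(2)] l S by (metis less_imp_le order_refl subsetD)
  then have "nlen n s < nlen n (reduce (?u @ t))" if "s \<in> set xs" for s
  proof (cases "s \<in> set (butlast xs)")
    case True
    then show ?thesis using IH(2) step(2) by (meson less_trans)
  next
    case False
    then have "s = last xs" using that
      by (metis append_butlast_last_id empty_iff empty_set in_set_conv_decomp rotate1.simps(2) set_ConsD set_rotate1 snoc.hyps)
    then show ?thesis using \<open>nlen n (last xs) \<le> nlen n ?u\<close> step(2) by simp
  qed
  then show ?case using step by simp
qed

lemma generate_free_group_product:
  assumes "h \<in> generate (free_group n) T" "T \<subseteq> carrier (free_group n)"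
  shows "\<exists>xs. set xs \<subseteq> T \<union> inv_word ` T \<and> h = reduce (concat xs)"
  using assms(1)
proof (induction rule: generate.induct)
  case one
  then show ?case by (intro exI[of _ "[]"]) simp
next
  case (incl h)
  then show ?case using assms(2) by (intro exI[of _ "[h]"]) (auto simp: in_free_group reduce_reduced)
next
  case (inv h)
  then have "h \<in> carrier (free_group n)" using assms(2) by auto
  then show ?case using inv
    by (intro exI[of _ "[inv_word h]"]) (auto simp: inv_free_group in_free_group reduce_reduced)
next
  case (eng h1 h2)
  then obtain xs ys where "set xs \<subseteq> T \<union> inv_word ` T" "h1 = reduce (concat xs)"
    "set ys \<subseteq> T \<union> inv_word ` T" "h2 = reduce (concat ys)" by blast
  then show ?case by (intro exI[of _ "xs @ ys"]) auto
qed

lemma reduced_product: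
  assumes "h = reduce (concat xs)" "set xs \<subseteq> S"
  shows "\<exists>ys. set ys \<subseteq> S \<and> h = reduce (concat ys) \<and> (\<forall>i. Suc i < length ys \<longrightarrow> ys ! Suc i \<noteq> inv_word (ys ! i))"
  using assms
proof (induction "length xs" arbitrary: xs rule: less_induct)
  case less
  show ?case
  proof (cases "\<forall>i. Suc i < length xs \<longrightarrow> xs ! Suc i \<noteq> inv_word (xs ! i)")
    case True
    then show ?thesis using less.prems by blast
  next
    case False
    then obtain i where i: "Suc i < length xs" "xs ! Suc i = inv_word (xs ! i)" by blast
    have xs: "xs = take i xs @ xs ! i # inv_word (xs ! i) # drop (Suc (Suc i)) xs"
      using i by (metis Cons_nth_drop_Suc Suc_lessD append_take_drop_id)
    define ys where "ys = take i xs @ drop (Suc (Suc i)) xs"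
    have "reduce (concat xs) = reduce (concat ys)"
      by (subst xs) (simp add: ys_def reduce_cancel_mid)
    moreover have "set ys \<subseteq> S"
      using less.prems(2) by (auto simp: ys_def dest: in_set_takeD in_set_dropD)
    moreover have "length ys < length xs" using i by (simp add: ys_def)
    ultimately show ?thesis using less by metis
  qed
qed

text \<open>In a product without adjacent inverses every factor has smaller \<open>nlen\<close> than
  \<open>h\<close>, or \<open>h\<close> is itself a factor. This is the minimality of Nielsen
  reduced sets, in the form in which it is played off against a competing smaller basis.\<close>

lemma generate_nrank_le:
  assumes T: "T \<subseteq> carrier (free_group n)" "nielsen_symmetric n (T \<union> inv_word ` T)"
    and sgn: "\<And>t. t \<in> T \<Longrightarrow> nrank n t \<le> nrank n (inv_word t)"
    and h: "h \<in> generate (free_group n) T" and n: "0 < n"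
  shows "h \<in> generate (free_group n) {t \<in> T. nrank n t \<le> nrank n h}" (is "h \<in> generate _ ?U")
proof -
  interpret F: group "free_group n" by (rule group_free_group)
  have U: "?U \<subseteq> carrier (free_group n)" using T by auto
  \<comment> \<open>If \<open>h\<close> is the inverse of some \<open>t\<close> in \<open>T\<close>,
    then \<open>nlen\<close> does not separate them, and \<open>sgn\<close> ensures that
    \<open>t\<close> has the smaller rank.\<close>
  have inU: "s \<in> generate (free_group n) ?U" if sT: "s \<in> T \<union> inv_word ` T" and sh: "s = h \<or> nlen n s < nlen n h" for s
  proof -
    obtain t where t: "t \<in> T" "s = t \<or> s = inv_word t" using sT by blast
    have "nrank n t \<le> nrank n h"
    proof (cases "s = h")
      case True
      then show ?thesis using t sgn by auto
    next
      case False
      then have "nlen n t < nlen n h" using sh t by auto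
      then show ?thesis by (simp add: nrank_def)
    qed
    then have "t \<in> ?U" using t by simp
    then have "t \<in> generate (free_group n) ?U" "inv\<^bsub>free_group n\<^esub> t \<in> generate (free_group n) ?U"
      by (auto intro: generate.incl generate.inv)
    then show ?thesis using t T inv_free_group by auto
  qed
  obtain xs where xs: "set xs \<subseteq> T \<union> inv_word ` T" "h = reduce (concat xs)"
      "\<And>i. Suc i < length xs \<Longrightarrow> xs ! Suc i \<noteq> inv_word (xs ! i)"
    using generate_free_group_product[OF h T(1)] reduced_product by metis
  show ?thesis
  proof (cases "xs = []")
    case True
    then show ?thesis using xs generate.one[of "free_group n"] by simp
  next
    case False
    have inv: "nielsen_inv n h (last xs)" "\<And>s. s \<in> set (butlast xs) \<Longrightarrow> nlen n s < nlen n h"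
      using nielsen_product[OF T(2) n False xs(1,3)] xs(2) by auto
    have Sc: "T \<union> inv_word ` T \<subseteq> carrier (free_group n)" using T(2) by (simp add: nielsen_symmetric_def)
    have hc: "h \<in> carrier (free_group n)" using h F.generate_in_carrier T by blast
    have lastS: "last xs \<in> T \<union> inv_word ` T" using xs(1) False last_in_set by blast
    consider "h = last xs" | "nlen n (last xs) < nlen n h"
      using nielsen_inv_nlen[OF inv(1) hc _ n] lastS Sc by auto
    then show ?thesis
    proof cases
      case 1
      then show ?thesis using inU[OF lastS] by simp
    next
      case 2
      have "s \<in> generate (free_group n) ?U" if "s \<in> set xs" for s
      proof (rule inU)
        show "s \<in> T \<union> inv_word ` T" using that xs by auto
        have "s \<in> set (butlast xs) \<or> s = last xs"
          using that False by (metis append_butlast_last_id Un_iff empty_iff insert_iff list.set(1) list.set(2) set_append)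
        then show "s = h \<or> nlen n s < nlen n h" using inv 2 by auto
      qed
      then have "reduce (concat xs) \<in> generate (free_group n) ?U"
      proof (induction xs)
        case Nil
        then show ?case using generate.one[of "free_group n"] by simp
      next
        case (Cons x xs)
        then have "x \<otimes>\<^bsub>free_group n\<^esub> reduce (concat xs) \<in> generate (free_group n) ?U"
          by (intro generate.eng) auto
        then show ?case by simp
      qed
      then show ?thesis using xs by simp
    qed
  qed
qed

text \<open>Replacing \<open>s\<close> by \<open>s s\<close> is not an elementary move, so it must
  be excluded that a shortening product uses the same element twice. Cancelling half of
  \<open>s\<close> or more against itself would force a nonempty reduced word to equal its inverse,
  or \<open>s\<close> to be trivial.\<close>

lemma length_square:
  assumes "reduced s" "s \<noteq> []"
  shows "length s < length (reduce (s @ s))"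
proof -
  obtain a b c where abc: "s = a @ b" "s = inv_word b @ c" "reduced (a @ c)"
    using cancellation[OF assms(1) assms(1)] by metis
  have "reduce (s @ s) = reduce ((a @ b) @ (inv_word b @ c))" using abc by metis
  then have eq: "reduce (s @ s) = a @ c" using abc(3) by (simp add: reduce_cancel_mid reduce_reduced)
  have len: "length a = length c" using abc(1,2) by (metis add_diff_cancel_left' add_diff_cancel_right' length_append length_inv_word)
  have "length b < length a"
  proof (rule ccontr)
    assume "\<not> length b < length a"
    moreover have "a @ b = inv_word b @ c" using abc(1,2) by simp
    ultimately obtain d where d: "b = d @ c" "inv_word b = a @ d"
      by (metis append_eq_append_conv_if append_take_drop_id length_inv_word not_less)
    then have "inv_word c @ inv_word d = a @ d" by simp
    \<comment> \<open>A nonempty reduced word is never its own inverse: in even length the two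
      middle letters would cancel, in odd length the middle letter would be its own inverse.\<close>
    then have "d = inv_word d" using len by (metis append_eq_append_conv length_inv_word)
    have "d = []"
    proof (rule ccontr)
      assume "d \<noteq> []"
      show False
      proof (cases "even (length d)")
        case True
        define e where "e = take (length d div 2) d"
        define f where "f = drop (length d div 2) d"
        have "d = e @ f" "length e = length f" using True by (auto simp: e_def f_def)
        then have "inv_word d = inv_word f @ inv_word e" by simp
        then have ef: "e @ f = inv_word f @ inv_word e"
          using \<open>d = inv_word d\<close> \<open>d = e @ f\<close> by metis
        have "length e = length (inv_word f)" using \<open>length e = length f\<close> by simp
        then have "e = inv_word f"
          using ef append_eq_append_conv by blast
        then have "d = inv_word f @ f" using \<open>d = e @ f\<close> by simp
        moreover have "reduced d" using assms(1) abc(1) d(1) by (simp add: reduced_append)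
        ultimately show False using \<open>d \<noteq> []\<close> reduce_reduced[of d] by simp
      next
        case False
        define i where "i = length d div 2"
        have i: "i < length d" "length d - Suc i = i" using False \<open>d \<noteq> []\<close> by (auto simp: i_def elim!: oddE)
        have "d ! i = inv_word d ! i" using \<open>d = inv_word d\<close> by metis
        also have "\<dots> = inv_letter (d ! i)" using i by (simp add: inv_word_def rev_nth)
        finally show False by simp
      qed
    qed
    then have "s = inv_word b @ b" using abc d by simp
    then have "reduce s = []" by simp
    then show False using assms by (simp add: reduce_reduced)
  qed
  then show ?thesis using eq abc(1) len by simp
qed

section \<open>Automorphisms of free groups\<close>

definition subst :: "(letter \<Rightarrow> word) \<Rightarrow> word \<Rightarrow> word"
  where "subst f w = reduce (concat (map f w))"

definition inv_compat :: "(letter \<Rightarrow> word) \<Rightarrow> bool"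
  where "inv_compat f \<longleftrightarrow> (\<forall>l. f (inv_letter l) = inv_word (f l))"

lemma subst_Nil [simp]: "subst f [] = []"
  by (simp add: subst_def)

lemma subst_append: "subst f (u @ v) = reduce (subst f u @ subst f v)"
  by (simp add: subst_def)

lemma reduced_subst [simp]: "reduced (subst f w)"
  by (simp add: subst_def)

lemma subst_Cons: "subst f (x # w) = reduce (f x @ subst f w)"
  by (simp add: subst_def)

lemma subst_red_cons: "inv_compat f \<Longrightarrow> subst f (red_cons x w) = subst f (x # w)"
proof (cases w)
  case (Cons y ys)
  assume "inv_compat f"
  then have "f (inv_letter x) = inv_word (f x)" unfolding inv_compat_def by blast
  then show ?thesis using Cons by (simp add: subst_def)
qed simp

lemma subst_reduce: "inv_compat f \<Longrightarrow> subst f (reduce w) = subst f w"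
  by (induction w) (auto simp: reduce_Cons subst_red_cons subst_Cons)

lemma subst_in_free_group:
  assumes "\<And>l. l \<in> set w \<Longrightarrow> f l \<in> carrier (free_group m)"
  shows "subst f w \<in> carrier (free_group m)"
  unfolding subst_def by (rule concat_in_free_group) (use assms in auto)

lemma letter_in_free_group: "[l] \<in> carrier (free_group n) \<longleftrightarrow> fst l < n"
  by (simp add: in_free_group)

lemma hom_inv_word:
  assumes "\<phi> \<in> hom (free_group n) (free_group m)" "w \<in> carrier (free_group n)"
  shows "\<phi> (inv_word w) = inv_word (\<phi> w)"
proof -
  interpret group_hom "free_group n" "free_group m" \<phi>
    using assms by (simp add: group_hom_def group_hom_axioms_def group_free_group)
  show ?thesis using hom_inv[OF assms(2)] assms(2) hom_closed by (simp add: inv_free_group)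
qed

lemma hom_eqI:
  assumes "\<phi> \<in> hom (free_group n) (free_group m)" "\<psi> \<in> hom (free_group n) (free_group m)"
    and "\<And>i. i < n \<Longrightarrow> \<phi> [(i, False)] = \<psi> [(i, False)]" and "w \<in> carrier (free_group n)"
  shows "\<phi> w = \<psi> w"
proof -
  have one: "\<phi> [] = []" "\<psi> [] = []"
    using assms(1,2) group_hom.hom_one[of "free_group n" "free_group m"]
    by (auto simp: group_hom_def group_hom_axioms_def group_free_group)
  have letter: "\<phi> [l] = \<psi> [l]" if "fst l < n" for l
  proof (cases l)
    case (Pair i b)
    have "[(i, True)] = inv_word [(i, False)]" by (simp add: inv_word_def inv_letter_def)
    then have "\<phi> [(i, True)] = inv_word (\<phi> [(i, False)])" "\<psi> [(i, True)] = inv_word (\<psi> [(i, False)])"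
      using hom_inv_word[OF assms(1), of "[(i, False)]"] hom_inv_word[OF assms(2), of "[(i, False)]"] that Pair
      by (simp_all add: letter_in_free_group)
    then have "\<phi> [(i, True)] = \<psi> [(i, True)]" using assms(3) that Pair by simp
    then show ?thesis using Pair that assms(3) by (cases b) auto
  qed
  show ?thesis using assms(4)
  proof (induction w)
    case (Cons x w)
    have w: "w \<in> carrier (free_group n)" "[x] \<in> carrier (free_group n)"
      using Cons.prems reduced_append[of "[x]" w] by (auto simp: in_free_group)
    have eq: "x # w = [x] \<otimes>\<^bsub>free_group n\<^esub> w"
      using Cons.prems by (simp add: in_free_group reduce_reduced)
    have "\<phi> (x # w) = \<phi> [x] \<otimes>\<^bsub>free_group m\<^esub> \<phi> w" "\<psi> (x # w) = \<psi> [x] \<otimes>\<^bsub>free_group m\<^esub> \<psi> w"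
      unfolding eq using assms(1,2) w by (auto simp: hom_def simp del: mult_free_group)
    then show ?case using Cons.IH w letter[of x] by (simp add: letter_in_free_group)
  qed (simp add: one)
qed

abbreviation Aut :: "nat \<Rightarrow> (word \<Rightarrow> word) monoid"
  where "Aut n \<equiv> AutoGroup (free_group n)"

lemma group_Aut: "group (Aut n)"
  by (rule group.AutoGroup[OF group_free_group])

lemma carrier_Aut: "carrier (Aut n) = auto (free_group n)"
  by (simp add: AutoGroup_def)

lemma Aut_hom: "\<phi> \<in> carrier (Aut n) \<Longrightarrow> \<phi> \<in> hom (free_group n) (free_group n)"
  by (simp add: carrier_Aut auto_def)

lemma Aut_group_hom: "\<phi> \<in> carrier (Aut n) \<Longrightarrow> group_hom (free_group n) (free_group n) \<phi>"
  by (simp add: group_hom_def group_hom_axioms_def group_free_group Aut_hom)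

lemma Aut_Bij: "\<phi> \<in> carrier (Aut n) \<Longrightarrow> \<phi> \<in> Bij (carrier (free_group n))"
  by (simp add: carrier_Aut auto_def)

lemma Aut_bij: "\<phi> \<in> carrier (Aut n) \<Longrightarrow> bij_betw \<phi> (carrier (free_group n)) (carrier (free_group n))"
  using Aut_Bij by (auto simp: Bij_def)

lemma Aut_inj: "\<phi> \<in> carrier (Aut n) \<Longrightarrow> inj_on \<phi> (carrier (free_group n))"
  by (rule bij_betw_imp_inj_on[OF Aut_bij])

lemma Aut_image: "\<phi> \<in> carrier (Aut n) \<Longrightarrow> \<phi> ` carrier (free_group n) = carrier (free_group n)"
  by (rule bij_betw_imp_surj_on[OF Aut_bij])

lemma Aut_closed: "\<phi> \<in> carrier (Aut n) \<Longrightarrow> w \<in> carrier (free_group n) \<Longrightarrow> \<phi> w \<in> carrier (free_group n)"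
  using Aut_image[of \<phi> n] by blast

lemma Aut_mult: "\<phi> \<in> carrier (Aut n) \<Longrightarrow> \<psi> \<in> carrier (Aut n) \<Longrightarrow>
  \<phi> \<otimes>\<^bsub>Aut n\<^esub> \<psi> = compose (carrier (free_group n)) \<phi> \<psi>"
  using Aut_Bij[of \<phi> n] Aut_Bij[of \<psi> n] by (simp add: AutoGroup_def BijGroup_def)

lemma Aut_mult_apply: "\<phi> \<in> carrier (Aut n) \<Longrightarrow> \<psi> \<in> carrier (Aut n) \<Longrightarrow> w \<in> carrier (free_group n) \<Longrightarrow>
  (\<phi> \<otimes>\<^bsub>Aut n\<^esub> \<psi>) w = \<phi> (\<psi> w)"
  by (simp add: Aut_mult compose_def)

lemma Aut_one: "\<one>\<^bsub>Aut n\<^esub> = (\<lambda>w\<in>carrier (free_group n). w)"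
  by (simp add: AutoGroup_def BijGroup_def)

lemma Aut_eqI:
  assumes "\<phi> \<in> carrier (Aut n)" "\<psi> \<in> carrier (Aut n)" "\<And>i. i < n \<Longrightarrow> \<phi> [(i, False)] = \<psi> [(i, False)]"
  shows "\<phi> = \<psi>"
proof (rule extensionalityI[of _ "carrier (free_group n)"])
  show "\<phi> \<in> extensional (carrier (free_group n))" "\<psi> \<in> extensional (carrier (free_group n))"
    using assms Aut_Bij Bij_imp_extensional by blast+
qed (use assms hom_eqI Aut_hom in blast)

lemma Aut_inv_word: "\<phi> \<in> carrier (Aut n) \<Longrightarrow> w \<in> carrier (free_group n) \<Longrightarrow> \<phi> (inv_word w) = inv_word (\<phi> w)"
  by (rule hom_inv_word[OF Aut_hom])

definition letter_aut :: "nat \<Rightarrow> (letter \<Rightarrow> word) \<Rightarrow> word \<Rightarrow> word"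
  where "letter_aut n f = (\<lambda>w\<in>carrier (free_group n). subst f w)"

lemma letter_aut_hom:
  assumes "inv_compat f" "\<And>l. fst l < n \<Longrightarrow> f l \<in> carrier (free_group m)"
  shows "letter_aut n f \<in> hom (free_group n) (free_group m)"
proof -
  have "subst f w \<in> carrier (free_group m)" if "w \<in> carrier (free_group n)" for w
    using that assms by (intro subst_in_free_group) (auto simp: in_free_group)
  moreover have "x \<otimes>\<^bsub>free_group n\<^esub> y \<in> carrier (free_group n)"
    if "x \<in> carrier (free_group n)" "y \<in> carrier (free_group n)" for x y
    using that group.is_monoid[OF group_free_group] monoid.m_closed by metis
  ultimately show ?thesis
    using assms(1) by (auto simp: hom_def letter_aut_def subst_reduce subst_append)
qed

lemma letter_aut_in_Aut:
  assumes f: "inv_compat f" "\<And>l. fst l < n \<Longrightarrow> f l \<in> carrier (free_group n)"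
    and g: "inv_compat g" "\<And>l. fst l < n \<Longrightarrow> g l \<in> carrier (free_group n)"
    and fg: "\<And>i. i < n \<Longrightarrow> subst f (g (i, False)) = [(i, False)]"
    and gf: "\<And>i. i < n \<Longrightarrow> subst g (f (i, False)) = [(i, False)]"
  shows "letter_aut n f \<in> carrier (Aut n)"
proof -
  have h: "letter_aut n f \<in> hom (free_group n) (free_group n)" "letter_aut n g \<in> hom (free_group n) (free_group n)"
    using letter_aut_hom f g by blast+
  let ?C = "carrier (free_group n)"
  have id: "(\<lambda>w. w) \<in> hom (free_group n) (free_group n)" by (auto simp: hom_def)
  have cl: "letter_aut n f w \<in> ?C" "letter_aut n g w \<in> ?C" if "w \<in> ?C" for w
    using h that by (auto simp: hom_def)
  have comp: "(\<lambda>w. letter_aut n f (letter_aut n g w)) \<in> hom (free_group n) (free_group n)"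
    "(\<lambda>w. letter_aut n g (letter_aut n f w)) \<in> hom (free_group n) (free_group n)"
    using h cl by (auto simp: hom_def simp del: mult_free_group)
  have gen: "letter_aut n f [(i, False)] = f (i, False)" "letter_aut n g [(i, False)] = g (i, False)" if "i < n" for i
    using that f(2)[of "(i, False)"] g(2)[of "(i, False)"]
    by (simp_all add: letter_aut_def in_free_group subst_def reduce_reduced)
  have 1: "letter_aut n f (letter_aut n g w) = w" if "w \<in> ?C" for w
    by (rule hom_eqI[OF comp(1) id _ that]) (use gen fg g(2) in \<open>simp add: letter_aut_def\<close>)
  have 2: "letter_aut n g (letter_aut n f w) = w" if "w \<in> ?C" for w
    by (rule hom_eqI[OF comp(2) id _ that]) (use gen gf f(2) in \<open>simp add: letter_aut_def\<close>)
  have "bij_betw (letter_aut n f) ?C ?C"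
    by (rule bij_betw_byWitness[where f' = "letter_aut n g"]) (use 1 2 cl in auto)
  then show ?thesis
    using h by (auto simp: carrier_Aut auto_def Bij_def letter_aut_def)
qed

lemma letter_aut_gen: "i < n \<Longrightarrow> reduced (f (i, False)) \<Longrightarrow> letter_aut n f [(i, False)] = f (i, False)"
  by (simp add: letter_aut_def in_free_group subst_def reduce_reduced)

definition flip_map :: "nat \<Rightarrow> letter \<Rightarrow> word"
  where "flip_map i l = (if fst l = i then [inv_letter l] else [l])"

lemma flip_Aut: "i < n \<Longrightarrow> letter_aut n (flip_map i) \<in> carrier (Aut n)"
  by (rule letter_aut_in_Aut[where g = "flip_map i"])
     (auto simp: inv_compat_def flip_map_def inv_word_def in_free_group subst_def reduce_reduced)

definition perm_map :: "(nat \<Rightarrow> nat) \<Rightarrow> letter \<Rightarrow> word"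
  where "perm_map p l = [(p (fst l), snd l)]"

lemma inv_compat_perm_map: "inv_compat (perm_map p)"
  by (simp add: inv_compat_def perm_map_def inv_word_def inv_letter_def)

lemma perm_Aut:
  assumes "p permutes {..<n}"
  shows "letter_aut n (perm_map p) \<in> carrier (Aut n)"
proof (rule letter_aut_in_Aut[where g = "perm_map (inv_into UNIV p)"])
  have *: "p i < n \<longleftrightarrow> i < n" "inv_into UNIV p i < n \<longleftrightarrow> i < n" for i
    using permutes_in_image[OF assms] permutes_in_image[OF permutes_inv[OF assms]] by auto
  show "perm_map p l \<in> carrier (free_group n)" "perm_map (inv_into UNIV p) l \<in> carrier (free_group n)"
    if "fst l < n" for l
    using that * by (auto simp: perm_map_def in_free_group)
  show "subst (perm_map p) (perm_map (inv_into UNIV p) (i, False)) = [(i, False)]"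
    "subst (perm_map (inv_into UNIV p)) (perm_map p (i, False)) = [(i, False)]" for i
    using permutes_inverses[OF assms] by (auto simp: perm_map_def subst_def reduce_reduced)
qed (auto simp: inv_compat_perm_map)

text \<open>The substitution of \<open>x_i\<close> by \<open>x_i^(+-1) x_j^(+-1)\<close>, where the
  flags \<open>e\<close> and \<open>d\<close> mark inverted factors. Allowing a sign on
  \<open>x_i\<close> as well covers every reducing product without a preliminary inversion.\<close>

definition nielsen_map :: "nat \<Rightarrow> bool \<Rightarrow> nat \<Rightarrow> bool \<Rightarrow> letter \<Rightarrow> word" where
  "nielsen_map i e j d l = (if fst l = i then (if snd l then [(j, \<not> d), (i, \<not> e)] else [(i, e), (j, d)]) else [l])"

definition nielsen_map_inv :: "nat \<Rightarrow> bool \<Rightarrow> nat \<Rightarrow> bool \<Rightarrow> letter \<Rightarrow> word" where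
  "nielsen_map_inv i e j d l = (if fst l = i then
     (if snd l = e then [(i, False), (j, \<not> d)] else [(j, d), (i, True)]) else [l])"

lemma nielsen_Aut:
  assumes "i < n" "j < n" "i \<noteq> j"
  shows "letter_aut n (nielsen_map i e j d) \<in> carrier (Aut n)"
proof (rule letter_aut_in_Aut[where g = "nielsen_map_inv i e j d"])
  show "inv_compat (nielsen_map i e j d)"
    by (auto simp: inv_compat_def nielsen_map_def inv_word_def inv_letter_def)
  show "inv_compat (nielsen_map_inv i e j d)"
    by (auto simp: inv_compat_def nielsen_map_inv_def inv_word_def inv_letter_def)
  show "nielsen_map i e j d l \<in> carrier (free_group n)" "nielsen_map_inv i e j d l \<in> carrier (free_group n)"
    if "fst l < n" for l
    using assms that by (auto simp: nielsen_map_def nielsen_map_inv_def in_free_group inv_letter_def)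
  show "subst (nielsen_map i e j d) (nielsen_map_inv i e j d (k, False)) = [(k, False)]"
    "subst (nielsen_map_inv i e j d) (nielsen_map i e j d (k, False)) = [(k, False)]" for k
    using assms by (auto simp: nielsen_map_def nielsen_map_inv_def subst_def reduce_def inv_letter_def)
qed

section \<open>Bases and the complex of partial bases with complements\<close>

definition std_basis :: "nat \<Rightarrow> word set"
  where "std_basis n = (\<lambda>i. [(i, False)]) ` {..<n}"

definition bases :: "nat \<Rightarrow> word set set"
  where "bases n = (\<lambda>\<phi>. \<phi> ` std_basis n) ` carrier (Aut n)"

abbreviation gen :: "nat \<Rightarrow> word set \<Rightarrow> word set"
  where "gen n \<equiv> generate (free_group n)"

lemma std_basis_carrier: "std_basis n \<subseteq> carrier (free_group n)"
  by (auto simp: std_basis_def in_free_group)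

lemma letters_subgroup:
  "subgroup {w \<in> carrier (free_group n). \<forall>l\<in>set w. fst l \<in> I} (free_group n)"
proof -
  interpret F: group "free_group n" by (rule group_free_group)
  show ?thesis
  proof (rule F.subgroupI)
    fix a b assume ab: "a \<in> {w \<in> carrier (free_group n). \<forall>l\<in>set w. fst l \<in> I}"
      "b \<in> {w \<in> carrier (free_group n). \<forall>l\<in>set w. fst l \<in> I}"
    then show "a \<otimes>\<^bsub>free_group n\<^esub> b \<in> {w \<in> carrier (free_group n). \<forall>l\<in>set w. fst l \<in> I}"
      using F.m_closed[of a b] set_reduce[of "a @ b"] by fastforce
    show "inv\<^bsub>free_group n\<^esub> a \<in> {w \<in> carrier (free_group n). \<forall>l\<in>set w. fst l \<in> I}"
      using ab inv_word_in_free_group[of a n] by (auto simp: inv_free_group set_inv_word)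
  next
    have "[] \<in> {w \<in> carrier (free_group n). \<forall>l\<in>set w. fst l \<in> I}" by (simp add: in_free_group)
    then show "{w \<in> carrier (free_group n). \<forall>l\<in>set w. fst l \<in> I} \<noteq> {}" by blast
  qed auto
qed

lemma gen_std:
  assumes "I \<subseteq> {..<n}"
  shows "gen n ((\<lambda>i. [(i, False)]) ` I) = {w \<in> carrier (free_group n). \<forall>l\<in>set w. fst l \<in> I}" (is "gen n ?S = ?W")
proof
  interpret F: group "free_group n" by (rule group_free_group)
  have S: "?S \<subseteq> carrier (free_group n)" using assms by (auto simp: in_free_group)
  show "gen n ?S \<subseteq> ?W"
    by (rule F.generate_subgroup_incl[OF _ letters_subgroup]) (use S in auto)
  show "?W \<subseteq> gen n ?S"
  proof
    fix w assume "w \<in> ?W"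
    then show "w \<in> gen n ?S"
    proof (induction w)
      case Nil
      show ?case using generate.one[of "free_group n" ?S] by simp
    next
      case (Cons x w)
      have "reduced w" using Cons.prems reduced_append[of "[x]" w] by (auto simp: in_free_group)
      then have w: "w \<in> gen n ?S" using Cons by (auto simp: in_free_group)
      have x: "[x] \<in> gen n ?S"
      proof (cases "snd x")
        case False
        then have "[x] \<in> ?S" using Cons.prems by (cases x) auto
        then show ?thesis by (rule generate.incl)
      next
        case True
        have i: "[(fst x, False)] \<in> ?S" using Cons.prems by auto
        then have "inv\<^bsub>free_group n\<^esub> [(fst x, False)] \<in> gen n ?S" by (rule generate.inv)
        moreover have "inv\<^bsub>free_group n\<^esub> [(fst x, False)] = [x]"
          using i S True by (subst inv_free_group) (auto simp: inv_word_def inv_letter_def prod_eq_iff)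
        ultimately show ?thesis by simp
      qed
      have "[x] \<otimes>\<^bsub>free_group n\<^esub> w \<in> gen n ?S" using x w by (rule generate.eng)
      then show ?case using Cons.prems by (simp add: in_free_group reduce_reduced)
    qed
  qed
qed

lemma gen_std_diff:
  assumes "J \<subseteq> {..<n}"
  shows "gen n (std_basis n - (\<lambda>i. [(i, False)]) ` J) = {w \<in> carrier (free_group n). \<forall>l\<in>set w. fst l \<notin> J}"
proof -
  have "std_basis n - (\<lambda>i. [(i, False)]) ` J = (\<lambda>i. [(i, False)]) ` ({..<n} - J)"
    by (auto simp: std_basis_def)
  then show ?thesis using gen_std[of "{..<n} - J" n] by (auto simp: in_free_group)
qed

lemma gen_image: "\<phi> \<in> carrier (Aut n) \<Longrightarrow> S \<subseteq> carrier (free_group n) \<Longrightarrow> gen n (\<phi> ` S) = \<phi> ` gen n S"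
  using group_hom.generate_img[OF Aut_group_hom] by blast

lemma basis_carrier: "B \<in> bases n \<Longrightarrow> B \<subseteq> carrier (free_group n)"
  using std_basis_carrier Aut_closed by (fastforce simp: bases_def)

lemma basis_card:
  assumes "B \<in> bases n" shows "card B = n" "finite B"
proof -
  obtain \<phi> where \<phi>: "\<phi> \<in> carrier (Aut n)" "B = \<phi> ` std_basis n" using assms by (auto simp: bases_def)
  have "card (std_basis n) = n" unfolding std_basis_def by (subst card_image) (auto simp: inj_on_def)
  moreover have "inj_on \<phi> (std_basis n)" using Aut_inj[OF \<phi>(1)] std_basis_carrier inj_on_subset by blast
  ultimately show "card B = n" using \<phi> by (simp add: card_image)
  show "finite B" using \<phi> by (simp add: std_basis_def)
qed

lemma gen_basis: "B \<in> bases n \<Longrightarrow> gen n B = carrier (free_group n)"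
proof -
  assume "B \<in> bases n"
  then obtain \<phi> where \<phi>: "\<phi> \<in> carrier (Aut n)" "B = \<phi> ` std_basis n" by (auto simp: bases_def)
  have "gen n (std_basis n) = carrier (free_group n)" using gen_std_diff[of "{}" n] by simp
  then show ?thesis using gen_image[OF \<phi>(1) std_basis_carrier] Aut_image[OF \<phi>(1)] \<phi>(2) by simp
qed

text \<open>For the standard basis both sides consist of the words that avoid the generators in
  \<open>s\<close>, and an injective map respects intersections. The consequence: the factor
  complementary to a face is determined by the complements recorded in its vertices.\<close>

lemma gen_basis_diff:
  assumes B: "B \<in> bases n" and s: "s \<subseteq> B" "s \<noteq> {}"
  shows "gen n (B - s) = (\<Inter>x\<in>s. gen n (B - {x}))"
proof -
  obtain \<phi> where \<phi>: "\<phi> \<in> carrier (Aut n)" "B = \<phi> ` std_basis n" using B by (auto simp: bases_def)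
  have inj: "inj_on \<phi> (carrier (free_group n))" using Aut_inj[OF \<phi>(1)] .
  define J where "J = {i. i < n \<and> \<phi> [(i, False)] \<in> s}"
  let ?e = "\<lambda>i. [(i, False)]"
  have sJ: "s = \<phi> ` ?e ` J" using s \<phi> by (auto simp: J_def std_basis_def)
  have J: "J \<subseteq> {..<n}" by (auto simp: J_def)
  have Jne: "J \<noteq> {}" using s(2) sJ by blast
  have *: "gen n (B - \<phi> ` ?e ` I) = \<phi> ` {w \<in> carrier (free_group n). \<forall>l\<in>set w. fst l \<notin> I}" if "I \<subseteq> {..<n}" for I
  proof -
    have "?e ` I \<subseteq> carrier (free_group n)" using that by (auto simp: in_free_group)
    then have "B - \<phi> ` ?e ` I = \<phi> ` (std_basis n - ?e ` I)"
      using inj_on_image_set_diff[OF inj, of "std_basis n" "?e ` I"] std_basis_carrier \<phi>(2) by auto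
    moreover have "std_basis n - ?e ` I \<subseteq> carrier (free_group n)" using std_basis_carrier by blast
    ultimately show ?thesis
      using gen_image[OF \<phi>(1), of "std_basis n - ?e ` I"] gen_std_diff[OF that] by simp
  qed
  have "(\<Inter>x\<in>s. gen n (B - {x})) = (\<Inter>i\<in>J. gen n (B - \<phi> ` ?e ` {i}))"
    unfolding sJ by simp
  also have "\<dots> = (\<Inter>i\<in>J. \<phi> ` {w \<in> carrier (free_group n). \<forall>l\<in>set w. fst l \<notin> {i}})"
    by (rule INF_cong[OF refl], rule *) (use J in auto)
  also have "\<dots> = \<phi> ` (\<Inter>i\<in>J. {w \<in> carrier (free_group n). \<forall>l\<in>set w. fst l \<notin> {i}})"
  proof -
    obtain j where "j \<in> J" using Jne by blast
    then show ?thesis by (intro image_INT[OF inj, symmetric]) auto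
  qed
  also have "(\<Inter>i\<in>J. {w \<in> carrier (free_group n). \<forall>l\<in>set w. fst l \<notin> {i}}) =
      {w \<in> carrier (free_group n). \<forall>l\<in>set w. fst l \<notin> J}"
    using Jne by auto
  also have "\<phi> ` \<dots> = gen n (B - s)" using *[OF J] sJ by simp
  finally show ?thesis by simp
qed

lemma basis_independent:
  assumes B: "B \<in> bases n" and x: "x \<in> B"
  shows "x \<notin> gen n (B - {x})"
proof -
  obtain \<phi> i where \<phi>: "\<phi> \<in> carrier (Aut n)" "B = \<phi> ` std_basis n" "x = \<phi> [(i, False)]" "i < n"
    using B x by (auto simp: bases_def std_basis_def)
  have inj: "inj_on \<phi> (carrier (free_group n))" using Aut_inj[OF \<phi>(1)] .
  have e: "[(i, False)] \<in> carrier (free_group n)" using \<phi> by (simp add: in_free_group)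
  have sub: "std_basis n - {[(i, False)]} \<subseteq> carrier (free_group n)" using std_basis_carrier by blast
  have "B - {x} = \<phi> ` (std_basis n - {[(i, False)]})"
    using inj_on_image_set_diff[OF inj, of "std_basis n" "{[(i, False)]}"] std_basis_carrier \<phi> e by auto
  then have "gen n (B - {x}) = \<phi> ` {w \<in> carrier (free_group n). \<forall>l\<in>set w. fst l \<notin> {i}}"
    using gen_image[OF \<phi>(1), of "std_basis n - {[(i, False)]}"] sub gen_std_diff[of "{i}" n] \<phi> by simp
  then show ?thesis using \<phi>(3) inj e by (auto dest!: inj_onD[OF inj])
qed

lemma image_std_basis_update:
  assumes "i < n" "\<And>k. k < n \<Longrightarrow> g [(k, False)] = (if k = i then c else f [(k, False)])"
    "\<And>k. k < n \<Longrightarrow> f [(k, False)] = t \<longleftrightarrow> k = i"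
  shows "g ` std_basis n = insert c (f ` std_basis n - {t})"
proof -
  have n: "{..<n} = insert i ({..<n} - {i})" using assms(1) by auto
  have "g ` std_basis n = (\<lambda>k. g [(k, False)]) ` {..<n}" by (simp add: std_basis_def image_image)
  also have "\<dots> = insert c ((\<lambda>k. g [(k, False)]) ` ({..<n} - {i}))"
    by (subst n) (simp only: image_insert assms(2)[OF assms(1)] simp_thms if_True)
  also have "(\<lambda>k. g [(k, False)]) ` ({..<n} - {i}) = (\<lambda>k. f [(k, False)]) ` ({..<n} - {i})"
    by (rule image_cong) (use assms(2) in auto)
  also have "\<dots> = f ` std_basis n - {t}"
    using assms(3) by (auto simp: std_basis_def)
  finally show ?thesis .
qed

lemma basis_flip:
  assumes B: "B \<in> bases n" and t: "t \<in> B"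
  shows "insert (inv_word t) (B - {t}) \<in> bases n"
proof -
  obtain \<phi> i where \<phi>: "\<phi> \<in> carrier (Aut n)" "B = \<phi> ` std_basis n" "t = \<phi> [(i, False)]" "i < n"
    using B t by (auto simp: bases_def std_basis_def)
  let ?\<alpha> = "letter_aut n (flip_map i)"
  let ?e = "\<lambda>i. [(i, False)]"
  have \<alpha>: "?\<alpha> \<in> carrier (Aut n)" using flip_Aut \<phi> by blast
  have \<alpha>e: "?\<alpha> (?e k) = (if k = i then inv_word (?e i) else ?e k)" if "k < n" for k
    using that by (subst letter_aut_gen) (auto simp: flip_map_def inv_word_def)
  have inj: "inj_on \<phi> (carrier (free_group n))" using Aut_inj[OF \<phi>(1)] .
  have ec: "?e k \<in> carrier (free_group n)" if "k < n" for k using that by (simp add: in_free_group)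
  have "insert (inv_word t) (B - {t}) = (\<phi> \<otimes>\<^bsub>Aut n\<^esub> ?\<alpha>) ` std_basis n"
  proof -
    have "(\<phi> \<otimes>\<^bsub>Aut n\<^esub> ?\<alpha>) (?e k) = (if k = i then inv_word t else \<phi> (?e k))" if "k < n" for k
      using that \<phi> \<alpha> ec \<alpha>e Aut_inv_word[OF \<phi>(1) ec[OF that]] by (auto simp: Aut_mult_apply)
    moreover have "\<phi> (?e k) = t \<longleftrightarrow> k = i" if "k < n" for k
      using \<phi> ec that inj_onD[OF inj, of "?e k" "?e i"] by auto
    ultimately show ?thesis unfolding \<phi>(2) by (intro image_std_basis_update[OF \<phi>(4), symmetric])
  qed
  then show ?thesis using group.is_monoid[OF group_Aut] monoid.m_closed[of "Aut n" \<phi> ?\<alpha>] \<phi>(1) \<alpha>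
    by (auto simp: bases_def)
qed

text \<open>If \<open>\<phi>\<close> carries the standard basis to \<open>B\<close>, precomposing it
  with an elementary automorphism performs the move in terms of \<open>B\<close>.\<close>

lemma basis_nielsen:
  assumes B: "B \<in> bases n" and t: "t \<in> B" "t' \<in> B" "t \<noteq> t'"
    and s: "s = t \<or> s = inv_word t" "s' = t' \<or> s' = inv_word t'"
  shows "insert (reduce (s @ s')) (B - {t}) \<in> bases n"
proof -
  let ?e = "\<lambda>i. [(i, False)]"
  obtain \<phi> where \<phi>: "\<phi> \<in> carrier (Aut n)" "B = \<phi> ` std_basis n" using B by (auto simp: bases_def)
  obtain i j where ij: "t = \<phi> (?e i)" "t' = \<phi> (?e j)" "i < n" "j < n" using t \<phi> by (auto simp: std_basis_def)
  have "i \<noteq> j" using t ij by auto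
  have ec: "[(k, b)] \<in> carrier (free_group n)" if "k < n" for k b using that by (simp add: in_free_group)
  have inv: "\<phi> [(k, True)] = inv_word (\<phi> (?e k))" if "k < n" for k
    using Aut_inv_word[OF \<phi>(1) ec[OF that, of False]] by (simp add: inv_word_def inv_letter_def)
  obtain e d where ed: "s = \<phi> [(i, e)]" "s' = \<phi> [(j, d)]"
    using s ij inv by metis
  let ?\<alpha> = "letter_aut n (nielsen_map i e j d)"
  have \<alpha>: "?\<alpha> \<in> carrier (Aut n)" using nielsen_Aut ij \<open>i \<noteq> j\<close> by blast
  have \<alpha>e: "?\<alpha> (?e k) = (if k = i then [(i, e), (j, d)] else ?e k)" if "k < n" for k
    using that \<open>i \<noteq> j\<close> by (subst letter_aut_gen) (auto simp: nielsen_map_def inv_letter_def)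
  have inj: "inj_on \<phi> (carrier (free_group n))" using Aut_inj[OF \<phi>(1)] .
  have "\<phi> ([(i, e)] \<otimes>\<^bsub>free_group n\<^esub> [(j, d)]) = \<phi> [(i, e)] \<otimes>\<^bsub>free_group n\<^esub> \<phi> [(j, d)]"
    using Aut_hom[OF \<phi>(1)] ec ij by (simp add: hom_def del: mult_free_group)
  moreover have "[(i, e)] \<otimes>\<^bsub>free_group n\<^esub> [(j, d)] = [(i, e), (j, d)]"
    using \<open>i \<noteq> j\<close> by (auto simp: reduce_def inv_letter_def)
  ultimately have c: "\<phi> [(i, e), (j, d)] = reduce (s @ s')" using ed by simp
  have "insert (reduce (s @ s')) (B - {t}) = (\<phi> \<otimes>\<^bsub>Aut n\<^esub> ?\<alpha>) ` std_basis n"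
  proof -
    have "(\<phi> \<otimes>\<^bsub>Aut n\<^esub> ?\<alpha>) (?e k) = (if k = i then reduce (s @ s') else \<phi> (?e k))" if "k < n" for k
      using that \<phi> \<alpha> ec \<alpha>e c by (auto simp: Aut_mult_apply)
    moreover have "\<phi> (?e k) = t \<longleftrightarrow> k = i" if "k < n" for k
      using ij ec that inj_onD[OF inj, of "?e k" "?e i"] by auto
    ultimately show ?thesis unfolding \<phi>(2) by (intro image_std_basis_update[OF ij(3), symmetric])
  qed
  then show ?thesis using group.is_monoid[OF group_Aut] monoid.m_closed[of "Aut n" \<phi> ?\<alpha>] \<phi>(1) \<alpha>
    by (auto simp: bases_def)
qed

section \<open>A well-founded order on bases\<close>

lemma card_eq_sets_have_min:
  fixes r :: "'a \<Rightarrow> 'b::wellorder"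
  assumes "Q \<noteq> {}" "\<And>A. A \<in> Q \<Longrightarrow> finite A \<and> card A = n" "inj_on r (\<Union>Q)"
  shows "\<exists>A\<in>Q. \<forall>B\<in>Q. \<not> (\<exists>w\<in>B - A. \<forall>v\<in>A - B. r w < r v)"
  using assms
proof (induction n arbitrary: Q)
  case 0
  then obtain A where "A \<in> Q" by blast
  moreover have "B = {}" if "B \<in> Q" for B using 0(2)[OF that] by auto
  ultimately show ?case by blast
next
  case (Suc n)
  obtain A0 where "A0 \<in> Q" using Suc.prems by blast
  moreover have "A0 \<noteq> {}" using Suc.prems(2)[OF \<open>A0 \<in> Q\<close>] by auto
  ultimately have ne: "\<Union>Q \<noteq> {}" by blast
  \<comment> \<open>The least element occurring in any member of \<open>Q\<close>. Only sets
    containing it compete; after its removal they have cardinality \<open>n\<close>.\<close>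
  obtain a where a: "a \<in> \<Union>Q" "\<And>b. b \<in> \<Union>Q \<Longrightarrow> \<not> r b < r a"
  proof -
    obtain z where z: "z \<in> r ` \<Union>Q" using ne by blast
    define m where "m = (LEAST z. z \<in> r ` \<Union>Q)"
    have "m \<in> r ` \<Union>Q" unfolding m_def by (rule LeastI[of "\<lambda>z. z \<in> r ` \<Union>Q", OF z])
    moreover have "\<not> r b < m" if "b \<in> \<Union>Q" for b
      using not_less_Least[of "r b" "\<lambda>z. z \<in> r ` \<Union>Q"] that unfolding m_def by blast
    ultimately show ?thesis using that by auto
  qed
  define Q' where "Q' = (\<lambda>A. A - {a}) ` {A \<in> Q. a \<in> A}"
  have ne': "Q' \<noteq> {}" using a(1) by (auto simp: Q'_def)
  have fin': "finite A \<and> card A = n" if "A \<in> Q'" for A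
    using that Suc.prems(2) by (fastforce simp: Q'_def)
  have inj': "inj_on r (\<Union>Q')"
    by (rule inj_on_subset[OF Suc.prems(3)]) (auto simp: Q'_def)
  have "\<exists>A\<in>Q'. \<forall>B\<in>Q'. \<not> (\<exists>w\<in>B - A. \<forall>v\<in>A - B. r w < r v)"
    by (rule Suc.IH[OF ne' _ inj']) (rule fin')
  then obtain A' where A': "A' \<in> Q'" "\<forall>B\<in>Q'. \<not> (\<exists>w\<in>B - A'. \<forall>v\<in>A' - B. r w < r v)"
    by (rule bexE)
  then obtain A where A: "A \<in> Q" "a \<in> A" "A' = A - {a}" by (auto simp: Q'_def)
  have "\<not> (\<exists>w\<in>B - A. \<forall>v\<in>A - B. r w < r v)" if B: "B \<in> Q" for B
  proof
    assume "\<exists>w\<in>B - A. \<forall>v\<in>A - B. r w < r v"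
    then obtain w where w: "w \<in> B" "w \<notin> A" "\<And>v. v \<in> A - B \<Longrightarrow> r w < r v" by blast
    \<comment> \<open>Otherwise \<open>a\<close> lies in \<open>A - B\<close>, and \<open>B\<close>
      could beat \<open>A\<close> only with an element of rank below \<open>a\<close>.\<close>
    have "a \<in> B"
      using w A a(2)[of w] B by blast
    then have "B - {a} \<in> Q'" using B by (auto simp: Q'_def)
    moreover have "\<exists>w\<in>(B - {a}) - A'. \<forall>v\<in>A' - (B - {a}). r w < r v"
      using w A by (intro bexI[of _ w]) auto
    ultimately show False using A'(2) by blast
  qed
  then show ?case using A by blast
qed

text \<open>The lexicographic order of the bases listed by increasing rank: the basis owning the
  least element of the symmetric difference is the smaller one.\<close>

definition basis_less :: "nat \<Rightarrow> word set \<Rightarrow> word set \<Rightarrow> bool"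
  where "basis_less n B B' \<longleftrightarrow> (\<exists>w\<in>B - B'. \<forall>v\<in>B' - B. nrank n w < nrank n v)"

lemma nrank_inj_on: "inj_on (nrank n) (carrier (free_group n))"
  using nrank_inj by (auto simp: inj_on_def)

text \<open>The common cardinality \<open>n\<close> is essential: for sets of varying size the chain
  \<open>{0}\<close>, \<open>{0,1}\<close>, \<open>{0,1,2}\<close>, ... would descend forever in
  such an order.\<close>

lemma wf_basis_less: "wf {(B, B'). B \<in> bases n \<and> B' \<in> bases n \<and> basis_less n B B'}"
proof (rule wfI_min)
  fix B Q assume "B \<in> (Q :: word set set)"
  show "\<exists>z\<in>Q. \<forall>y. (y, z) \<in> {(B, B'). B \<in> bases n \<and> B' \<in> bases n \<and> basis_less n B B'} \<longrightarrow> y \<notin> Q"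
  proof (cases "B \<in> bases n")
    case False
    then show ?thesis using \<open>B \<in> Q\<close> by blast
  next
    case True
    let ?Q = "Q \<inter> bases n"
    have "inj_on (nrank n) (\<Union>?Q)"
      by (rule inj_on_subset[OF nrank_inj_on]) (use basis_carrier in auto)
    moreover have "?Q \<noteq> {}" using True \<open>B \<in> Q\<close> by blast
    moreover have "finite A \<and> card A = n" if "A \<in> ?Q" for A using that basis_card[of A n] by simp
    ultimately have "\<exists>A\<in>?Q. \<forall>B\<in>?Q. \<not> (\<exists>w\<in>B - A. \<forall>v\<in>A - B. nrank n w < nrank n v)"
      by (intro card_eq_sets_have_min[of ?Q n "nrank n"])
    then obtain A where "A \<in> ?Q" "\<forall>B\<in>?Q. \<not> (\<exists>w\<in>B - A. \<forall>v\<in>A - B. nrank n w < nrank n v)"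
      by (rule bexE)
    then show ?thesis by (intro bexI[of _ A]) (auto simp: basis_less_def)
  qed
qed

lemma basis_less_total:
  assumes "B \<in> bases n" "B' \<in> bases n" "B \<noteq> B'"
  shows "basis_less n B B' \<or> basis_less n B' B"
proof -
  let ?D = "(B - B') \<union> (B' - B)"
  have fin: "finite ?D" using assms basis_card by auto
  moreover have "?D \<noteq> {}" using assms by auto
  ultimately obtain w where w: "w \<in> ?D" "\<And>v. v \<in> ?D \<Longrightarrow> nrank n w \<le> nrank n v"
    using finite_has_minimal[of "nrank n ` ?D"]
    by (metis (no_types, lifting) arg_min_least arg_min_if_finite(1))
  have neq: "nrank n w \<noteq> nrank n v" if "v \<in> ?D" "v \<noteq> w" for v
  proof -
    have "v \<in> carrier (free_group n)" "w \<in> carrier (free_group n)"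
      using that w assms basis_carrier by blast+
    then show ?thesis using nrank_inj that by metis
  qed
  have lt: "nrank n w < nrank n v" if "v \<in> ?D" "v \<noteq> w" for v
    using w(2)[OF that(1)] neq[OF that] by simp
  show ?thesis
  proof (cases "w \<in> B")
    case True
    then have "basis_less n B B'" unfolding basis_less_def using w lt by (intro bexI[of _ w]) auto
    then show ?thesis ..
  next
    case False
    then have "basis_less n B' B" unfolding basis_less_def using w lt by (intro bexI[of _ w]) auto
    then show ?thesis ..
  qed
qed

lemma gen_eqI:
  assumes "S \<subseteq> carrier (free_group n)" "S' \<subseteq> carrier (free_group n)" "S \<subseteq> gen n S'" "S' \<subseteq> gen n S"
  shows "gen n S = gen n S'"
proof -
  interpret F: group "free_group n" by (rule group_free_group)
  show ?thesis
    using assms F.generate_subgroup_incl[OF _ F.generate_is_subgroup] by (intro equalityI) auto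
qed

section \<open>Frames: basis elements with their complements\<close>

definition frame_vertices :: "nat \<Rightarrow> word set \<Rightarrow> (word \<times> word set) set"
  where "frame_vertices n B = (\<lambda>x. (x, gen n (B - {x}))) ` B"

lemma frame_vertices_card: "B \<in> bases n \<Longrightarrow> card (frame_vertices n B) = n"
  unfolding frame_vertices_def by (subst card_image) (auto simp: inj_on_def basis_card)

text \<open>For \<open>x\<close> outside \<open>U\<close> the factor \<open>gen n (B - {x})\<close>
  contains \<open>U\<close>, and the exchange of \<open>t\<close> for \<open>c\<close> takes place
  inside \<open>gen n U\<close>. So the complement of \<open>x\<close> does not change, and the
  vertex of \<open>x\<close> persists in the new basis. Only vertices of \<open>U\<close> can be
  lost.\<close>

lemma basis_replace:
  assumes B: "B \<in> bases n" and B'': "insert c (B - {t}) \<in> bases n" and t: "t \<in> B" and U: "t \<in> U" "U \<subseteq> B" "card U \<le> 2"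
    and c: "nrank n c < nrank n t"
    and gen: "c \<in> gen n U" "t \<in> gen n (insert c (U - {t}))"
  shows "\<exists>B''. B'' \<in> bases n \<and> basis_less n B'' B \<and> (\<lambda>x. (x, gen n (B - {x}))) ` U \<subseteq> frame_vertices n B \<and>
     card ((\<lambda>x. (x, gen n (B - {x}))) ` U) \<le> 2 \<and>
     frame_vertices n B - (\<lambda>x. (x, gen n (B - {x}))) ` U \<subseteq> frame_vertices n B''"
proof (intro exI conjI)
  interpret F: group "free_group n" by (rule group_free_group)
  let ?B = "insert c (B - {t})"
  have car: "B \<subseteq> carrier (free_group n)" "?B \<subseteq> carrier (free_group n)" using B B'' basis_carrier by blast+
  \<comment> \<open>If \<open>c\<close> were in \<open>B\<close> already, the new basis would have
    \<open>n - 1\<close> elements. So \<open>c\<close> is new and witnesses that the basis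
    decreases.\<close>
  have "c \<notin> B"
  proof
    assume "c \<in> B"
    moreover have "c \<noteq> t" using c by auto
    ultimately have "?B = B - {t}" by auto
    then have "card ?B < card B" using card_Diff1_less[OF basis_card(2)[OF B] t] by metis
    then show False using basis_card[OF B] basis_card[OF B''] by simp
  qed
  then show "basis_less n ?B B" unfolding basis_less_def using c by (intro bexI[of _ c]) auto
  show "frame_vertices n B - (\<lambda>x. (x, gen n (B - {x}))) ` U \<subseteq> frame_vertices n ?B"
  proof
    fix v assume "v \<in> frame_vertices n B - (\<lambda>x. (x, gen n (B - {x}))) ` U"
    then obtain x where x: "x \<in> B" "x \<notin> U" "v = (x, gen n (B - {x}))" by (auto simp: frame_vertices_def)
    have "x \<noteq> t" "x \<noteq> c" using x U \<open>c \<notin> B\<close> by auto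
    have "gen n (B - {x}) = gen n (?B - {x})"
    proof (rule gen_eqI)
      have "U \<subseteq> B - {x}" "insert c (U - {t}) \<subseteq> ?B - {x}" using U x \<open>x \<noteq> c\<close> by auto
      then have "c \<in> gen n (B - {x})" "t \<in> gen n (?B - {x})"
        using gen F.mono_generate by blast+
      then have "insert t (?B - {x}) \<subseteq> gen n (?B - {x})" "insert c (B - {x}) \<subseteq> gen n (B - {x})"
        using generate.incl[of _ "?B - {x}" "free_group n"] generate.incl[of _ "B - {x}" "free_group n"]
        by blast+
      moreover have "B - {x} \<subseteq> insert t (?B - {x})" "?B - {x} \<subseteq> insert c (B - {x})" by auto
      ultimately show "B - {x} \<subseteq> gen n (?B - {x})" "?B - {x} \<subseteq> gen n (B - {x})"
        by (meson subset_trans)+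
    qed (use car in auto)
    then show "v \<in> frame_vertices n ?B" using x \<open>x \<noteq> t\<close> by (auto simp: frame_vertices_def)
  qed
  show "card ((\<lambda>x. (x, gen n (B - {x}))) ` U) \<le> 2"
    using U(3) card_image_le[OF finite_subset[OF U(2) basis_card(2)[OF B]]] by (rule le_trans[rotated])
qed (use B'' U in \<open>auto simp: frame_vertices_def\<close>)

lemma gen_pair:
  assumes t: "t \<in> carrier (free_group n)" "t' \<in> carrier (free_group n)" "t \<noteq> t'"
    and s: "s = t \<or> s = inv_word t" "s' = t' \<or> s' = inv_word t'"
  shows "reduce (s @ s') \<in> gen n {t, t'}" "t \<in> gen n (insert (reduce (s @ s')) ({t, t'} - {t}))"
proof -
  interpret F: group "free_group n" by (rule group_free_group)
  have mem: "x \<in> gen n S" "inv_word x \<in> gen n S" if "x \<in> S" "x \<in> carrier (free_group n)" for x S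
    using that generate.incl[of x S "free_group n"] generate.inv[of x S "free_group n"] by (auto simp: inv_free_group)
  have mult: "reduce (x @ y) \<in> gen n S" if "x \<in> gen n S" "y \<in> gen n S" for x y S
    using generate.eng[OF that] by simp
  have "s \<in> gen n {t, t'}" "s' \<in> gen n {t, t'}" using s t mem[of _ "{t, t'}"] by auto
  then show "reduce (s @ s') \<in> gen n {t, t'}" by (rule mult)
  have ss: "s \<in> carrier (free_group n)" "s' \<in> carrier (free_group n)"
    using s t inv_word_in_free_group by auto
  have c: "reduce (s @ s') \<in> carrier (free_group n)" using F.m_closed[OF ss] by simp
  let ?S = "insert (reduce (s @ s')) ({t, t'} - {t})"
  have t': "t' \<in> ?S" using t by simp
  have "inv_word s' \<in> gen n ?S" using s(2) mem[OF t' t(2)] by auto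
  then have "reduce (reduce (s @ s') @ inv_word s') \<in> gen n ?S" using mem(1)[OF _ c] mult by blast
  moreover have "reduce (reduce (s @ s') @ inv_word s') = s"
    using ss reduce_cancel_mid[of s s' "[]"] by (simp add: in_free_group reduce_reduced)
  ultimately have "s \<in> gen n ?S" by simp
  moreover from this have "inv_word s \<in> gen n ?S"
    using F.generate_m_inv_closed[of ?S s] t c ss by (auto simp: inv_free_group)
  ultimately show "t \<in> gen n ?S" using s(1) by auto
qed

text \<open>A failure of reducedness shows in one element or in a product of two. If an inverse has
  smaller rank, inverting \<open>t\<close> does, with \<open>U = {t}\<close>; if a product
  \<open>s s'\<close> is too small, the elementary move on \<open>U = {t, t'}\<close> does. In
  either case \<open>c\<close> and \<open>t\<close> are expressible through each other inside
  \<open>U\<close>.\<close>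

lemma nielsen_reduction_step:
  assumes B: "B \<in> bases n" and \<tau>: "\<tau> \<subseteq> B"
    and not: "\<not> ((\<forall>t\<in>\<tau>. nrank n t \<le> nrank n (inv_word t)) \<and> nielsen_symmetric n (\<tau> \<union> inv_word ` \<tau>))"
  shows "\<exists>c t U. t \<in> U \<and> U \<subseteq> \<tau> \<and> card U \<le> 2 \<and> insert c (B - {t}) \<in> bases n \<and> nrank n c < nrank n t \<and>
    c \<in> gen n U \<and> t \<in> gen n (insert c (U - {t}))"
proof (cases "\<forall>t\<in>\<tau>. nrank n t \<le> nrank n (inv_word t)")
  case False
  interpret F: group "free_group n" by (rule group_free_group)
  obtain t where t: "t \<in> \<tau>" "nrank n (inv_word t) < nrank n t" using False by auto
  have tc: "t \<in> carrier (free_group n)" using t \<tau> B basis_carrier by blast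
  have 1: "inv_word t \<in> gen n {t}"
    using generate.inv[of t "{t}" "free_group n"] tc by (simp add: inv_free_group)
  have 2: "t \<in> gen n {inv_word t}"
    using generate.inv[of "inv_word t" "{inv_word t}" "free_group n"] tc inv_word_in_free_group
    by (simp add: inv_free_group)
  show ?thesis
    by (rule exI[of _ "inv_word t"], rule exI[of _ t], rule exI[of _ "{t}"])
       (use t 1 2 basis_flip[OF B] \<tau> in auto)
next
  case True
  have \<tau>c: "\<tau> \<subseteq> carrier (free_group n)" using \<tau> B basis_carrier by blast
  have "[] \<notin> B"
  proof
    assume "[] \<in> B"
    then show False using basis_independent[OF B] generate.one[of "free_group n"] by (metis one_free_group)
  qed
  then have "[] \<notin> \<tau> \<union> inv_word ` \<tau>" using \<tau> by (auto simp: image_iff) (metis inv_word_eq_Nil subsetD)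
  moreover have "\<tau> \<union> inv_word ` \<tau> \<subseteq> carrier (free_group n)" using \<tau>c inv_word_in_free_group by auto
  ultimately obtain s s' where s: "s \<in> \<tau> \<union> inv_word ` \<tau>" "s' \<in> \<tau> \<union> inv_word ` \<tau>" "s' \<noteq> inv_word s"
    "nlen n (reduce (s @ s')) < nlen n s \<or> nlen n (reduce (s @ s')) < nlen n s'"
    using not True unfolding nielsen_symmetric_def by (metis not_le)
  obtain t where t: "t \<in> \<tau>" "s = t \<or> s = inv_word t" using s(1) by blast
  obtain t' where t': "t' \<in> \<tau>" "s' = t' \<or> s' = inv_word t'" using s(2) by blast
  \<comment> \<open>With \<open>t = t'\<close> the product would be a square, which is longer than
    its factor.\<close>
  have "t \<noteq> t'"
  proof
    assume "t = t'"
    then have "s' = s" using t t' s(3) by auto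
    moreover have "reduced s" "s \<noteq> []"
      using s(1) \<open>[] \<notin> \<tau> \<union> inv_word ` \<tau>\<close> \<open>\<tau> \<union> inv_word ` \<tau> \<subseteq> carrier (free_group n)\<close> by (auto simp: in_free_group)
    ultimately show False using s(4) length_square[of s] by (auto simp: nlen_def)
  qed
  have *: "\<exists>c t U. t \<in> U \<and> U \<subseteq> \<tau> \<and> card U \<le> 2 \<and> insert c (B - {t}) \<in> bases n \<and> nrank n c < nrank n t \<and>
    c \<in> gen n U \<and> t \<in> gen n (insert c (U - {t}))"
    if u: "t \<in> \<tau>" "t' \<in> \<tau>" "t \<noteq> t'" "u = t \<or> u = inv_word t" "u' = t' \<or> u' = inv_word t'"
      "nlen n (reduce (u @ u')) < nlen n u" for t t' u u'
  proof (rule exI[of _ "reduce (u @ u')"], rule exI[of _ t], rule exI[of _ "{t, t'}"], intro conjI)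
    have tc: "t \<in> carrier (free_group n)" "t' \<in> carrier (free_group n)" using u \<tau>c by auto
    show "reduce (u @ u') \<in> gen n {t, t'}" "t \<in> gen n (insert (reduce (u @ u')) ({t, t'} - {t}))"
      using gen_pair[OF tc u(3-5)] by auto
    show "insert (reduce (u @ u')) (B - {t}) \<in> bases n"
      using basis_nielsen[OF B _ _ u(3-5)] u(1,2) \<tau> by auto
    have "nlen n (reduce (u @ u')) < nlen n t" using u(4,6) by auto
    then show "nrank n (reduce (u @ u')) < nrank n t" by (simp add: nrank_def)
    show "card {t, t'} \<le> 2" by (simp add: card_insert_if)
  qed (use u in auto)
  from s(4) show ?thesis
  proof
    assume "nlen n (reduce (s @ s')) < nlen n s"
    then show ?thesis by (rule *[OF t(1) t'(1) \<open>t \<noteq> t'\<close> t(2) t'(2)])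
  next
    \<comment> \<open>If the product is smaller than its right factor, its inverse is smaller than
      the left factor of that inverse; the roles of \<open>t\<close> and \<open>t'\<close> are
      exchanged.\<close>
    assume "nlen n (reduce (s @ s')) < nlen n s'"
    then have m: "nlen n (reduce (inv_word s' @ inv_word s)) < nlen n (inv_word s')"
      by (metis inv_word_append inv_word_reduce nlen_inv_word)
    have "inv_word s' = t' \<or> inv_word s' = inv_word t'" "inv_word s = t \<or> inv_word s = inv_word t"
      using t(2) t'(2) by auto
    then show ?thesis by (rule *[OF t'(1) t(1) \<open>t \<noteq> t'\<close>[symmetric] _ _ m])
  qed
qed

definition frame_words :: "nat \<Rightarrow> (word \<times> word set) list set"
  where "frame_words n = (\<Union>B\<in>bases n. inj_words (frame_vertices n B))"

lemma id_basis: "std_basis n \<in> bases n"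
proof -
  have "\<one>\<^bsub>Aut n\<^esub> ` std_basis n = std_basis n"
    using std_basis_carrier[of n] by (auto simp: Aut_one subset_eq image_iff)
  then show ?thesis using monoid.one_closed[OF group.is_monoid[OF group_Aut[of n]]] by (auto simp: bases_def image_iff)
qed

text \<open>Let \<open>x\<close> be the element of \<open>B' - B\<close> that makes
  \<open>B'\<close> smaller. If \<open>B - \<sigma>\<close> were Nielsen reduced, then
  \<open>x\<close>, which lies in the common complementary factor, would be generated by the
  elements of \<open>B - \<sigma>\<close> of rank at most that of \<open>x\<close>. These all belong
  to \<open>B' - {x}\<close>, as the elements of \<open>B - B'\<close> have larger rank, and
  \<open>B'\<close> would be dependent. So some elementary move in \<open>B - \<sigma>\<close>
  decreases \<open>B\<close>, and it leaves the vertices of \<open>w\<close> alone.\<close>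

lemma frame_facets_reduce:
  assumes B: "B \<in> bases n" "B' \<in> bases n" "basis_less n B' B"
    and w: "w \<in> inj_words (frame_vertices n B)" "w \<in> inj_words (frame_vertices n B')" and n: "0 < n"
  shows "\<exists>T B''. B'' \<in> bases n \<and> basis_less n B'' B \<and> T \<subseteq> frame_vertices n B \<and> card T \<le> 2 \<and> set w \<inter> T = {} \<and>
    frame_vertices n B - T \<subseteq> frame_vertices n B''"
proof -
  interpret F: group "free_group n" by (rule group_free_group)
  define \<sigma> where "\<sigma> = fst ` set w"
  have \<sigma>: "\<sigma> \<subseteq> B" "\<sigma> \<subseteq> B'" using w by (auto simp: \<sigma>_def inj_words_def frame_vertices_def)
  have eqx: "gen n (B - {x}) = gen n (B' - {x})" if "x \<in> \<sigma>" for x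
  proof -
    obtain H where "(x, H) \<in> set w" using \<open>x \<in> \<sigma>\<close> by (auto simp: \<sigma>_def)
    then show ?thesis using w by (auto simp: inj_words_def frame_vertices_def)
  qed
  \<comment> \<open>The vertices of \<open>w\<close> carry equal complements in \<open>B\<close> and
    \<open>B'\<close>; intersecting them gives the factor. For the empty word the factor is the
    whole group.\<close>
  have gen_eq: "gen n (B - \<sigma>) = gen n (B' - \<sigma>)"
  proof (cases "\<sigma> = {}")
    case True
    then show ?thesis using gen_basis B by simp
  next
    case False
    then show ?thesis using gen_basis_diff[OF B(1) \<sigma>(1)] gen_basis_diff[OF B(2) \<sigma>(2)] eqx by simp
  qed
  define \<tau> where "\<tau> = B - \<sigma>"
  have "\<not> ((\<forall>t\<in>\<tau>. nrank n t \<le> nrank n (inv_word t)) \<and> nielsen_symmetric n (\<tau> \<union> inv_word ` \<tau>))"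
  proof
    assume irr: "(\<forall>t\<in>\<tau>. nrank n t \<le> nrank n (inv_word t)) \<and> nielsen_symmetric n (\<tau> \<union> inv_word ` \<tau>)"
    obtain x where x: "x \<in> B'" "x \<notin> B" "\<And>v. v \<in> B - B' \<Longrightarrow> nrank n x < nrank n v"
      using B(3) by (auto simp: basis_less_def)
    have \<tau>c: "\<tau> \<subseteq> carrier (free_group n)" using basis_carrier[OF B(1)] by (auto simp: \<tau>_def)
    have "x \<in> B' - \<sigma>" using x \<sigma> by auto
    then have "x \<in> gen n \<tau>" using gen_eq generate.incl[of x "B' - \<sigma>" "free_group n"] by (simp add: \<tau>_def)
    then have "x \<in> gen n {t \<in> \<tau>. nrank n t \<le> nrank n x}"
      using generate_nrank_le[OF \<tau>c] irr n by blast
    moreover have "{t \<in> \<tau>. nrank n t \<le> nrank n x} \<subseteq> B' - {x}"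
      using x by (fastforce simp: \<tau>_def)
    ultimately have "x \<in> gen n (B' - {x})" using F.mono_generate by (metis subsetD)
    then show False using basis_independent[OF B(2) x(1)] by simp
  qed
  then obtain c t U where *: "t \<in> U" "U \<subseteq> \<tau>" "card U \<le> 2" "insert c (B - {t}) \<in> bases n" "nrank n c < nrank n t"
    "c \<in> gen n U" "t \<in> gen n (insert c (U - {t}))"
    using nielsen_reduction_step[OF B(1), of \<tau>] by (auto simp: \<tau>_def)
  have "t \<in> B" "U \<subseteq> B" using * by (auto simp: \<tau>_def)
  moreover have "set w \<inter> (\<lambda>x. (x, gen n (B - {x}))) ` U = {}"
    using *(2) by (force simp: \<tau>_def \<sigma>_def)
  ultimately show ?thesis
    using basis_replace[OF B(1) *(4) _ *(1) _ *(3) *(5) *(6) *(7)] by blast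
qed

theorem frame_words_acyc:
  assumes "2 * l + 1 \<le> n"
  shows "acyc (frame_words n) l"
  unfolding frame_words_def
proof (rule acyc_facets[where lt = "basis_less n"])
  show "finite (frame_vertices n B)" if "B \<in> bases n" for B
    using that basis_card by (simp add: frame_vertices_def)
  show "2 * l + 1 \<le> card (frame_vertices n B)" if "B \<in> bases n" for B
    using that assms frame_vertices_card by simp
  show "bases n \<noteq> {}" using id_basis by blast
qed (use wf_basis_less basis_less_total frame_facets_reduce assms in auto)

section \<open>The bar complex of a group action\<close>

text \<open>Tuples \<open>(gs, x)\<close> span the bar construction with trivial coefficients on the
  left and \<open>X\<close> on the right, which computes the homology of the homotopy quotient of
  \<open>X\<close> by the group. With no entry left to multiply, an element acts on the
  point.\<close>

fun mult_head :: "('a, 'b) monoid_scheme \<Rightarrow> ('a \<Rightarrow> 'x \<Rightarrow> 'x) \<Rightarrow> 'a \<Rightarrow> 'a list \<times> 'x \<Rightarrow> 'a list \<times> 'x" where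
  "mult_head G act g ([], x) = ([], act g x)"
| "mult_head G act g (h # hs, x) = ((g \<otimes>\<^bsub>G\<^esub> h) # hs, x)"

definition cons_head :: "'a \<Rightarrow> 'a list \<times> 'x \<Rightarrow> 'a list \<times> 'x"
  where "cons_head g w = (g # fst w, snd w)"

lemma cons_head_simp [simp]: "cons_head g (gs, x) = (g # gs, x)"
  by (simp add: cons_head_def)

lemma mult_head_cons_head [simp]: "mult_head G act g (cons_head h w) = cons_head (g \<otimes>\<^bsub>G\<^esub> h) w"
  by (cases w) simp

text \<open>\<open>bar_rest\<close> is minus the sum of all terms of the boundary except the one that drops the first entry.\<close>

fun bar_rest :: "('a, 'b) monoid_scheme \<Rightarrow> ('a \<Rightarrow> 'x \<Rightarrow> 'x) \<Rightarrow> 'a list \<Rightarrow> 'x \<Rightarrow> ('a list \<times> 'x) \<Rightarrow>\<^sub>0 int" where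
  "bar_rest G act [] x = 0"
| "bar_rest G act (g # gs) x = frag_of (mult_head G act g (gs, x)) - fmap (cons_head g) (bar_rest G act gs x)"

fun bar_bd :: "('a, 'b) monoid_scheme \<Rightarrow> ('a \<Rightarrow> 'x \<Rightarrow> 'x) \<Rightarrow> 'a list \<Rightarrow> 'x \<Rightarrow> ('a list \<times> 'x) \<Rightarrow>\<^sub>0 int" where
  "bar_bd G act [] x = 0"
| "bar_bd G act (g # gs) x = frag_of (gs, x) - bar_rest G act (g # gs) x"

definition bar_e :: "('a, 'b) monoid_scheme \<Rightarrow> ('a \<Rightarrow> 'x \<Rightarrow> 'x) \<Rightarrow> (('a list \<times> 'x) \<Rightarrow>\<^sub>0 int) \<Rightarrow> ('a list \<times> 'x) \<Rightarrow>\<^sub>0 int"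
  where "bar_e G act = frag_extend (\<lambda>w. bar_rest G act (fst w) (snd w))"

definition bar_d :: "('a, 'b) monoid_scheme \<Rightarrow> ('a \<Rightarrow> 'x \<Rightarrow> 'x) \<Rightarrow> (('a list \<times> 'x) \<Rightarrow>\<^sub>0 int) \<Rightarrow> ('a list \<times> 'x) \<Rightarrow>\<^sub>0 int"
  where "bar_d G act = frag_extend (\<lambda>w. bar_bd G act (fst w) (snd w))"

definition bar_simplices :: "('a, 'b) monoid_scheme \<Rightarrow> 'x set \<Rightarrow> nat \<Rightarrow> ('a list \<times> 'x) set"
  where "bar_simplices G X q = {(gs, x). length gs = q \<and> set gs \<subseteq> carrier G \<and> x \<in> X}"

lemma in_bar_simplices: "(gs, x) \<in> bar_simplices G X q \<longleftrightarrow> length gs = q \<and> set gs \<subseteq> carrier G \<and> x \<in> X"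
  by (simp add: bar_simplices_def)

lemma bar_e_of: "bar_e G act (frag_of (gs, x)) = bar_rest G act gs x"
  by (simp add: bar_e_def)

lemma bar_d_of: "bar_d G act (frag_of (gs, x)) = bar_bd G act gs x"
  by (simp add: bar_d_def)

lemma bar_e_diff: "bar_e G act (a - b) = bar_e G act a - bar_e G act b"
  by (simp add: bar_e_def frag_extend_diff)

lemma bar_d_diff: "bar_d G act (a - b) = bar_d G act a - bar_d G act b"
  by (simp add: bar_d_def frag_extend_diff)

lemma bar_d_add: "bar_d G act (a + b) = bar_d G act a + bar_d G act b"
  by (simp add: bar_d_def frag_extend_add)

lemma bar_d_minus: "bar_d G act (- a) = - bar_d G act a"
  by (simp add: bar_d_def frag_extend_minus)

lemma bar_d_0 [simp]: "bar_d G act 0 = 0"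
  by (simp add: bar_d_def)

lemma bar_e_0 [simp]: "bar_e G act 0 = 0"
  by (simp add: bar_e_def)

lemma bar_e_cons_head:
  "bar_e G act (fmap (cons_head g) c) = fmap (mult_head G act g) c - fmap (cons_head g) (bar_e G act c)"
  by (simp add: bar_e_def frag_extend_fmap cons_head_def[abs_def] frag_extend_minus_fun fmap_frag_extend flip: fmap_def)

lemma bar_d_tail:
  assumes "\<And>w. w \<in> supp c \<Longrightarrow> fst w \<noteq> []"
  shows "bar_d G act c = fmap (\<lambda>w. (tl (fst w), snd w)) c - bar_e G act c"
proof -
  have "bar_d G act c = frag_extend (\<lambda>w. frag_of (tl (fst w), snd w) - bar_rest G act (fst w) (snd w)) c"
    unfolding bar_d_def
  proof (rule frag_extend_eq)
    fix w assume "w \<in> supp c"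
    then obtain g gs where "fst w = g # gs" using assms by (meson list.exhaust)
    then show "bar_bd G act (fst w) (snd w) = frag_of (tl (fst w), snd w) - bar_rest G act (fst w) (snd w)" by simp
  qed
  then show ?thesis by (simp add: frag_extend_minus_fun bar_e_def fmap_def)
qed

locale group_action = group G for G (structure) +
  fixes act :: "'a \<Rightarrow> 'x \<Rightarrow> 'x" and X :: "'x set"
  assumes act_closed: "g \<in> carrier G \<Longrightarrow> x \<in> X \<Longrightarrow> act g x \<in> X"
    and act_mult: "g \<in> carrier G \<Longrightarrow> h \<in> carrier G \<Longrightarrow> x \<in> X \<Longrightarrow> act (g \<otimes> h) x = act g (act h x)"
    and act_one: "x \<in> X \<Longrightarrow> act \<one> x = x"
begin

abbreviation mh where "mh \<equiv> mult_head G act"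
abbreviation E where "E \<equiv> bar_e G act"
abbreviation D where "D \<equiv> bar_d G act"
abbreviation S where "S \<equiv> bar_simplices G X"

lemma mh_in_S: "g \<in> carrier G \<Longrightarrow> w \<in> S q \<Longrightarrow> mh g w \<in> S q"
  by (cases "(G, act, g, w)" rule: mult_head.cases) (auto simp: in_bar_simplices act_closed)

lemma cons_head_in_S: "g \<in> carrier G \<Longrightarrow> w \<in> S q \<Longrightarrow> cons_head g w \<in> S (Suc q)"
  by (auto simp: bar_simplices_def cons_head_def)

lemma mh_mh:
  assumes "g \<in> carrier G" "h \<in> carrier G" "w \<in> S q"
  shows "mh g (mh h w) = mh (g \<otimes> h) w"
proof -
  obtain gs x where w: "w = (gs, x)" by fastforce
  show ?thesis
    using assms unfolding w by (cases gs) (auto simp: in_bar_simplices act_mult m_assoc)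
qed

lemma rest_supp: "set gs \<subseteq> carrier G \<Longrightarrow> x \<in> X \<Longrightarrow> supp (bar_rest G act gs x) \<subseteq> S (length gs - 1)"
proof (induction gs)
  case (Cons g gs)
  have "supp (fmap (cons_head g) (bar_rest G act gs x)) \<subseteq> S (length gs)"
  proof (cases gs)
    case (Cons h hs)
    then show ?thesis
      using Cons.prems Cons.IH by (intro supp_fmapI) (auto dest!: subsetD intro: cons_head_in_S)
  qed simp
  moreover have "mh g (gs, x) \<in> S (length gs)"
    using Cons.prems by (intro mh_in_S) (auto simp: in_bar_simplices)
  ultimately show ?case by (simp add: supp_diff keys_frag_of)
qed simp

lemma bd_supp: "set gs \<subseteq> carrier G \<Longrightarrow> x \<in> X \<Longrightarrow> supp (bar_bd G act gs x) \<subseteq> S (length gs - 1)"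
proof (cases gs)
  case (Cons g hs)
  assume "set gs \<subseteq> carrier G" "x \<in> X"
  then show ?thesis
    using rest_supp[of gs x] Cons
    by (simp add: supp_diff keys_frag_of in_bar_simplices del: bar_rest.simps)
qed simp

lemma D_supp: "supp c \<subseteq> S (Suc q) \<Longrightarrow> supp (D c) \<subseteq> S q"
  unfolding bar_d_def
proof (rule supp_frag_extend)
  fix w assume "supp c \<subseteq> S (Suc q)" "w \<in> supp c"
  then have "w \<in> S (Suc q)" by blast
  moreover obtain gs x where "w = (gs, x)" by fastforce
  ultimately show "supp (bar_bd G act (fst w) (snd w)) \<subseteq> S q"
    using bd_supp[of gs x] by (simp add: in_bar_simplices)
qed

lemma D_S0: "supp c \<subseteq> S 0 \<Longrightarrow> D c = 0"
  unfolding bar_d_def by (rule frag_extend_eq_0) (auto simp: bar_simplices_def)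

lemma rest_mh:
  assumes "g \<in> carrier G" "set hs \<subseteq> carrier G" "x \<in> X"
  shows "E (frag_of (mh g (hs, x))) = fmap (mh g) (bar_rest G act hs x)"
proof (cases hs)
  case (Cons h hs')
  have *: "(hs', x) \<in> S (length hs')" using assms Cons by (simp add: in_bar_simplices)
  have "mh g (mh h (hs', x)) = mh (g \<otimes> h) (hs', x)"
    using assms Cons by (intro mh_mh[OF _ _ *]) auto
  then show ?thesis using Cons by (simp add: bar_e_of fmap_diff fmap_fmap)
qed (simp add: bar_e_of)

text \<open>Up to sign, \<open>E\<close> is the boundary without its first face. It squares to zero
  by itself: by \<open>rest_mh\<close>, the two terms in which the first entry is multiplied onto
  the rest cancel.\<close>

lemma E_rest: "set gs \<subseteq> carrier G \<Longrightarrow> x \<in> X \<Longrightarrow> E (bar_rest G act gs x) = 0"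
proof (induction gs)
  case (Cons g gs)
  then show ?case
    using rest_mh[of g gs x] by (simp add: bar_e_diff bar_e_cons_head)
qed simp

text \<open>On nonempty strings \<open>D\<close> is the removal of the first entry minus
  \<open>E\<close>. Since \<open>E\<close> kills \<open>bar_rest\<close>, only the removal
  contributes, and applied to \<open>bar_rest\<close> it reproduces the boundary of the shorter
  string.\<close>

lemma D_bd: "set gs \<subseteq> carrier G \<Longrightarrow> x \<in> X \<Longrightarrow> D (bar_bd G act gs x) = 0"
proof (cases gs)
  case (Cons g w)
  assume gs: "set gs \<subseteq> carrier G" and x: "x \<in> X"
  show ?thesis
  proof (cases w)
    case Nil
    then show ?thesis using Cons by (simp add: bar_d_diff bar_d_of)
  next
    case (Cons h hs)
    let ?c = "bar_rest G act gs x"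
    have gw: "gs = g # w" by fact
    have ne: "fst v \<noteq> []" if "v \<in> supp ?c" for v
      using rest_supp[OF gs x] that gw Cons by (auto simp: bar_simplices_def)
    have "D ?c = fmap (\<lambda>v. (tl (fst v), snd v)) ?c - E ?c"
      by (rule bar_d_tail) (rule ne)
    also have "E ?c = 0" by (rule E_rest[OF gs x])
    also have "fmap (\<lambda>v. (tl (fst v), snd v)) ?c = frag_of (hs, x) - bar_rest G act w x"
      using gw Cons by (simp add: fmap_diff fmap_fmap del: bar_rest.simps(2))
        (simp add: fmap_diff fmap_fmap cons_head_def[abs_def])
    finally show ?thesis using gw Cons by (simp add: bar_d_diff bar_d_of)
  qed
qed simp

lemma D_D:
  assumes "supp c \<subseteq> S q"
  shows "D (D c) = 0"
proof -
  have "D (D c) = frag_extend (\<lambda>w. D (bar_bd G act (fst w) (snd w))) c"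
    by (simp add: bar_d_def frag_extend_frag_extend)
  also have "\<dots> = 0"
    by (rule frag_extend_eq_0) (use assms D_bd in \<open>auto simp: bar_simplices_def\<close>)
  finally show ?thesis .
qed

end

section \<open>Natural transformations and chain homotopies\<close>

fun bar_tgt :: "('a \<Rightarrow> 'x \<Rightarrow> 'x) \<Rightarrow> 'a list \<Rightarrow> 'x \<Rightarrow> 'x" where
  "bar_tgt act [] x = x"
| "bar_tgt act (g # gs) x = act g (bar_tgt act gs x)"

text \<open>A simplex \<open>(gs, x)\<close> is a string of composable arrows of the action groupoid
  with source \<open>x\<close> and target \<open>bar_tgt act gs x\<close>. A choice of
  \<open>\<tau>\<close> is a natural transformation from the identity to the functor taking
  \<open>x\<close> to \<open>act (\<tau> x) x\<close> and an arrow \<open>g\<close> at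
  \<open>y\<close> to \<open>tw_elt g y\<close>. \<open>twist\<close> is that functor on
  strings.\<close>

locale twisted_action = group_action G act X
  for G (structure) and act :: "'a \<Rightarrow> 'x \<Rightarrow> 'x" and X +
  fixes \<tau> :: "'x \<Rightarrow> 'a"
  assumes \<tau>_closed: "x \<in> X \<Longrightarrow> \<tau> x \<in> carrier G"
begin

abbreviation tgt where "tgt \<equiv> bar_tgt act"

definition tw_elt :: "'a \<Rightarrow> 'x \<Rightarrow> 'a"
  where "tw_elt g y = \<tau> (act g y) \<otimes> g \<otimes> inv (\<tau> y)"

fun twist :: "'a list \<Rightarrow> 'x \<Rightarrow> 'a list \<times> 'x" where
  "twist [] x = ([], act (\<tau> x) x)"
| "twist (g # gs) x = cons_head (tw_elt g (tgt gs x)) (twist gs x)"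

text \<open>The chain homotopy of a natural transformation: one term for each place where the arrow
  \<open>\<tau>\<close> can be inserted, with twisted entries to its left and the original entries
  to its right.\<close>

fun prism :: "'a list \<Rightarrow> 'x \<Rightarrow> ('a list \<times> 'x) \<Rightarrow>\<^sub>0 int" where
  "prism [] x = frag_of ([\<tau> x], x)"
| "prism (g # gs) x = frag_of (\<tau> (act g (tgt gs x)) # g # gs, x) - fmap (cons_head (tw_elt g (tgt gs x))) (prism gs x)"

definition Tw where "Tw = fmap (\<lambda>w. twist (fst w) (snd w))"
definition Pr where "Pr = frag_extend (\<lambda>w. prism (fst w) (snd w))"

lemma tgt_closed: "set gs \<subseteq> carrier G \<Longrightarrow> x \<in> X \<Longrightarrow> tgt gs x \<in> X"
  by (induction gs) (auto simp: act_closed)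

lemma tw_elt_closed: "g \<in> carrier G \<Longrightarrow> y \<in> X \<Longrightarrow> tw_elt g y \<in> carrier G"
  by (simp add: tw_elt_def \<tau>_closed act_closed)

lemma tw_elt_\<tau>: "g \<in> carrier G \<Longrightarrow> y \<in> X \<Longrightarrow> tw_elt g y \<otimes> \<tau> y = \<tau> (act g y) \<otimes> g"
  by (simp add: tw_elt_def m_assoc \<tau>_closed act_closed)

lemma tw_elt_mult:
  assumes "g \<in> carrier G" "h \<in> carrier G" "y \<in> X"
  shows "tw_elt g (act h y) \<otimes> tw_elt h y = tw_elt (g \<otimes> h) y"
proof -
  have c: "\<tau> y \<in> carrier G" "\<tau> (act h y) \<in> carrier G" "\<tau> (act g (act h y)) \<in> carrier G"
    using assms \<tau>_closed act_closed by auto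
  have "inv \<tau> (act h y) \<otimes> (\<tau> (act h y) \<otimes> (h \<otimes> inv \<tau> y)) = h \<otimes> inv \<tau> y"
    using assms c by (simp flip: m_assoc)
  then show ?thesis using assms c by (simp add: tw_elt_def m_assoc act_mult)
qed

lemma twist_in_S: "set gs \<subseteq> carrier G \<Longrightarrow> x \<in> X \<Longrightarrow> twist gs x \<in> S (length gs)"
proof (induction gs)
  case (Cons g gs)
  then show ?case by (auto intro!: cons_head_in_S tw_elt_closed tgt_closed)
qed (simp add: in_bar_simplices act_closed \<tau>_closed)

lemma tgt_mh:
  assumes "g \<in> carrier G" "set hs \<subseteq> carrier G" "x \<in> X"
  shows "tgt (fst (mh g (hs, x))) (snd (mh g (hs, x))) = act g (tgt hs x)"
  using assms by (cases hs) (auto simp: act_mult tgt_closed)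

lemma rest_tgt:
  assumes "set gs \<subseteq> carrier G" "x \<in> X" "w \<in> supp (bar_rest G act gs x)"
  shows "tgt (fst w) (snd w) = tgt gs x"
  using assms
proof (induction gs arbitrary: w)
  case (Cons g gs)
  have "w \<in> {mh g (gs, x)} \<union> cons_head g ` supp (bar_rest G act gs x)"
    using Cons.prems(3) keys_diff[of "frag_of (mh g (gs, x))" "fmap (cons_head g) (bar_rest G act gs x)"]
      supp_fmap[of "cons_head g" "bar_rest G act gs x"] by (auto simp: keys_frag_of)
  then show ?case
    using Cons.IH Cons.prems tgt_mh[of g gs x] by (auto simp: cons_head_def)
qed simp

lemma prism_supp: "set gs \<subseteq> carrier G \<Longrightarrow> x \<in> X \<Longrightarrow> supp (prism gs x) \<subseteq> S (Suc (length gs))"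
proof (induction gs)
  case (Cons g gs)
  have "supp (fmap (cons_head (tw_elt g (tgt gs x))) (prism gs x)) \<subseteq> S (Suc (Suc (length gs)))"
    using Cons by (intro supp_fmapI cons_head_in_S tw_elt_closed tgt_closed) auto
  then show ?case
    using Cons.prems
    by (simp add: supp_diff keys_frag_of in_bar_simplices \<tau>_closed act_closed tgt_closed)
qed (simp add: keys_frag_of in_bar_simplices \<tau>_closed)

lemma prism_mh:
  assumes "g \<in> carrier G" "set hs \<subseteq> carrier G" "x \<in> X"
  shows "Pr (frag_of (mh g (hs, x))) =
    frag_of (cons_head (\<tau> (act g (tgt hs x))) (mh g (hs, x))) - frag_of ((\<tau> (act g (tgt hs x)) \<otimes> g) # hs, x)
    + fmap (mh (tw_elt g (tgt hs x))) (prism hs x)"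
proof (cases hs)
  case Nil
  then show ?thesis using assms by (simp add: Pr_def tw_elt_\<tau>)
next
  case (Cons h hs')
  have c: "h \<in> carrier G" "tgt hs' x \<in> X" using assms Cons tgt_closed by auto
  then show ?thesis
    using assms Cons by (simp add: Pr_def fmap_diff fmap_fmap tw_elt_\<tau> tw_elt_mult act_mult act_closed)
qed

lemma Pr_cons_head:
  assumes "\<And>w. w \<in> supp c \<Longrightarrow> tgt (fst w) (snd w) = y"
  shows "Pr (fmap (cons_head g) c) =
    fmap (cons_head (\<tau> (act g y))) (fmap (cons_head g) c) - fmap (cons_head (tw_elt g y)) (Pr c)"
proof -
  have "Pr (fmap (cons_head g) c) = frag_extend (\<lambda>w. frag_of (cons_head (\<tau> (act g y)) (cons_head g w)) -
      fmap (cons_head (tw_elt g y)) (prism (fst w) (snd w))) c"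
    unfolding Pr_def frag_extend_fmap using assms by (intro frag_extend_eq) (simp add: cons_head_def)
  then show ?thesis by (simp add: frag_extend_minus_fun Pr_def fmap_frag_extend fmap_fmap flip: fmap_def)
qed

lemma Pr_diff: "Pr (a - b) = Pr a - Pr b"
  by (simp add: Pr_def frag_extend_diff)

text \<open>A telescoping sum: the naturality square
  \<open>tw_elt g y \<otimes> \<tau> y = \<tau> (act g y) \<otimes> g\<close> identifies faces of
  neighbouring prism terms, and only the fully twisted string survives. The untwisted one comes from
  the first face, which \<open>E\<close> omits.\<close>

lemma prism_rest:
  assumes "set gs \<subseteq> carrier G" "x \<in> X"
  shows "E (prism gs x) + Pr (bar_rest G act gs x) = frag_of (twist gs x)"
  using assms
proof (induction gs)
  case Nil
  then show ?case by (simp add: bar_e_of Pr_def)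
next
  case (Cons g gs)
  let ?y = "tgt gs x" and ?r = "bar_rest G act gs x"
  let ?t = "\<tau> (act g ?y)" and ?k = "tw_elt g ?y"
  have g: "g \<in> carrier G" "set gs \<subseteq> carrier G" using Cons.prems by auto
  have e: "E (prism (g # gs) x) =
      (frag_of ((?t \<otimes> g) # gs, x) - fmap (cons_head ?t) (bar_rest G act (g # gs) x))
      - (fmap (mh ?k) (prism gs x) - fmap (cons_head ?k) (E (prism gs x)))"
    by (simp add: bar_e_diff bar_e_of bar_e_cons_head del: bar_rest.simps(2)) (simp only: bar_rest.simps mult_head.simps)
  have p: "Pr (bar_rest G act (g # gs) x) =
     (frag_of (cons_head ?t (mh g (gs, x))) - frag_of ((?t \<otimes> g) # gs, x) + fmap (mh ?k) (prism gs x))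
     - (fmap (cons_head ?t) (fmap (cons_head g) ?r) - fmap (cons_head ?k) (Pr ?r))"
    unfolding bar_rest.simps Pr_diff prism_mh[OF g Cons.prems(2)]
    using rest_tgt[OF g(2) Cons.prems(2)] by (subst Pr_cons_head[of _ ?y]) auto
  have "fmap (cons_head ?t) (bar_rest G act (g # gs) x) =
      frag_of (cons_head ?t (mh g (gs, x))) - fmap (cons_head ?t) (fmap (cons_head g) ?r)"
    by (simp add: fmap_diff)
  then have "E (prism (g # gs) x) + Pr (bar_rest G act (g # gs) x) = fmap (cons_head ?k) (E (prism gs x) + Pr ?r)"
    unfolding e p fmap_add by simp
  then show ?case using Cons.IH Cons.prems by simp
qed

lemma prism_bd:
  assumes "set gs \<subseteq> carrier G" "x \<in> X"
  shows "D (prism gs x) + Pr (bar_bd G act gs x) = frag_of (gs, x) - frag_of (twist gs x)"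
proof -
  have "fst w \<noteq> []" if "w \<in> supp (prism gs x)" for w
    using prism_supp[OF assms] that by (auto simp: bar_simplices_def)
  then have D: "D (prism gs x) = fmap (\<lambda>w. (tl (fst w), snd w)) (prism gs x) - E (prism gs x)"
    by (rule bar_d_tail)
  show ?thesis
  proof (cases gs)
    case Nil
    then show ?thesis using D prism_rest[OF assms] by (simp add: Pr_def)
  next
    case (Cons g hs)
    have 1: "fmap (\<lambda>w. (tl (fst w), snd w)) (prism gs x) = frag_of (gs, x) - prism hs x"
      using Cons by (simp add: fmap_diff fmap_fmap cons_head_def[abs_def])
    have 2: "Pr (bar_bd G act gs x) = prism hs x - Pr (bar_rest G act gs x)"
      using Cons by (simp add: Pr_diff del: bar_rest.simps) (simp add: Pr_def)
    show ?thesis unfolding prism_rest[OF assms, symmetric] D 1 2 by (simp add: algebra_simps)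
  qed
qed

lemma Pr_D:
  assumes "supp c \<subseteq> S q"
  shows "D (Pr c) + Pr (D c) = c - Tw c"
proof -
  have "D (Pr c) + Pr (D c) = frag_extend (\<lambda>w. D (prism (fst w) (snd w)) + Pr (bar_bd G act (fst w) (snd w))) c"
    by (simp add: Pr_def bar_d_def frag_extend_frag_extend frag_extend_plus)
  also have "\<dots> = frag_extend (\<lambda>w. frag_of w - frag_of (twist (fst w) (snd w))) c"
    by (rule frag_extend_eq) (use assms prism_bd in \<open>auto simp: bar_simplices_def\<close>)
  also have "\<dots> = c - Tw c"
    by (simp add: frag_extend_minus_fun Tw_def fmap_def flip: frag_expansion)
  finally show ?thesis .
qed

lemma Pr_supp: "supp c \<subseteq> S q \<Longrightarrow> supp (Pr c) \<subseteq> S (Suc q)"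
  unfolding Pr_def
proof (rule supp_frag_extend)
  fix w assume "supp c \<subseteq> S q" "w \<in> supp c"
  then have "w \<in> S q" by blast
  moreover obtain gs x where "w = (gs, x)" by fastforce
  ultimately show "supp (prism (fst w) (snd w)) \<subseteq> S (Suc q)"
    using prism_supp[of gs x] by (simp add: in_bar_simplices)
qed

lemma Tw_cycle:
  assumes "supp c \<subseteq> S q" "D c = 0"
  shows "\<exists>b. supp b \<subseteq> S (Suc q) \<and> c - Tw c = D b"
  using Pr_D[OF assms(1)] Pr_supp[OF assms(1)] assms(2) by (intro exI[of _ "Pr c"]) (simp add: Pr_def)

text \<open>Read off from the homotopy formula: apply \<open>D\<close> to the formula for
  \<open>c\<close> and compare with the formula for \<open>D c\<close>.\<close>

lemma Tw_D:
  assumes "supp c \<subseteq> S q"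
  shows "D (Tw c) = Tw (D c)"
proof (cases q)
  case 0
  then have "supp (Tw c) \<subseteq> S 0"
    using assms twist_in_S unfolding Tw_def by (intro supp_fmapI) (fastforce simp: bar_simplices_def)
  then show ?thesis using assms 0 D_S0 by (simp add: Tw_def)
next
  case (Suc p)
  have sD: "supp (D c) \<subseteq> S p" using assms Suc D_supp by blast
  have "D (D (Pr c) + Pr (D c)) = D c - D (Tw c)" using Pr_D[OF assms] by (simp add: bar_d_diff)
  moreover have "D (D (Pr c)) = 0" using D_D Pr_supp[OF assms] by blast
  moreover have "D (Pr (D c)) = D c - Tw (D c)"
    using Pr_D[OF sD] D_D[OF assms] by (simp add: Pr_def)
  ultimately show ?thesis by (simp add: bar_d_add)
qed

end

lemma bar_d_equivariant:
  assumes s: "\<And>g h. g \<in> carrier K \<Longrightarrow> h \<in> carrier K \<Longrightarrow> s (g \<otimes>\<^bsub>K\<^esub> h) = s g \<otimes>\<^bsub>G\<^esub> s h"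
    and f: "\<And>g x. g \<in> carrier K \<Longrightarrow> x \<in> X \<Longrightarrow> f (actK g x) = act (s g) (f x)"
    and c: "supp c \<subseteq> bar_simplices K X q"
  shows "bar_d G act (fmap (\<lambda>w. (map s (fst w), f (snd w))) c) = fmap (\<lambda>w. (map s (fst w), f (snd w))) (bar_d K actK c)"
proof -
  let ?m = "\<lambda>w. (map s (fst w), f (snd w))"
  have mh: "mult_head G act (s g) (?m (hs, x)) = ?m (mult_head K actK g (hs, x))"
    if "g \<in> carrier K" "set hs \<subseteq> carrier K" "x \<in> X" for g hs x
    using that s f by (cases hs) auto
  have rest: "bar_rest G act (map s gs) (f x) = fmap ?m (bar_rest K actK gs x)"
    if "set gs \<subseteq> carrier K" "x \<in> X" for gs x
    using that
  proof (induction gs)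
    case (Cons g gs)
    have "fmap (cons_head (s g)) (fmap ?m r) = fmap ?m (fmap (cons_head g) r)" for r
      by (simp add: fmap_fmap cons_head_def)
    then show ?case using Cons mh[of g gs x] by (simp add: fmap_diff)
  qed simp
  have "bar_bd G act (map s gs) (f x) = fmap ?m (bar_bd K actK gs x)" if "set gs \<subseteq> carrier K" "x \<in> X" for gs x
    using that rest[of gs x] by (cases gs) (auto simp: fmap_diff simp del: bar_rest.simps)
  then show ?thesis
    unfolding bar_d_def frag_extend_fmap fmap_frag_extend using c
    by (intro frag_extend_eq) (auto simp: bar_simplices_def)
qed

section \<open>Shapiro's lemma\<close>

definition at_point :: "('k \<Rightarrow> 'a) \<Rightarrow> 'x \<Rightarrow> (('k list \<times> 'y) \<Rightarrow>\<^sub>0 int) \<Rightarrow> ('a list \<times> 'x) \<Rightarrow>\<^sub>0 int"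
  where "at_point s x = fmap (\<lambda>w. (map s (fst w), x))"

lemma at_point_add: "at_point s x (a + b) = at_point s x a + at_point s x b"
  by (simp add: at_point_def fmap_add)

text \<open>The bar complex of the group \<open>K\<close> itself is that of its action on a one-point set \<open>{y0}\<close>.\<close>

locale point_stabilizer = group_action G act X + K: group K
  for G (structure) and act :: "'a \<Rightarrow> 'x \<Rightarrow> 'x" and X and K (structure) +
  fixes s :: "'k \<Rightarrow> 'a" and x0 :: 'x and actK :: "'k \<Rightarrow> 'y \<Rightarrow> 'y" and y0 :: 'y
  assumes s_mult: "g \<in> carrier K \<Longrightarrow> h \<in> carrier K \<Longrightarrow> s (g \<otimes>\<^bsub>K\<^esub> h) = s g \<otimes> s h"
    and s_inj: "inj_on s (carrier K)"
    and s_image: "s ` carrier K = {g \<in> carrier G. act g x0 = x0}"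
    and x0: "x0 \<in> X"
    and trans: "x \<in> X \<Longrightarrow> \<exists>g\<in>carrier G. act g x = x0"
    and actK: "k \<in> carrier K \<Longrightarrow> actK k y0 = y0"
begin

abbreviation SK where "SK \<equiv> bar_simplices K {y0}"
abbreviation DK where "DK \<equiv> bar_d K actK"
abbreviation iota where "iota \<equiv> at_point s x0"

lemma s_stab: "k \<in> carrier K \<Longrightarrow> s k \<in> carrier G" "k \<in> carrier K \<Longrightarrow> act (s k) x0 = x0"
  using s_image by auto

lemma iota_D: "supp c \<subseteq> SK q \<Longrightarrow> D (iota c) = iota (DK c)"
  unfolding at_point_def
  by (rule bar_d_equivariant[where X = "{y0}" and f = "\<lambda>_. x0"]) (auto simp: s_mult s_stab)

lemma iota_supp: "supp c \<subseteq> SK q \<Longrightarrow> supp (iota c) \<subseteq> S q"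
  unfolding at_point_def
proof (rule supp_fmapI)
  fix w assume "supp c \<subseteq> SK q" "w \<in> supp c"
  then have "w \<in> SK q" by blast
  then show "(map s (fst w), x0) \<in> S q" using s_stab(1) x0 by (auto simp: bar_simplices_def)
qed

lemma DK_supp: "supp c \<subseteq> SK (Suc q) \<Longrightarrow> supp (DK c) \<subseteq> SK q"
proof -
  interpret K: group_action K actK "{y0}" by unfold_locales (auto simp: actK)
  show "supp c \<subseteq> SK (Suc q) \<Longrightarrow> supp (DK c) \<subseteq> SK q" by (rule K.D_supp)
qed

lemma DK_supp0: "supp c \<subseteq> SK 0 \<Longrightarrow> DK c = 0"
proof -
  interpret K: group_action K actK "{y0}" by unfold_locales (auto simp: actK)
  show "supp c \<subseteq> SK 0 \<Longrightarrow> DK c = 0" by (rule K.D_S0)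
qed

lemma iota_inj:
  assumes "iota a = iota b" "supp a \<subseteq> SK q" "supp b \<subseteq> SK q"
  shows "a = b"
proof (rule fmap_inj_on_eq[OF assms(1)[unfolded at_point_def] _ assms(2,3)])
  show "inj_on (\<lambda>w. (map s (fst w), x0)) (SK q)"
  proof (rule inj_onI)
    fix v w assume v: "v \<in> SK q" and w: "w \<in> SK q" and eq: "(map s (fst v), x0) = (map s (fst w), x0)"
    have "fst v = fst w"
    proof (rule map_inj_on)
      show "map s (fst v) = map s (fst w)" using eq by simp
      show "inj_on s (set (fst v) \<union> set (fst w))"
        by (rule inj_on_subset[OF s_inj]) (use v w in \<open>auto simp: bar_simplices_def\<close>)
    qed
    moreover have "snd v = y0" "snd w = y0" using v w by (auto simp: bar_simplices_def)
    ultimately show "v = w" by (simp add: prod_eq_iff)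
  qed
qed

lemma iota_image:
  assumes "supp c \<subseteq> {(gs, x). length gs = q \<and> set gs \<subseteq> s ` carrier K \<and> x = x0}"
  obtains c' where "supp c' \<subseteq> SK q" "c = iota c'"
proof -
  have "{(gs, x). length gs = q \<and> set gs \<subseteq> s ` carrier K \<and> x = x0} \<subseteq> (\<lambda>w. (map s (fst w), x0)) ` SK q"
  proof
    fix w assume "w \<in> {(gs, x). length gs = q \<and> set gs \<subseteq> s ` carrier K \<and> x = x0}"
    then obtain gs where w: "w = (gs, x0)" "length gs = q" "set gs \<subseteq> s ` carrier K" by auto
    then have "gs \<in> map s ` lists (carrier K)"
      unfolding lists_image[symmetric] by (simp add: in_lists_conv_set subset_iff)
    then obtain ks where ks: "gs = map s ks" "set ks \<subseteq> carrier K" by auto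
    then show "w \<in> (\<lambda>w. (map s (fst w), x0)) ` SK q"
      using w by (intro image_eqI[of _ _ "(ks, y0)"]) (auto simp: in_bar_simplices)
  qed
  then have *: "supp c \<subseteq> (\<lambda>w. (map s (fst w), x0)) ` SK q" using assms by blast
  obtain c' where "supp c' \<subseteq> SK q" "c = fmap (\<lambda>w. (map s (fst w), x0)) c'"
    using supp_image_fmap[OF *] .
  then show ?thesis using that by (simp add: at_point_def)
qed

text \<open>The value at \<open>x0\<close> is fixed to be the unit, so that twisting is the identity
  on strings of the stabiliser at \<open>x0\<close>. This makes \<open>Tw\<close> a retraction onto
  the bar complex of \<open>K\<close>.\<close>

definition \<tau> where "\<tau> x = (if x = x0 then \<one> else SOME g. g \<in> carrier G \<and> act g x = x0)"

lemma \<tau>: "x \<in> X \<Longrightarrow> \<tau> x \<in> carrier G" "x \<in> X \<Longrightarrow> act (\<tau> x) x = x0"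
proof -
  assume x: "x \<in> X"
  then have "\<exists>g. g \<in> carrier G \<and> act g x = x0" using trans by blast
  from someI_ex[OF this] show "\<tau> x \<in> carrier G" "act (\<tau> x) x = x0" using x act_one by (auto simp: \<tau>_def)
qed

interpretation T: twisted_action G act X \<tau>
  by unfold_locales (rule \<tau>)

lemma tw_elt_stab:
  assumes "g \<in> carrier G" "y \<in> X"
  shows "T.tw_elt g y \<in> s ` carrier K"
proof -
  have "act (inv (\<tau> y)) x0 = y"
    using \<tau>[OF assms(2)] assms(2) act_mult[of "inv \<tau> y" "\<tau> y" y] by (simp add: act_one)
  then have "act (T.tw_elt g y) x0 = x0"
    using assms \<tau> x0 by (simp add: T.tw_elt_def act_mult act_closed)
  then show ?thesis using assms T.tw_elt_closed by (simp add: s_image)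
qed

lemma twist_stab: "set gs \<subseteq> carrier G \<Longrightarrow> x \<in> X \<Longrightarrow>
   T.twist gs x \<in> {(hs, x). length hs = length gs \<and> set hs \<subseteq> s ` carrier K \<and> x = x0}"
proof (induction gs)
  case (Cons g gs)
  then show ?case using tw_elt_stab[of g "bar_tgt act gs x"] T.tgt_closed[of gs x] by (auto simp: cons_head_def)
qed (simp add: \<tau>)

lemma Tw_iota_image:
  assumes "supp c \<subseteq> S q"
  obtains c' where "supp c' \<subseteq> SK q" "T.Tw c = iota c'"
proof -
  have "supp (T.Tw c) \<subseteq> {(gs, x). length gs = q \<and> set gs \<subseteq> s ` carrier K \<and> x = x0}"
    unfolding T.Tw_def by (rule supp_fmapI) (use assms twist_stab in \<open>fastforce simp: bar_simplices_def\<close>)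
  then show ?thesis using iota_image that by blast
qed

lemma twist_x0: "set gs \<subseteq> s ` carrier K \<Longrightarrow> T.twist gs x0 = (gs, x0)"
proof (induction gs)
  case Nil
  then show ?case using \<tau>(2)[OF x0] by simp
next
  case (Cons g gs)
  have "bar_tgt act hs x0 = x0" if "set hs \<subseteq> s ` carrier K" for hs
    using that by (induction hs) (auto simp: s_stab)
  moreover have "\<tau> x0 = \<one>" by (simp add: \<tau>_def)
  moreover have "g \<in> carrier G" "act g x0 = x0" using Cons.prems s_stab by auto
  ultimately show ?case using Cons by (simp add: T.tw_elt_def)
qed

lemma Tw_iota:
  assumes "supp c \<subseteq> SK q"
  shows "T.Tw (iota c) = iota c"
  unfolding T.Tw_def at_point_def fmap_fmap
proof (rule fmap_cong)
  fix w assume "w \<in> supp c"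
  then have "w \<in> SK q" using assms by blast
  then have "set (map s (fst w)) \<subseteq> s ` carrier K" by (auto simp: bar_simplices_def)
  from twist_x0[OF this]
  show "T.twist (fst (map s (fst w), x0)) (snd (map s (fst w), x0)) = (map s (fst w), x0)" by simp
qed

text \<open>Twisting is homotopic to the identity and drags every string to \<open>x0\<close>; there
  each entry goes from \<open>x0\<close> to its chosen representative, on to another one and back,
  so it lies in the stabiliser.\<close>

theorem shapiro_surj:
  assumes "supp c \<subseteq> S q" "D c = 0"
  shows "\<exists>c' b. supp c' \<subseteq> SK q \<and> DK c' = 0 \<and> supp b \<subseteq> S (Suc q) \<and> c = iota c' + D b"
proof -
  obtain b where b: "supp b \<subseteq> S (Suc q)" "c - T.Tw c = D b" using T.Tw_cycle[OF assms] by blast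
  obtain c' where c': "supp c' \<subseteq> SK q" "T.Tw c = iota c'" using Tw_iota_image[OF assms(1)] .
  have "DK c' = 0"
  proof (cases q)
    case 0
    then show ?thesis using c' DK_supp0 by simp
  next
    case (Suc p)
    have "iota (DK c') = T.Tw (D c)" using iota_D[OF c'(1)] c'(2) T.Tw_D[OF assms(1)] by simp
    also have "\<dots> = iota 0" using assms(2) by (simp add: T.Tw_def at_point_def)
    finally show ?thesis using iota_inj[of "DK c'" 0 p] DK_supp c'(1) Suc by simp
  qed
  moreover have "c = iota c' + D b" using b(2) c'(2) by (simp add: algebra_simps)
  ultimately show ?thesis using b(1) c'(1) by blast
qed

text \<open>\<open>Tw\<close> commutes with the boundary and fixes \<open>iota c\<close>, so
  twisting the filling \<open>b\<close> gives one that comes from \<open>K\<close>.\<close>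

theorem shapiro_inj:
  assumes "supp c \<subseteq> SK q" "supp b \<subseteq> S (Suc q)" "iota c = D b"
  shows "\<exists>u. supp u \<subseteq> SK (Suc q) \<and> c = DK u"
proof -
  obtain u where u: "supp u \<subseteq> SK (Suc q)" "T.Tw b = iota u" using Tw_iota_image[OF assms(2)] .
  have "iota c = T.Tw (D b)" using Tw_iota[OF assms(1)] assms(3) by simp
  also have "\<dots> = iota (DK u)" using T.Tw_D[OF assms(2)] u(2) iota_D[OF u(1)] by simp
  finally show ?thesis using iota_inj[OF _ assms(1) DK_supp[OF u(1)]] u(1) by blast
qed

end

text \<open>Take the constant \<open>\<tau> = h\<close>. The twist conjugates every entry by
  \<open>h\<close>, which does nothing since \<open>h\<close> centralises the image of
  \<open>K\<close>, and it moves the point from \<open>x0\<close> to \<open>act h x0\<close>. So the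
  inclusions of \<open>K\<close> at the two points are homotopic.\<close>

lemma (in group_action) conjugate_point:
  assumes K: "\<And>k. k \<in> carrier K \<Longrightarrow> s k \<in> carrier G" "\<And>k. k \<in> carrier K \<Longrightarrow> act (s k) x0 = x0"
    "\<And>g h. g \<in> carrier K \<Longrightarrow> h \<in> carrier K \<Longrightarrow> s (g \<otimes>\<^bsub>K\<^esub> h) = s g \<otimes> s h"
    and actK: "\<And>k. k \<in> carrier K \<Longrightarrow> actK k y0 = y0"
    and x0: "x0 \<in> X" and h: "h \<in> carrier G" "\<And>k. k \<in> carrier K \<Longrightarrow> h \<otimes> s k = s k \<otimes> h"
    and c: "supp c \<subseteq> bar_simplices K {y0} q" "bar_d K actK c = 0"
  shows "\<exists>b. supp b \<subseteq> S (Suc q) \<and> at_point s (act h x0) c = at_point s x0 c + D b"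
proof -
  interpret T: twisted_action G act X "\<lambda>_. h" by unfold_locales (rule h)
  have "D (at_point s x0 c) = at_point s x0 (bar_d K actK c)"
    unfolding at_point_def
    by (rule bar_d_equivariant[where X = "{y0}" and f = "\<lambda>_. x0"]) (use K actK c in auto)
  then have "D (at_point s x0 c) = 0" using c(2) by (simp add: at_point_def)
  moreover have "supp (at_point s x0 c) \<subseteq> S q"
    unfolding at_point_def
  proof (rule supp_fmapI)
    fix w assume "w \<in> supp c"
    then have "w \<in> bar_simplices K {y0} q" using c(1) by blast
    then show "(map s (fst w), x0) \<in> S q" using K(1) x0 by (auto simp: bar_simplices_def)
  qed
  ultimately obtain b where b: "supp b \<subseteq> S (Suc q)" "at_point s x0 c - T.Tw (at_point s x0 c) = D b"
    using T.Tw_cycle by blast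
  have tw: "T.twist gs x0 = (gs, act h x0)" if "set gs \<subseteq> s ` carrier K" for gs
    using that
  proof (induction gs)
    case (Cons g gs)
    then obtain k where k: "k \<in> carrier K" "g = s k" by auto
    have "T.tw_elt g y = g" for y
      using h(2)[OF k(1)] h(1) k(2) K(1)[OF k(1)] by (simp add: T.tw_elt_def m_assoc)
    then show ?case using Cons by simp
  qed simp
  have "T.Tw (at_point s x0 c) = at_point s (act h x0) c"
    unfolding T.Tw_def at_point_def fmap_fmap
  proof (rule fmap_cong)
    fix w assume "w \<in> supp c"
    then have "w \<in> bar_simplices K {y0} q" using c(1) by blast
    then have "set (map s (fst w)) \<subseteq> s ` carrier K" by (auto simp: bar_simplices_def)
    from tw[OF this]
    show "T.twist (fst (map s (fst w), x0)) (snd (map s (fst w), x0)) = (map s (fst w), act h x0)" by simp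
  qed
  then have "at_point s (act h x0) c = at_point s x0 c + D (- b)"
    using b(2) by (simp add: bar_d_minus algebra_simps)
  then show ?thesis using b(1) by (intro exI[of _ "- b"]) simp
qed

section \<open>The action of the automorphism group on partial bases with complements\<close>

definition vact :: "(word \<Rightarrow> word) \<Rightarrow> word \<times> word set \<Rightarrow> word \<times> word set"
  where "vact \<phi> v = (\<phi> (fst v), \<phi> ` snd v)"

definition wact :: "(word \<Rightarrow> word) \<Rightarrow> (word \<times> word set) list \<Rightarrow> (word \<times> word set) list"
  where "wact \<phi> = map (vact \<phi>)"

definition frame_layer :: "nat \<Rightarrow> nat \<Rightarrow> (word \<times> word set) list set"
  where "frame_layer n a = {w \<in> frame_words n. length w = a}"

lemma wact_Nil [simp]: "wact \<phi> [] = []"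
  by (simp add: wact_def)

lemma frame_vertices_carrier:
  assumes "B \<in> bases n" "v \<in> frame_vertices n B"
  shows "fst v \<in> carrier (free_group n)" "snd v \<subseteq> carrier (free_group n)"
proof -
  interpret F: group "free_group n" by (rule group_free_group)
  obtain x where x: "x \<in> B" "v = (x, gen n (B - {x}))" using assms(2) by (auto simp: frame_vertices_def)
  have B: "B \<subseteq> carrier (free_group n)" by (rule basis_carrier[OF assms(1)])
  have "gen n (B - {x}) \<subseteq> carrier (free_group n)"
    using F.generate_incl[of "B - {x}"] B by blast
  then show "fst v \<in> carrier (free_group n)" "snd v \<subseteq> carrier (free_group n)" using x B by auto
qed

lemma image_basis:
  assumes \<phi>: "\<phi> \<in> carrier (Aut n)" and B: "B \<in> bases n"
  shows "\<phi> ` B \<in> bases n"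
proof -
  obtain \<psi> where \<psi>: "\<psi> \<in> carrier (Aut n)" "B = \<psi> ` std_basis n" using B by (auto simp: bases_def)
  have "(\<phi> \<otimes>\<^bsub>Aut n\<^esub> \<psi>) ` std_basis n = \<phi> ` B"
    unfolding \<psi>(2) image_image
    using std_basis_carrier[of n] by (intro image_cong refl Aut_mult_apply[OF \<phi> \<psi>(1)]) auto
  moreover have "\<phi> \<otimes>\<^bsub>Aut n\<^esub> \<psi> \<in> carrier (Aut n)"
    using monoid.m_closed[OF group.is_monoid[OF group_Aut] \<phi> \<psi>(1)] .
  ultimately show ?thesis unfolding bases_def by (metis imageI)
qed

lemma vact_frame_vertices:
  assumes \<phi>: "\<phi> \<in> carrier (Aut n)" and B: "B \<in> bases n"
  shows "vact \<phi> ` frame_vertices n B = frame_vertices n (\<phi> ` B)"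
proof -
  have "\<phi> ` gen n (B - {x}) = gen n (\<phi> ` B - {\<phi> x})" if "x \<in> B" for x
  proof -
    have "\<phi> ` gen n (B - {x}) = gen n (\<phi> ` (B - {x}))"
      by (rule gen_image[OF \<phi>, symmetric]) (use basis_carrier[OF B] in auto)
    also have "\<phi> ` (B - {x}) = \<phi> ` B - {\<phi> x}"
      using inj_on_image_set_diff[OF Aut_inj[OF \<phi>], of B "{x}"] basis_carrier[OF B] that by auto
    finally show ?thesis .
  qed
  then show ?thesis
    unfolding frame_vertices_def image_image by (intro image_cong) (auto simp: vact_def)
qed

lemma inj_on_vact:
  assumes "\<phi> \<in> carrier (Aut n)" "B \<in> bases n"
  shows "inj_on (vact \<phi>) (frame_vertices n B)"
proof (rule inj_onI)
  fix v w assume vw: "v \<in> frame_vertices n B" "w \<in> frame_vertices n B" "vact \<phi> v = vact \<phi> w"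
  then have "\<phi> (fst v) = \<phi> (fst w)" by (simp add: vact_def)
  then have "fst v = fst w"
    using inj_onD[OF Aut_inj[OF assms(1)]] frame_vertices_carrier(1)[OF assms(2)] vw by blast
  then show "v = w" using vw by (auto simp: frame_vertices_def)
qed

lemma wact_frame_words:
  assumes \<phi>: "\<phi> \<in> carrier (Aut n)" and w: "w \<in> frame_words n"
  shows "wact \<phi> w \<in> frame_words n"
proof -
  obtain B where B: "B \<in> bases n" "w \<in> inj_words (frame_vertices n B)" using w by (auto simp: frame_words_def)
  have "distinct (map (vact \<phi>) w)"
    using B(2) inj_on_subset[OF inj_on_vact[OF \<phi> B(1)]] by (auto simp: distinct_map inj_words_def)
  moreover have "set (map (vact \<phi>) w) \<subseteq> frame_vertices n (\<phi> ` B)"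
    using B(2) vact_frame_vertices[OF \<phi> B(1)] by (auto simp: inj_words_def)
  ultimately show ?thesis
    using image_basis[OF \<phi> B(1)] by (auto simp: frame_words_def inj_words_def wact_def)
qed

lemma frame_words_carrier:
  assumes "w \<in> frame_words n" "v \<in> set w"
  shows "fst v \<in> carrier (free_group n)" "snd v \<subseteq> carrier (free_group n)"
proof -
  obtain B where "B \<in> bases n" "w \<in> inj_words (frame_vertices n B)" using assms by (auto simp: frame_words_def)
  then show "fst v \<in> carrier (free_group n)" "snd v \<subseteq> carrier (free_group n)"
    using frame_vertices_carrier[of B n v] assms(2) by (auto simp: inj_words_def)
qed

lemma vact_mult:
  assumes "\<phi> \<in> carrier (Aut n)" "\<psi> \<in> carrier (Aut n)"
    "fst v \<in> carrier (free_group n)" "snd v \<subseteq> carrier (free_group n)"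
  shows "vact (\<phi> \<otimes>\<^bsub>Aut n\<^esub> \<psi>) v = vact \<phi> (vact \<psi> v)"
proof -
  have "(\<phi> \<otimes>\<^bsub>Aut n\<^esub> \<psi>) ` snd v = \<phi> ` \<psi> ` snd v"
    unfolding image_image using assms(4) by (intro image_cong refl Aut_mult_apply[OF assms(1,2)]) auto
  then show ?thesis using Aut_mult_apply[OF assms(1-3)] by (simp add: vact_def)
qed

lemma wact_mult:
  assumes "\<phi> \<in> carrier (Aut n)" "\<psi> \<in> carrier (Aut n)" "w \<in> frame_words n"
  shows "wact (\<phi> \<otimes>\<^bsub>Aut n\<^esub> \<psi>) w = wact \<phi> (wact \<psi> w)"
  unfolding wact_def map_map comp_def
  by (rule map_cong[OF refl vact_mult[OF assms(1,2)]]) (use frame_words_carrier[OF assms(3)] in auto)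

lemma wact_one:
  assumes "w \<in> frame_words n"
  shows "wact \<one>\<^bsub>Aut n\<^esub> w = w"
  unfolding wact_def
proof (rule map_idI)
  fix v assume v: "v \<in> set w"
  have "\<one>\<^bsub>Aut n\<^esub> ` snd v = (\<lambda>x. x) ` snd v"
    using frame_words_carrier(2)[OF assms v] by (intro image_cong) (auto simp: Aut_one)
  then show "vact \<one>\<^bsub>Aut n\<^esub> v = v"
    using frame_words_carrier(1)[OF assms v] by (simp add: vact_def Aut_one)
qed

lemma frame_action: "group_action (Aut n) wact (frame_layer n a)"
proof -
  interpret A: group "Aut n" by (rule group_Aut)
  show ?thesis
    by unfold_locales (auto simp: frame_layer_def wact_frame_words wact_mult wact_one, simp add: wact_def)
qed

section \<open>Extending automorphisms to larger free groups\<close>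

definition ext :: "nat \<Rightarrow> nat \<Rightarrow> (word \<Rightarrow> word) \<Rightarrow> word \<Rightarrow> word"
  where "ext m n \<phi> = letter_aut n (stab_letter m \<phi>)"

lemma stab_eq_ext: "stab m = ext m (Suc m)"
  by (simp add: fun_eq_iff stab_def ext_def letter_aut_def subst_def)

lemma inv_compat_stab_letter: "inv_compat (stab_letter m \<phi>)"
  unfolding inv_compat_def by (auto simp: stab_letter_def inv_letter_def inv_word_def rev_map comp_def)

lemma free_group_mono: "m \<le> n \<Longrightarrow> carrier (free_group m) \<subseteq> carrier (free_group n)"
  by (fastforce simp: in_free_group)

lemma stab_letter_closed:
  assumes "\<phi> \<in> carrier (Aut m)" "m \<le> n" "fst l < n"
  shows "stab_letter m \<phi> l \<in> carrier (free_group n)"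
proof (cases "fst l < m")
  case True
  then have "\<phi> [(fst l, False)] \<in> carrier (free_group m)"
    by (intro Aut_closed[OF assms(1)]) (simp add: in_free_group)
  then show ?thesis
    using True free_group_mono[OF assms(2)] inv_word_in_free_group by (auto simp: stab_letter_def)
qed (use assms in \<open>simp add: stab_letter_def in_free_group\<close>)

lemma subst_stab_letter:
  assumes "\<phi> \<in> carrier (Aut m)" "m \<le> n" "w \<in> carrier (free_group m)"
  shows "subst (stab_letter m \<phi>) w = \<phi> w"
proof -
  have "letter_aut m (stab_letter m \<phi>) \<in> hom (free_group m) (free_group m)"
    by (rule letter_aut_hom[OF inv_compat_stab_letter]) (use stab_letter_closed[OF assms(1)] in simp)
  then have "letter_aut m (stab_letter m \<phi>) w = \<phi> w"
  proof (rule hom_eqI[OF _ Aut_hom[OF assms(1)] _ assms(3)])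
    fix i assume i: "i < m"
    then have "reduced (\<phi> [(i, False)])" using Aut_closed[OF assms(1), of "[(i, False)]"] by (simp add: in_free_group)
    then show "letter_aut m (stab_letter m \<phi>) [(i, False)] = \<phi> [(i, False)]"
      using i by (subst letter_aut_gen) (auto simp: stab_letter_def)
  qed
  then show ?thesis using assms(3) by (simp add: letter_aut_def)
qed

lemma ext_Aut:
  assumes "\<phi> \<in> carrier (Aut m)" "m \<le> n"
  shows "ext m n \<phi> \<in> carrier (Aut n)"
proof -
  interpret A: group "Aut m" by (rule group_Aut)
  let ?\<psi> = "inv\<^bsub>Aut m\<^esub> \<phi>"
  have \<psi>: "?\<psi> \<in> carrier (Aut m)" using assms(1) by simp
  have inv: "\<phi> (?\<psi> w) = w" "?\<psi> (\<phi> w) = w" if "w \<in> carrier (free_group m)" for w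
    using Aut_mult_apply[OF assms(1) \<psi> that] Aut_mult_apply[OF \<psi> assms(1) that] assms(1) that
    by (simp_all add: Aut_one)
  have key: "subst (stab_letter m \<alpha>) (stab_letter m \<beta> (i, False)) = [(i, False)]"
    if "i < n" "\<alpha> \<in> carrier (Aut m)" "\<beta> \<in> carrier (Aut m)"
      "\<And>w. w \<in> carrier (free_group m) \<Longrightarrow> \<alpha> (\<beta> w) = w" for \<alpha> \<beta> i
  proof (cases "i < m")
    case True
    then have i: "[(i, False)] \<in> carrier (free_group m)" by (simp add: in_free_group)
    then show ?thesis
      using True that subst_stab_letter[OF that(2) assms(2) Aut_closed[OF that(3) i]] by (simp add: stab_letter_def)
  next
    case False
    then show ?thesis by (simp add: stab_letter_def subst_def reduce_reduced)
  qed
  show ?thesis unfolding ext_def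
    by (rule letter_aut_in_Aut[where g = "stab_letter m ?\<psi>"])
       (use key inv assms \<psi> inv_compat_stab_letter stab_letter_closed in auto)
qed

lemma ext_apply:
  assumes "\<phi> \<in> carrier (Aut m)" "m \<le> n" "w \<in> carrier (free_group m)"
  shows "ext m n \<phi> w = \<phi> w"
  using subst_stab_letter[OF assms] free_group_mono[OF assms(2)] assms(3) by (auto simp: ext_def letter_aut_def)

lemma ext_gen:
  assumes "\<phi> \<in> carrier (Aut m)" "m \<le> n" "i < n"
  shows "ext m n \<phi> [(i, False)] = (if i < m then \<phi> [(i, False)] else [(i, False)])"
proof (cases "i < m")
  case True
  then show ?thesis using ext_apply[OF assms(1,2), of "[(i, False)]"] by (simp add: in_free_group)
next
  case False
  then show ?thesis using assms(3) unfolding ext_def by (subst letter_aut_gen) (auto simp: stab_letter_def)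
qed

lemma ext_mult:
  assumes "\<phi> \<in> carrier (Aut m)" "\<psi> \<in> carrier (Aut m)" "m \<le> n"
  shows "ext m n (\<phi> \<otimes>\<^bsub>Aut m\<^esub> \<psi>) = ext m n \<phi> \<otimes>\<^bsub>Aut n\<^esub> ext m n \<psi>"
proof (rule Aut_eqI)
  interpret A: group "Aut m" by (rule group_Aut)
  interpret An: group "Aut n" by (rule group_Aut)
  note e = ext_Aut[OF assms(1,3)] ext_Aut[OF assms(2,3)]
  show "ext m n (\<phi> \<otimes>\<^bsub>Aut m\<^esub> \<psi>) \<in> carrier (Aut n)" using assms by (intro ext_Aut) auto
  show "ext m n \<phi> \<otimes>\<^bsub>Aut n\<^esub> ext m n \<psi> \<in> carrier (Aut n)" using e by simp
  fix i assume i: "i < n"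
  have in_n: "[(i, False)] \<in> carrier (free_group n)" using i by (simp add: in_free_group)
  show "ext m n (\<phi> \<otimes>\<^bsub>Aut m\<^esub> \<psi>) [(i, False)] = (ext m n \<phi> \<otimes>\<^bsub>Aut n\<^esub> ext m n \<psi>) [(i, False)]"
  proof (cases "i < m")
    case True
    then have im: "[(i, False)] \<in> carrier (free_group m)" by (simp add: in_free_group)
    show ?thesis
      using True i assms im in_n
      by (simp add: ext_gen Aut_mult_apply[OF e] Aut_mult_apply[OF assms(1,2)] ext_apply Aut_closed)
  next
    case False
    then show ?thesis using i assms in_n by (simp add: ext_gen Aut_mult_apply[OF e])
  qed
qed

lemma ext_inj: "m \<le> n \<Longrightarrow> inj_on (ext m n) (carrier (Aut m))"
proof (rule inj_onI)
  fix \<phi> \<psi> assume *: "m \<le> n" "\<phi> \<in> carrier (Aut m)" "\<psi> \<in> carrier (Aut m)" "ext m n \<phi> = ext m n \<psi>"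
  show "\<phi> = \<psi>"
  proof (rule Aut_eqI[OF *(2,3)])
    fix i assume "i < m"
    then show "\<phi> [(i, False)] = \<psi> [(i, False)]"
      using ext_gen[OF *(2,1), of i] ext_gen[OF *(3,1), of i] *(1,4) by simp
  qed
qed

lemma ext_self: "\<phi> \<in> carrier (Aut n) \<Longrightarrow> ext n n \<phi> = \<phi>"
  by (rule Aut_eqI) (auto simp: ext_Aut ext_gen)

lemma ext_stab:
  assumes "\<phi> \<in> carrier (Aut m)" "Suc m \<le> n"
  shows "ext (Suc m) n (stab m \<phi>) = ext m n \<phi>"
proof -
  have s: "stab m \<phi> \<in> carrier (Aut (Suc m))" unfolding stab_eq_ext by (rule ext_Aut) (use assms in auto)
  show ?thesis
  proof (rule Aut_eqI)
    show "ext (Suc m) n (stab m \<phi>) \<in> carrier (Aut n)" "ext m n \<phi> \<in> carrier (Aut n)"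
      using assms s by (auto intro: ext_Aut)
    fix i assume i: "i < n"
    have "stab m \<phi> [(i, False)] = (if i < m then \<phi> [(i, False)] else [(i, False)])" if "i < Suc m"
      unfolding stab_eq_ext using that assms by (intro ext_gen) auto
    then show "ext (Suc m) n (stab m \<phi>) [(i, False)] = ext m n \<phi> [(i, False)]"
      using i assms s by (auto simp: ext_gen)
  qed
qed

definition std_vertex :: "nat \<Rightarrow> nat \<Rightarrow> word \<times> word set"
  where "std_vertex n i = ([(i, False)], {w \<in> carrier (free_group n). \<forall>l\<in>set w. fst l \<noteq> i})"

text \<open>The last \<open>a\<close> generators are used, so that the stabiliser acts on the first
  \<open>n - a\<close> ones and its inclusion is an iterate of \<open>stab\<close>.\<close>

definition std_word :: "nat \<Rightarrow> nat \<Rightarrow> (word \<times> word set) list"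
  where "std_word n a = map (std_vertex n) [n - a..<n]"

lemma std_vertex_eq: "i < n \<Longrightarrow> std_vertex n i = ([(i, False)], gen n (std_basis n - {[(i, False)]}))"
  using gen_std_diff[of "{i}" n] by (simp add: std_vertex_def)

lemma frame_vertices_std: "frame_vertices n (std_basis n) = std_vertex n ` {..<n}"
  unfolding frame_vertices_def std_basis_def image_image
  by (rule image_cong) (auto simp: std_vertex_eq std_basis_def)

lemma inj_std_vertex: "inj_on (std_vertex n) A"
  by (auto simp: inj_on_def std_vertex_def)

lemma std_word_in: "a \<le> n \<Longrightarrow> std_word n a \<in> frame_layer n a"
  using id_basis[of n]
  by (auto simp: std_word_def frame_layer_def frame_words_def inj_words_def frame_vertices_std distinct_map inj_std_vertex
      intro!: bexI[of _ "std_basis n"])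

lemma ext_fixes_std_vertex:
  assumes \<phi>: "\<phi> \<in> carrier (Aut m)" and i: "m \<le> i" "i < n"
  shows "vact (ext m n \<phi>) (std_vertex n i) = std_vertex n i"
proof -
  interpret A: group "Aut m" by (rule group_Aut)
  let ?W = "{w \<in> carrier (free_group n). \<forall>l\<in>set w. fst l \<noteq> i}"
  have mn: "m \<le> n" using i by simp
  have sub: "ext m n \<psi> w \<in> ?W" if \<psi>: "\<psi> \<in> carrier (Aut m)" and w: "w \<in> ?W" for \<psi> w
  proof -
    have "fst k \<noteq> i" if l: "l \<in> set w" "k \<in> set (stab_letter m \<psi> l)" for l k
    proof (cases "fst l < m")
      case True
      then have "\<psi> [(fst l, False)] \<in> carrier (free_group m)"
        by (intro Aut_closed[OF \<psi>]) (simp add: in_free_group)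
      then have "stab_letter m \<psi> l \<in> carrier (free_group m)"
        using True inv_word_in_free_group by (auto simp: stab_letter_def)
      then show ?thesis using l(2) i by (auto simp: in_free_group)
    next
      case False
      then show ?thesis using l w by (auto simp: stab_letter_def)
    qed
    then have "\<forall>k\<in>set (concat (map (stab_letter m \<psi>) w)). fst k \<noteq> i" by auto
    then have "\<forall>k\<in>set (ext m n \<psi> w). fst k \<noteq> i"
      using w set_reduce by (fastforce simp: ext_def letter_aut_def subst_def)
    moreover have "ext m n \<psi> w \<in> carrier (free_group n)" using Aut_closed[OF ext_Aut[OF \<psi> mn]] w by blast
    ultimately show ?thesis by blast
  qed
  have "ext m n \<phi> ` ?W = ?W"
  proof
    show "ext m n \<phi> ` ?W \<subseteq> ?W" using sub[OF \<phi>] by blast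
    show "?W \<subseteq> ext m n \<phi> ` ?W"
    proof
      fix w assume w: "w \<in> ?W"
      let ?\<psi> = "inv\<^bsub>Aut m\<^esub> \<phi>"
      have \<psi>: "?\<psi> \<in> carrier (Aut m)" using \<phi> by simp
      have "ext m n \<phi> (ext m n ?\<psi> w) = ext m n (\<phi> \<otimes>\<^bsub>Aut m\<^esub> ?\<psi>) w"
        using w Aut_mult_apply[OF ext_Aut[OF \<phi> mn] ext_Aut[OF \<psi> mn]] by (simp add: ext_mult[OF \<phi> \<psi> mn])
      also have "ext m n (\<phi> \<otimes>\<^bsub>Aut m\<^esub> ?\<psi>) = \<one>\<^bsub>Aut n\<^esub>"
      proof (rule Aut_eqI)
        show "ext m n (\<phi> \<otimes>\<^bsub>Aut m\<^esub> ?\<psi>) \<in> carrier (Aut n)" using \<phi> \<psi> mn by (intro ext_Aut) auto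
        show "\<one>\<^bsub>Aut n\<^esub> \<in> carrier (Aut n)" using monoid.one_closed[OF group.is_monoid[OF group_Aut]] .
        fix k assume "k < n"
        then show "ext m n (\<phi> \<otimes>\<^bsub>Aut m\<^esub> ?\<psi>) [(k, False)] = \<one>\<^bsub>Aut n\<^esub> [(k, False)]"
          using \<phi> mn ext_gen[OF A.one_closed mn, of k] by (auto simp: Aut_one in_free_group)
      qed
      also have "\<one>\<^bsub>Aut n\<^esub> w = w" using w by (simp add: Aut_one)
      finally have eq: "ext m n \<phi> (ext m n ?\<psi> w) = w" .
      show "w \<in> ext m n \<phi> ` ?W"
        by (rule image_eqI[where x = "ext m n ?\<psi> w"], rule eq[symmetric], rule sub[OF \<psi> w])
    qed
  qed
  then show ?thesis using ext_gen[OF \<phi> mn i(2)] i(1) by (simp add: vact_def std_vertex_def)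
qed

lemma ext_fixes_std_word:
  assumes "\<phi> \<in> carrier (Aut m)" "m \<le> n - a"
  shows "wact (ext m n \<phi>) (std_word n a) = std_word n a"
  unfolding wact_def std_word_def map_map
  by (rule map_cong[OF refl]) (use assms ext_fixes_std_vertex in auto)

text \<open>Fixing the generators \<open>x_i\<close> with \<open>m \<le> i\<close> would not suffice
  to preserve the subgroup on the first \<open>m\<close> generators. Preserving the recorded
  complements does, because that subgroup is their intersection; \<open>\<phi>\<close> is then the
  extension of its restriction.\<close>

lemma std_word_stabilizer:
  assumes \<phi>: "\<phi> \<in> carrier (Aut n)" and a: "a \<le> n" and fixed: "wact \<phi> (std_word n a) = std_word n a"
  shows "\<phi> \<in> ext (n - a) n ` carrier (Aut (n - a))"
proof -
  define m where "m = n - a"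
  have mn: "m \<le> n" by (simp add: m_def)
  let ?W = "\<lambda>i. {w \<in> carrier (free_group n). \<forall>l\<in>set w. fst l \<noteq> i}"
  have v: "vact \<phi> (std_vertex n i) = std_vertex n i" if "m \<le> i" "i < n" for i
  proof -
    have "\<forall>x\<in>set [n - a..<n]. (vact \<phi> \<circ> std_vertex n) x = std_vertex n x"
      using fixed unfolding wact_def std_word_def map_map by (simp only: map_eq_conv)
    then show ?thesis using that by (simp add: m_def)
  qed
  have gen: "\<phi> [(i, False)] = [(i, False)]" "\<phi> ` ?W i = ?W i" if "m \<le> i" "i < n" for i
    using v[OF that] by (auto simp: vact_def std_vertex_def)
  have Fm: "w \<in> carrier (free_group m) \<longleftrightarrow> w \<in> carrier (free_group n) \<and> (\<forall>i. m \<le> i \<longrightarrow> i < n \<longrightarrow> w \<in> ?W i)" for w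
  proof
    assume "w \<in> carrier (free_group m)"
    then show "w \<in> carrier (free_group n) \<and> (\<forall>i. m \<le> i \<longrightarrow> i < n \<longrightarrow> w \<in> ?W i)"
      using mn by (fastforce simp: in_free_group)
  next
    assume *: "w \<in> carrier (free_group n) \<and> (\<forall>i. m \<le> i \<longrightarrow> i < n \<longrightarrow> w \<in> ?W i)"
    have "fst l < m" if "l \<in> set w" for l
    proof (rule ccontr)
      assume "\<not> fst l < m"
      moreover have "fst l < n" using * that by (simp add: in_free_group)
      ultimately have "w \<in> ?W (fst l)" using * by simp
      then show False using that by blast
    qed
    then show "w \<in> carrier (free_group m)" using * by (simp add: in_free_group)
  qed
  have img: "\<phi> ` carrier (free_group m) = carrier (free_group m)"
  proof
    show "\<phi> ` carrier (free_group m) \<subseteq> carrier (free_group m)"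
    proof
      fix w assume "w \<in> \<phi> ` carrier (free_group m)"
      then obtain v where v: "w = \<phi> v" "v \<in> carrier (free_group m)" by blast
      have "w \<in> carrier (free_group n)" using v Fm Aut_closed[OF \<phi>] by blast
      moreover have "w \<in> ?W i" if "m \<le> i" "i < n" for i
        using gen(2)[OF that] v Fm[of v] that by blast
      ultimately show "w \<in> carrier (free_group m)" using Fm by blast
    qed
    show "carrier (free_group m) \<subseteq> \<phi> ` carrier (free_group m)"
    proof
      fix w assume w: "w \<in> carrier (free_group m)"
      then have "w \<in> carrier (free_group n)" using Fm by blast
      then obtain v where v: "v \<in> carrier (free_group n)" "w = \<phi> v" using Aut_image[OF \<phi>] by blast
      have "v \<in> ?W i" if i: "m \<le> i" "i < n" for i
      proof -
        have "w \<in> \<phi> ` ?W i" using Fm[of w] w i gen(2)[OF i] by blast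
        then obtain v' where "v' \<in> ?W i" "w = \<phi> v'" by blast
        then show ?thesis using v inj_onD[OF Aut_inj[OF \<phi>], of v v'] by auto
      qed
      then show "w \<in> \<phi> ` carrier (free_group m)" using v Fm by blast
    qed
  qed
  define \<psi> where "\<psi> = restrict \<phi> (carrier (free_group m))"
  have sub: "carrier (free_group m) \<subseteq> carrier (free_group n)" by (rule free_group_mono[OF mn])
  interpret Fm: group "free_group m" by (rule group_free_group)
  have hom: "\<phi> (x \<otimes>\<^bsub>free_group n\<^esub> y) = \<phi> x \<otimes>\<^bsub>free_group n\<^esub> \<phi> y"
    if "x \<in> carrier (free_group n)" "y \<in> carrier (free_group n)" for x y
    using Aut_hom[OF \<phi>] that by (simp add: hom_def)
  have "\<psi> \<in> hom (free_group m) (free_group m)"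
  proof (rule homI)
    show "\<psi> x \<in> carrier (free_group m)" if "x \<in> carrier (free_group m)" for x
      using that img by (auto simp: \<psi>_def)
    fix x y assume xy: "x \<in> carrier (free_group m)" "y \<in> carrier (free_group m)"
    then show "\<psi> (x \<otimes>\<^bsub>free_group m\<^esub> y) = \<psi> x \<otimes>\<^bsub>free_group m\<^esub> \<psi> y"
      using hom[of x y] sub Fm.m_closed[OF xy] by (auto simp: \<psi>_def)
  qed
  moreover have "bij_betw \<psi> (carrier (free_group m)) (carrier (free_group m))"
  proof -
    have "bij_betw \<phi> (carrier (free_group m)) (carrier (free_group m))"
      using img inj_on_subset[OF Aut_inj[OF \<phi>] sub] by (simp add: bij_betw_def)
    then show ?thesis unfolding \<psi>_def by (simp cong: bij_betw_cong)
  qed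
  ultimately have \<psi>: "\<psi> \<in> carrier (Aut m)"
    by (simp add: carrier_Aut auto_def Bij_def \<psi>_def)
  have "ext m n \<psi> = \<phi>"
  proof (rule Aut_eqI[OF ext_Aut[OF \<psi> mn] \<phi>])
    fix i assume "i < n"
    then show "ext m n \<psi> [(i, False)] = \<phi> [(i, False)]"
      using gen(1)[of i] ext_gen[OF \<psi> mn, of i] by (auto simp: \<psi>_def in_free_group)
  qed
  then show ?thesis using \<psi> unfolding m_def by blast
qed

section \<open>Permutations of the generators\<close>

lemma ex_permutes_map:
  assumes "finite S" "distinct js" "distinct ks" "length js = length ks" "set js \<subseteq> S" "set ks \<subseteq> S"
  shows "\<exists>p. p permutes S \<and> map p js = ks"
proof -
  have "\<exists>f. bij_betw f (set js) (set ks) \<and> map f js = ks"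
    using assms(4,2,3)
  proof (induction js ks rule: list_induct2)
    case (Cons j js k ks)
    then obtain f where f: "bij_betw f (set js) (set ks)" "map f js = ks" by auto
    have "bij_betw (f(j := k)) (set (j # js)) (set (k # ks))"
    proof -
      have "bij_betw (f(j := k)) (set js) (set ks)"
        using f(1) Cons.prems by (subst bij_betw_cong[of _ _ f]) auto
      then show ?thesis using notIn_Un_bij_betw[of j "set js" "f(j := k)" "set ks"] Cons.prems by auto
    qed
    moreover have "map (f(j := k)) (j # js) = k # ks" using f(2) Cons.prems by auto
    ultimately show ?case by (intro exI[of _ "f(j := k)"] conjI)
  qed auto
  then obtain f where f: "bij_betw f (set js) (set ks)" "map f js = ks" by blast
  have "card (S - set js) = card (S - set ks)"
    using assms by (simp add: card_Diff_subset distinct_card)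
  then obtain g where g: "bij_betw g (S - set js) (S - set ks)"
    using assms(1) by (metis bij_betw_iff_card finite_Diff)
  define p where "p x = (if x \<in> set js then f x else if x \<in> S then g x else x)" for x
  have "bij_betw p (set js) (set ks)" using f(1) by (subst bij_betw_cong[of _ _ f]) (auto simp: p_def)
  moreover have "bij_betw p (S - set js) (S - set ks)" using g by (subst bij_betw_cong[of _ _ g]) (auto simp: p_def)
  ultimately have "bij_betw p (set js \<union> (S - set js)) (set ks \<union> (S - set ks))"
    by (rule bij_betw_combine) auto
  then have "bij_betw p S S" using assms(5,6) by (simp add: Un_absorb1)
  then have "p permutes S" using assms(5) by (intro bij_imp_permutes) (auto simp: p_def)
  moreover have "map p js = ks" using f(2) by (auto simp: p_def)
  ultimately show ?thesis by blast
qed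

abbreviation perm_aut :: "nat \<Rightarrow> (nat \<Rightarrow> nat) \<Rightarrow> word \<Rightarrow> word"
  where "perm_aut n p \<equiv> letter_aut n (perm_map p)"

lemma perm_aut_gen: "i < n \<Longrightarrow> perm_aut n p [(i, False)] = [(p i, False)]"
  by (subst letter_aut_gen) (auto simp: perm_map_def)

lemma perm_aut_std_vertex:
  assumes p: "p permutes {..<n}" and i: "i < n"
  shows "vact (perm_aut n p) (std_vertex n i) = std_vertex n (p i)"
proof -
  let ?P = "perm_aut n p"
  have P: "?P \<in> carrier (Aut n)" by (rule perm_Aut[OF p])
  have pi: "p i < n" using permutes_in_image[OF p] i by auto
  have "?P ` std_basis n = (\<lambda>i. [(i, False)]) ` p ` {..<n}"
    unfolding std_basis_def image_image by (rule image_cong) (auto simp: perm_aut_gen)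
  then have img: "?P ` std_basis n = std_basis n" using permutes_image[OF p] by (simp add: std_basis_def)
  have "?P ` gen n (std_basis n - {[(i, False)]}) = gen n (?P ` (std_basis n - {[(i, False)]}))"
    by (rule gen_image[OF P, symmetric]) (use std_basis_carrier in blast)
  also have "?P ` (std_basis n - {[(i, False)]}) = ?P ` std_basis n - ?P ` {[(i, False)]}"
    by (rule inj_on_image_set_diff[OF Aut_inj[OF P]]) (use std_basis_carrier i in \<open>auto simp: in_free_group\<close>)
  also have "\<dots> = std_basis n - {[(p i, False)]}" using img perm_aut_gen[OF i] by simp
  finally show ?thesis
    using perm_aut_gen[OF i] by (simp add: std_vertex_eq[OF i] std_vertex_eq[OF pi] vact_def)
qed

lemma wact_perm_aut:
  assumes "p permutes {..<n}" "set js \<subseteq> {..<n}"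
  shows "wact (perm_aut n p) (map (std_vertex n) js) = map (std_vertex n) (map p js)"
  using assms(2) perm_aut_std_vertex[OF assms(1)] by (auto simp: wact_def)

lemma frame_layer_transitive:
  assumes w: "w \<in> frame_layer n a"
  shows "\<exists>\<phi>\<in>carrier (Aut n). wact \<phi> w = std_word n a"
proof -
  interpret A: group "Aut n" by (rule group_Aut)
  obtain B where B: "B \<in> bases n" "w \<in> inj_words (frame_vertices n B)" "length w = a"
    using w by (auto simp: frame_layer_def frame_words_def)
  then obtain \<psi> where \<psi>: "\<psi> \<in> carrier (Aut n)" "B = \<psi> ` std_basis n" by (auto simp: bases_def)
  have "frame_vertices n B = vact \<psi> ` std_vertex n ` {..<n}"
    using vact_frame_vertices[OF \<psi>(1) id_basis] \<psi>(2) frame_vertices_std by simp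
  then have "w \<in> lists ((\<lambda>i. vact \<psi> (std_vertex n i)) ` {..<n})"
    using B(2) by (auto simp: inj_words_def image_image)
  then obtain js where js: "w = map (\<lambda>i. vact \<psi> (std_vertex n i)) js" "set js \<subseteq> {..<n}"
    unfolding lists_image by auto
  have "distinct js" using B(2) js(1) by (simp add: inj_words_def distinct_map)
  have len: "length js = a" using js B(3) by simp
  then have "a \<le> n" using \<open>distinct js\<close> js(2) card_mono[of "{..<n}" "set js"] by (simp add: distinct_card)
  have "\<exists>p. p permutes {..<n} \<and> map p [n - a..<n] = js"
    by (rule ex_permutes_map) (use \<open>distinct js\<close> js(2) len \<open>a \<le> n\<close> in auto)
  then obtain p where p: "p permutes {..<n}" "map p [n - a..<n] = js" by blast
  let ?P = "perm_aut n p"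
  have P: "?P \<in> carrier (Aut n)" by (rule perm_Aut[OF p(1)])
  have sw: "std_word n a \<in> frame_words n" using std_word_in[OF \<open>a \<le> n\<close>] by (simp add: frame_layer_def)
  have "wact ?P (std_word n a) = map (std_vertex n) js"
    unfolding std_word_def p(2)[symmetric] by (rule wact_perm_aut[OF p(1)]) auto
  then have gw: "wact (\<psi> \<otimes>\<^bsub>Aut n\<^esub> ?P) (std_word n a) = w"
    using wact_mult[OF \<psi>(1) P sw] js(1) by (simp add: wact_def)
  define g where "g = \<psi> \<otimes>\<^bsub>Aut n\<^esub> ?P"
  have g: "g \<in> carrier (Aut n)" using \<psi>(1) P by (simp add: g_def)
  have "wact (inv\<^bsub>Aut n\<^esub> g) w = wact (inv\<^bsub>Aut n\<^esub> g \<otimes>\<^bsub>Aut n\<^esub> g) (std_word n a)"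
    using wact_mult[OF A.inv_closed[OF g] g sw] gw by (simp add: g_def)
  also have "\<dots> = std_word n a" using g wact_one[OF sw] by simp
  finally show ?thesis using g by (intro bexI[of _ "inv\<^bsub>Aut n\<^esub> g"]) auto
qed

lemma perm_aut_commutes_ext:
  assumes p: "p permutes {m..<n}" and mn: "m \<le> n" and \<phi>: "\<phi> \<in> carrier (Aut m)"
  shows "perm_aut n p \<otimes>\<^bsub>Aut n\<^esub> ext m n \<phi> = ext m n \<phi> \<otimes>\<^bsub>Aut n\<^esub> perm_aut n p"
proof -
  interpret A: group "Aut n" by (rule group_Aut)
  let ?P = "perm_aut n p"
  have "p permutes {..<n}" by (rule permutes_subset[OF p]) auto
  then have P: "?P \<in> carrier (Aut n)" by (rule perm_Aut)
  note e = ext_Aut[OF \<phi> mn]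
  have fixm: "?P w = w" if w: "w \<in> carrier (free_group m)" for w
  proof -
    have sub: "carrier (free_group m) \<subseteq> carrier (free_group n)" by (rule free_group_mono[OF mn])
    have "?P \<in> hom (free_group m) (free_group n)" "(\<lambda>w. w) \<in> hom (free_group m) (free_group n)"
      using Aut_hom[OF P] sub by (auto simp: hom_def)
    then show ?thesis
    proof (rule hom_eqI[OF _ _ _ w])
      fix i assume "i < m"
      then show "?P [(i, False)] = [(i, False)]"
        using perm_aut_gen[of i n p] mn permutes_not_in[OF p, of i] by simp
    qed
  qed
  show ?thesis
  proof (rule Aut_eqI)
    show "?P \<otimes>\<^bsub>Aut n\<^esub> ext m n \<phi> \<in> carrier (Aut n)" "ext m n \<phi> \<otimes>\<^bsub>Aut n\<^esub> ?P \<in> carrier (Aut n)" using P e by auto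
    fix i assume i: "i < n"
    have ic: "[(i, False)] \<in> carrier (free_group n)" using i by (simp add: in_free_group)
    show "(?P \<otimes>\<^bsub>Aut n\<^esub> ext m n \<phi>) [(i, False)] = (ext m n \<phi> \<otimes>\<^bsub>Aut n\<^esub> ?P) [(i, False)]"
    proof (cases "i < m")
      case True
      have "\<phi> [(i, False)] \<in> carrier (free_group m)"
        using True by (intro Aut_closed[OF \<phi>]) (simp add: in_free_group)
      moreover have "?P [(i, False)] = [(i, False)]" using fixm True by (simp add: in_free_group)
      ultimately show ?thesis
        using True i ic fixm by (simp add: Aut_mult_apply[OF P e] Aut_mult_apply[OF e P] ext_gen[OF \<phi> mn])
    next
      case False
      have "p i \<in> {m..<n}" using permutes_in_image[OF p, of i] False i by simp
      then show ?thesis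
        using False i ic by (simp add: Aut_mult_apply[OF P e] Aut_mult_apply[OF e P] ext_gen[OF \<phi> mn] perm_aut_gen)
    qed
  qed
qed

text \<open>A face of the standard word of length \<open>a + 1\<close> lists \<open>a\<close> of the
  last \<open>a + 1\<close> generators, so a permutation of these turns \<open>std_word n a\<close>
  into it. Such a permutation commutes with all automorphisms of the first \<open>n - a - 1\<close>
  generators; this is what lets \<open>conjugate_point\<close> identify the faces.\<close>

lemma std_word_face:
  assumes a: "Suc a \<le> n" and i: "i \<le> a"
  shows "\<exists>h\<in>carrier (Aut n). (\<forall>\<phi>\<in>carrier (Aut (n - Suc a)). h \<otimes>\<^bsub>Aut n\<^esub> ext (n - Suc a) n \<phi> = ext (n - Suc a) n \<phi> \<otimes>\<^bsub>Aut n\<^esub> h) \<and>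
     wact h (std_word n a) = take i (std_word n (Suc a)) @ drop (Suc i) (std_word n (Suc a))"
proof -
  define m where "m = n - Suc a"
  let ?L = "[m..<n]"
  let ?js = "[n - a..<n]" and ?ks = "take i ?L @ drop (Suc i) ?L"
  have len: "length ?L = Suc a" using a by (simp add: m_def)
  have "length ?js = length ?ks" using i a len by auto
  moreover have "distinct ?ks" using distinct_append[of "take i ?L" "drop i ?L"] set_drop_subset_set_drop[of i "Suc i" ?L]
    by (auto simp: distinct_drop distinct_take)
  moreover have "set ?js \<subseteq> {m..<n}" "set ?ks \<subseteq> {m..<n}"
    by (auto simp: m_def dest: in_set_takeD in_set_dropD)
  ultimately obtain p where p: "p permutes {m..<n}" "map p ?js = ?ks"
    using ex_permutes_map[of "{m..<n}" ?js ?ks] by auto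
  have pn: "p permutes {..<n}" by (rule permutes_subset[OF p(1)]) auto
  have "wact (perm_aut n p) (std_word n a) = map (std_vertex n) ?ks"
    unfolding std_word_def p(2)[symmetric] by (rule wact_perm_aut[OF pn]) auto
  also have "\<dots> = take i (std_word n (Suc a)) @ drop (Suc i) (std_word n (Suc a))"
    by (simp add: std_word_def m_def take_map drop_map)
  finally show ?thesis
    using perm_Aut[OF pn] perm_aut_commutes_ext[OF p(1)] by (intro bexI[of _ "perm_aut n p"]) (auto simp: m_def)
qed

section \<open>Comparing the first two columns of a double complex\<close>

definition alt :: "nat \<Rightarrow> 'c::ab_group_add \<Rightarrow> 'c"
  where "alt a x = (if even a then x else - x)"

locale double_complex =
  fixes C :: "nat \<Rightarrow> nat \<Rightarrow> 'c::ab_group_add set" and dh dv :: "'c \<Rightarrow> 'c"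
  assumes zero_in: "0 \<in> C a q" and diff_in: "x \<in> C a q \<Longrightarrow> y \<in> C a q \<Longrightarrow> x - y \<in> C a q"
    and dh_diff: "dh (x - y) = dh x - dh y" and dv_diff: "dv (x - y) = dv x - dv y"
    and dh_in: "x \<in> C (Suc a) q \<Longrightarrow> dh x \<in> C a q" and dv_in: "x \<in> C a (Suc q) \<Longrightarrow> dv x \<in> C a q"
    and dh_0: "x \<in> C 0 q \<Longrightarrow> dh x = 0" and dv_0: "x \<in> C a 0 \<Longrightarrow> dv x = 0"
    and dh_dh: "x \<in> C a q \<Longrightarrow> dh (dh x) = 0" and dv_dv: "x \<in> C a q \<Longrightarrow> dv (dv x) = 0"
    and dh_dv: "x \<in> C a q \<Longrightarrow> dh (dv x) = dv (dh x)"
begin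

lemma dh_zero [simp]: "dh 0 = 0" using dh_diff[of 0 0] by simp
lemma dv_zero [simp]: "dv 0 = 0" using dv_diff[of 0 0] by simp
lemma dh_minus: "dh (- x) = - dh x" using dh_diff[of 0 x] by simp
lemma dv_minus: "dv (- x) = - dv x" using dv_diff[of 0 x] by simp
lemma dh_add: "dh (x + y) = dh x + dh y" using dh_diff[of x "- y"] by (simp add: dh_minus)
lemma dv_add: "dv (x + y) = dv x + dv y" using dv_diff[of x "- y"] by (simp add: dv_minus)
lemma minus_in: "x \<in> C a q \<Longrightarrow> - x \<in> C a q" using diff_in[OF zero_in, of x] by simp
lemma add_in: "x \<in> C a q \<Longrightarrow> y \<in> C a q \<Longrightarrow> x + y \<in> C a q" using diff_in[OF _ minus_in, of x a q y] by simp

definition row_exact :: "nat \<Rightarrow> bool" where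
  "row_exact a \<longleftrightarrow> (\<forall>q. \<forall>z\<in>C a q. dh z = 0 \<longrightarrow> (\<exists>y\<in>C (Suc a) q. dh y = z))"

text \<open>\<open>dh\<close> maps column \<open>Suc a\<close> to column \<open>a\<close>; these say that it is surjective, respectively
  injective, on vertical homology in degree \<open>q\<close>.\<close>

definition hsurj :: "nat \<Rightarrow> nat \<Rightarrow> bool" where
  "hsurj a q \<longleftrightarrow> (\<forall>z\<in>C a q. dv z = 0 \<longrightarrow> (\<exists>c\<in>C (Suc a) q. dv c = 0 \<and> (\<exists>b\<in>C a (Suc q). z = dh c + dv b)))"

definition hinj :: "nat \<Rightarrow> nat \<Rightarrow> bool" where
  "hinj a q \<longleftrightarrow> (\<forall>c\<in>C (Suc a) q. \<forall>b\<in>C a (Suc q). dv c = 0 \<longrightarrow> dh c = dv b \<longrightarrow> (\<exists>u\<in>C (Suc a) (Suc q). c = dv u))"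

text \<open>The component in column \<open>a\<close> of the total differential. The squares commute,
  so the sign depending on the column is what makes the total differential square to zero.\<close>

definition tot :: "(nat \<Rightarrow> 'c) \<Rightarrow> nat \<Rightarrow> 'c"
  where "tot y a = dh (y (Suc a)) + alt a (dv (y a))"

text \<open>The staircase: \<open>y (Suc a)\<close> is a horizontal preimage of what
  \<open>z a\<close> still lacks after the vertical contribution of \<open>y a\<close>. That defect
  is a horizontal cycle because \<open>tot z\<close> vanishes one column to the left; in column 0 it
  is one trivially.\<close>

lemma total_exact:
  assumes rows: "\<And>a. a \<le> m \<Longrightarrow> row_exact a"
    and z: "\<And>a. a \<le> m \<Longrightarrow> z a \<in> C a (m - a)"
    and cyc: "\<And>a. a < m \<Longrightarrow> tot z a = 0"
  shows "\<exists>y. (\<forall>a\<le>Suc m. y a \<in> C a (Suc m - a)) \<and> (\<forall>a\<le>m. tot y a = z a)"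
proof -
  define P where "P a x \<longleftrightarrow> (a \<le> Suc m \<longrightarrow> x \<in> C a (Suc m - a)) \<and> (a \<le> m \<longrightarrow> dh (z a - alt a (dv x)) = 0)" for a x
  define Q where "Q a x y \<longleftrightarrow> (a \<le> m \<longrightarrow> z a = dh y + alt a (dv x))" for a x y
  have "\<exists>y. \<forall>a. P a (y a) \<and> Q a (y a) (y (Suc a))"
  proof (rule dependent_nat_choice)
    have "dh (z 0) = 0" using z[of 0] dh_0 by simp
    then show "\<exists>x. P 0 x" by (intro exI[of _ 0]) (simp add: P_def zero_in alt_def)
  next
    fix x a assume P: "P a x"
    show "\<exists>y. P (Suc a) y \<and> Q a x y"
    proof (cases "a \<le> m")
      case False
      then show ?thesis by (intro exI[of _ 0]) (auto simp: P_def Q_def)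
    next
      case True
      let ?w = "z a - alt a (dv x)"
      have x: "x \<in> C a (Suc (m - a))" and w0: "dh ?w = 0" using P True by (auto simp: P_def Suc_diff_le)
      have "?w \<in> C a (m - a)"
        using z[OF True] dv_in[OF x] by (auto simp: alt_def intro: diff_in add_in)
      then obtain y where y: "y \<in> C (Suc a) (m - a)" "dh y = ?w"
        using rows[OF True] w0 by (auto simp: row_exact_def)
      have "dh (z (Suc a) - alt (Suc a) (dv y)) = 0" if "Suc a \<le> m"
      proof -
        have "dh (dv y) = dv (z a) - alt a (dv (dv x))"
          using dh_dv[OF y(1)] y(2) by (simp add: dv_diff dv_minus alt_def)
        then have "dh (dv y) = dv (z a)" using dv_dv[OF x] by (simp add: alt_def)
        then show ?thesis using cyc[of a] that by (auto simp: alt_def tot_def dh_diff dh_add dh_minus add_eq_0_iff2 split: if_splits)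
      qed
      then show ?thesis using y by (intro exI[of _ y]) (auto simp: P_def Q_def)
    qed
  qed
  then obtain y where "\<And>a. P a (y a) \<and> Q a (y a) (y (Suc a))" by blast
  then show ?thesis by (intro exI[of _ y]) (auto simp: P_def Q_def tot_def)
qed

definition tchain :: "nat \<Rightarrow> (nat \<Rightarrow> 'c) \<Rightarrow> bool" where
  "tchain M y \<longleftrightarrow> (\<forall>a\<le>M. y a \<in> C a (M - a)) \<and> (\<forall>a>M. y a = 0)"

text \<open>The columns \<open>2 * J\<close> and \<open>2 * J + 1\<close> are emptied together, from
  the right. The entry \<open>c\<close> of the odd column is a vertical cycle that dies in the even
  one, so injectivity gives \<open>c = dv u\<close>. Then \<open>p + dh u\<close> is a vertical
  cycle of the even column, and surjectivity writes it as \<open>dh c' + dv b\<close>. What is left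
  of the pair is a correction by \<open>dh b\<close> in the column before it.\<close>

lemma reduce_to_two_columns:
  assumes surj: "\<And>j. 1 \<le> j \<Longrightarrow> 2 * j \<le> M \<Longrightarrow> hsurj (2 * j) (M - 2 * j)"
    and inj: "\<And>j. 1 \<le> j \<Longrightarrow> 2 * j < M \<Longrightarrow> hinj (2 * j) (M - 2 * j - 1)"
    and y: "tchain M y" "\<And>a. 2 \<le> a \<Longrightarrow> tot y a = 0" "\<And>a. 2 * J + 2 \<le> a \<Longrightarrow> y a = 0"
  shows "\<exists>y'. tchain M y' \<and> (\<forall>a\<ge>2. y' a = 0) \<and> tot y' 0 = tot y 0 \<and> tot y' 1 = tot y 1"
  using y
proof (induction J arbitrary: y)
  case 0
  then show ?case by (intro exI[of _ y]) auto
next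
  case (Suc k)
  define J where "J = Suc k"
  show ?case
  proof (cases "2 * J \<le> M")
    case False
    then have "\<forall>a\<ge>2 * k + 2. y a = 0" using Suc.prems(1) by (auto simp: tchain_def J_def)
    then show ?thesis using Suc.IH[OF Suc.prems(1,2)] by simp
  next
    case True
    define q where "q = M - 2 * J"
    define p c where "p = y (2 * J)" and "c = y (Suc (2 * J))"
    have p: "p \<in> C (2 * J) q" using Suc.prems(1) True by (simp add: p_def q_def tchain_def)
    have pc: "dh c + dv p = 0"
      using Suc.prems(2)[of "2 * J"] by (simp add: tot_def alt_def J_def p_def c_def)
    \<comment> \<open>For \<open>2 * J = M\<close> the odd column lies beyond the total degree, and
      \<open>c\<close> is zero.\<close>
    have "\<exists>u\<in>C (Suc (2 * J)) q. c = dv u"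
    proof (cases "2 * J < M")
      case True
      then obtain r where r: "q = Suc r" unfolding q_def by (metis Suc_diff_Suc)
      have c: "c \<in> C (Suc (2 * J)) r"
        using Suc.prems(1) True r unfolding c_def tchain_def q_def by (metis Suc_leI diff_Suc_1 diff_Suc_eq_diff_pred diff_commute)
      have "dv c = 0"
        using Suc.prems(2)[of "Suc (2 * J)"] Suc.prems(3)[of "Suc (Suc (2 * J))"]
        by (simp add: tot_def alt_def J_def c_def)
      moreover have "dh c = dv (- p)" using pc by (simp add: dv_minus add_eq_0_iff2)
      moreover have "hinj (2 * J) r"
      proof -
        have "1 \<le> J" "M - 2 * J - 1 = r" using r by (simp_all add: J_def q_def)
        then show ?thesis using inj[OF _ True] by simp
      qed
      ultimately show ?thesis using c minus_in[OF p] r unfolding hinj_def by metis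
    next
      case False
      then have "c = 0" using Suc.prems(1) by (simp add: c_def tchain_def)
      then show ?thesis using zero_in by (intro bexI[of _ 0]) auto
    qed
    then obtain u where u: "u \<in> C (Suc (2 * J)) q" "c = dv u" by blast
    have pu: "p + dh u \<in> C (2 * J) q" using p dh_in[OF u(1)] add_in by blast
    have "dv (p + dh u) = 0" using pc u dh_dv[OF u(1)] by (simp add: dv_add add.commute)
    moreover have "hsurj (2 * J) q" using surj[of J] True by (simp add: J_def q_def)
    ultimately obtain c' b where cb: "c' \<in> C (Suc (2 * J)) q" "dv c' = 0" "b \<in> C (2 * J) (Suc q)"
        "p + dh u = dh c' + dv b"
      using pu unfolding hsurj_def by blast
    obtain i where i: "2 * J = Suc i" by (cases "2 * J") (auto simp: J_def)
    have i': "i = Suc (2 * k)" using i by (simp add: J_def)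
    \<comment> \<open>Column \<open>i\<close> is the one before the pair. Since
      \<open>dh p = dv (dh b)\<close> and \<open>i\<close> is odd, subtracting \<open>dh b\<close>
      there makes up for the loss of \<open>p\<close>, and columns further to the left do not
      notice.\<close>
    define y' where "y' a = (if a = i then y i - dh b else if i < a then 0 else y a)" for a
    have dhb: "dh b \<in> C i (M - i)"
    proof -
      have "Suc q = M - i" using True i by (simp add: q_def)
      then show ?thesis using dh_in[of b i "Suc q"] cb(3) i by simp
    qed
    have y'c: "tchain M y'"
      using Suc.prems(1) dhb True i unfolding tchain_def y'_def by (auto intro: diff_in zero_in)
    have dhp: "dh p = dv (dh b)"
    proof -
      have "dh p + dh (dh u) = dh (dh c') + dh (dv b)" using arg_cong[OF cb(4), of dh] by (simp add: dh_add)
      then show ?thesis using dh_dh[OF u(1)] dh_dh[OF cb(1)] dh_dv[OF cb(3)] by simp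
    qed
    have tot_i: "tot y' i = tot y i"
      using dhp i i' by (simp add: tot_def y'_def alt_def dv_diff p_def)
    have tot_lt: "tot y' a = tot y a" if "a < i" for a
    proof (cases "Suc a = i")
      case True
      have "dh (y i - dh b) = dh (y i)" using dh_dh[OF cb(3)] by (simp add: dh_diff)
      then show ?thesis using that True by (simp add: tot_def y'_def)
    next
      case False
      then show ?thesis using that by (simp add: tot_def y'_def)
    qed
    have tot_gt: "tot y' a = 0" if "i < a" for a using that by (simp add: tot_def y'_def alt_def)
    have "tot y' a = 0" if "2 \<le> a" for a
      using tot_i tot_lt tot_gt Suc.prems(2)[OF that] by (metis linorder_neqE_nat)
    moreover have "y' a = 0" if "2 * k + 2 \<le> a" for a using that i' by (simp add: y'_def)
    ultimately obtain y'' where "tchain M y''" "\<forall>a\<ge>2. y'' a = 0" "tot y'' 0 = tot y' 0" "tot y'' 1 = tot y' 1"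
      using Suc.IH[OF y'c] by blast
    moreover have "tot y' 0 = tot y 0" using tot_lt[of 0] i' by simp
    moreover have "tot y' 1 = tot y 1" using tot_lt[of 1] tot_i i' by (cases k) auto
    ultimately show ?thesis by metis
  qed
qed

text \<open>A vertical cycle of column 0 is a total cycle, and so is a pair \<open>(- b, c)\<close>
  with \<open>dh c = dv b\<close>. Row exactness makes it a total boundary, and the bounding chain
  can be pushed into columns 0 and 1. Its two entries then are the required lift, respectively the
  required filling.\<close>

theorem first_column_comparison:
  assumes rows: "\<And>a. a \<le> i \<Longrightarrow> row_exact a"
    and surj: "\<And>j. 1 \<le> j \<Longrightarrow> 2 * j \<le> Suc i \<Longrightarrow> hsurj (2 * j) (Suc i - 2 * j)"
    and inj: "\<And>j. 1 \<le> j \<Longrightarrow> 2 * j \<le> i \<Longrightarrow> hinj (2 * j) (i - 2 * j)"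
  shows "hsurj 0 i" "0 < i \<Longrightarrow> hinj 0 (i - 1)"
proof -
  have main: "\<exists>y. y 0 \<in> C 0 (Suc i) \<and> y 1 \<in> C 1 i \<and> tot y 0 = z 0 \<and> (1 \<le> i \<longrightarrow> tot y 1 = z 1) \<and> y 2 = 0"
    if z: "\<And>a. a \<le> i \<Longrightarrow> z a \<in> C a (i - a)" "\<And>a. a < i \<Longrightarrow> tot z a = 0" "\<And>a. 2 \<le> a \<Longrightarrow> z a = 0" for z
  proof -
    obtain x where x: "\<And>a. a \<le> Suc i \<Longrightarrow> x a \<in> C a (Suc i - a)" "\<And>a. a \<le> i \<Longrightarrow> tot x a = z a"
      using total_exact[OF rows z(1,2)] by blast
    \<comment> \<open>\<open>total_exact\<close> says nothing about columns beyond
      \<open>Suc i\<close>; they are set to zero.\<close>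
    define y where "y a = (if a \<le> Suc i then x a else 0)" for a
    have yc: "tchain (Suc i) y" using x by (simp add: tchain_def y_def)
    have ty: "tot y a = z a" if "a \<le> i" for a using x(2)[OF that] that by (simp add: tot_def y_def)
    have "tot y a = 0" if "2 \<le> a" for a
    proof (cases "a \<le> i")
      case True
      then show ?thesis using ty z(3) that by simp
    next
      case False
      then have "dv (y a) = 0" using x(1)[of "Suc i"] dv_0 by (cases "a = Suc i") (auto simp: y_def)
      then show ?thesis using False by (simp add: tot_def y_def alt_def)
    qed
    moreover have "y a = 0" if "2 * Suc i + 2 \<le> a" for a using that by (simp add: y_def)
    ultimately obtain y' where "tchain (Suc i) y'" "\<forall>a\<ge>2. y' a = 0" "tot y' 0 = tot y 0" "tot y' 1 = tot y 1"
      using reduce_to_two_columns[of "Suc i" y "Suc i"] surj inj yc by auto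
    then show ?thesis using ty by (intro exI[of _ y']) (auto simp: tchain_def)
  qed
  show "hsurj 0 i"
    unfolding hsurj_def
  proof (intro ballI impI)
    fix z0 assume z0: "z0 \<in> C 0 i" "dv z0 = 0"
    define z where "z a = (if a = 0 then z0 else 0)" for a :: nat
    have "\<exists>y. y 0 \<in> C 0 (Suc i) \<and> y 1 \<in> C 1 i \<and> tot y 0 = z 0 \<and> (1 \<le> i \<longrightarrow> tot y 1 = z 1) \<and> y 2 = 0"
      by (rule main) (use z0 zero_in in \<open>auto simp: z_def tot_def alt_def\<close>)
    then obtain y where y: "y 0 \<in> C 0 (Suc i)" "y 1 \<in> C 1 i" "tot y 0 = z 0" "1 \<le> i \<longrightarrow> tot y 1 = z 1" "y 2 = 0"
      by blast
    have "dv (y 1) = 0"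
    proof (cases i)
      case 0
      then show ?thesis using y(2) dv_0 by simp
    next
      case (Suc j)
      then show ?thesis using y(4,5) by (simp add: tot_def alt_def z_def numeral_2_eq_2)
    qed
    moreover have "z0 = dh (y 1) + dv (y 0)" using y(3) by (simp add: tot_def alt_def z_def)
    ultimately show "\<exists>c\<in>C (Suc 0) i. dv c = 0 \<and> (\<exists>b\<in>C 0 (Suc i). z0 = dh c + dv b)"
      using y(1,2) by auto
  qed
  show "hinj 0 (i - 1)" if i: "0 < i"
    unfolding hinj_def
  proof (intro ballI impI)
    fix c b assume cb: "c \<in> C (Suc 0) (i - 1)" "b \<in> C 0 (Suc (i - 1))" "dv c = 0" "dh c = dv b"
    \<comment> \<open>The sign turns \<open>dh c = dv b\<close> into vanishing of
      \<open>tot z\<close> in column 0.\<close>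
    define z where "z a = (if a = 0 then - b else if a = 1 then c else 0)" for a :: nat
    have "\<exists>y. y 0 \<in> C 0 (Suc i) \<and> y 1 \<in> C 1 i \<and> tot y 0 = z 0 \<and> (1 \<le> i \<longrightarrow> tot y 1 = z 1) \<and> y 2 = 0"
      by (rule main) (use cb i zero_in minus_in[OF cb(2)] in \<open>auto simp: z_def tot_def alt_def dv_minus\<close>)
    then obtain y where y: "y 1 \<in> C 1 i" "tot y 1 = c" "y 2 = 0" using i by (auto simp: z_def)
    then have "c = dv (- y 1)" by (simp add: tot_def alt_def numeral_2_eq_2 dv_minus)
    then show "\<exists>u\<in>C (Suc 0) (Suc (i - 1)). c = dv u" using y(1) i minus_in by auto
  qed
qed

end

section \<open>Quillen's argument\<close>

lemma wbd_map: "wbd (map f w) = fmap (map f) (wbd w)"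
  by (induction w) (auto simp: fmap_diff fmap_fmap)

lemma wbd_sum: "wbd w = (\<Sum>i<length w. frag_cmul ((-1) ^ i) (frag_of (take i w @ drop (Suc i) w)))"
proof (induction w)
  case (Cons v w)
  have "(\<Sum>i<length (v # w). frag_cmul ((-1) ^ i) (frag_of (take i (v # w) @ drop (Suc i) (v # w))))
     = frag_of w + (\<Sum>i<length w. frag_cmul ((-1) ^ Suc i) (frag_of (v # take i w @ drop (Suc i) w)))"
    by (simp only: length_Cons sum.lessThan_Suc_shift) simp
  also have "(\<Sum>i<length w. frag_cmul ((-1) ^ Suc i) (frag_of (v # take i w @ drop (Suc i) w))) = - fmap (Cons v) (wbd w)"
    unfolding Cons.IH by (simp add: fmap_sum fmap_cmul flip: sum_negf)
  finally show ?case by simp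
qed simp

definition hbd :: "('a list \<times> 'v list \<Rightarrow>\<^sub>0 int) \<Rightarrow> 'a list \<times> 'v list \<Rightarrow>\<^sub>0 int"
  where "hbd = frag_extend (\<lambda>w. fmap (Pair (fst w)) (wbd (snd w)))"

lemma hbd_diff: "hbd (a - b) = hbd a - hbd b"
  by (simp add: hbd_def frag_extend_diff)

lemma hbd_of: "hbd (frag_of (gs, w)) = fmap (Pair gs) (wbd w)"
  by (simp add: hbd_def)

lemma hbd_Pair: "hbd (fmap (Pair gs) c) = fmap (Pair gs) (wbdry c)"
  by (simp add: hbd_def frag_extend_fmap fmap_frag_extend)

lemma hbd_cons_head: "hbd (fmap (cons_head g) c) = fmap (cons_head g) (hbd c)"
  by (simp add: hbd_def frag_extend_fmap fmap_frag_extend fmap_fmap cons_head_def)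

lemma hbd_hbd: "hbd (hbd c) = 0"
proof -
  have "hbd (hbd c) = frag_extend (\<lambda>w. hbd (fmap (Pair (fst w)) (wbd (snd w)))) c"
    by (simp add: hbd_def frag_extend_frag_extend)
  also have "\<dots> = 0" by (rule frag_extend_eq_0) (simp add: hbd_Pair wbdry_wbd)
  finally show ?thesis .
qed

lemma hbd_bar_d:
  assumes act: "\<And>g w. wbd (act g w) = fmap (act g) (wbd w)"
  shows "hbd (bar_d G act c) = bar_d G act (hbd c)"
proof -
  have mh: "hbd (frag_of (mult_head G act g (gs, w))) = fmap (\<lambda>u. mult_head G act g (gs, u)) (wbd w)" for g gs w
    by (cases gs) (auto simp: hbd_of act fmap_fmap)
  have rest: "hbd (bar_rest G act gs w) = frag_extend (bar_rest G act gs) (wbd w)" for gs w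
  proof (induction gs)
    case Nil
    then show ?case by (simp add: hbd_def frag_extend_eq_0)
  next
    case (Cons g gs)
    have "hbd (bar_rest G act (g # gs) w) = fmap (\<lambda>u. mult_head G act g (gs, u)) (wbd w) -
        fmap (cons_head g) (frag_extend (bar_rest G act gs) (wbd w))"
      by (simp add: hbd_diff mh hbd_cons_head Cons.IH)
    also have "\<dots> = frag_extend (\<lambda>u. bar_rest G act (g # gs) u) (wbd w)"
      by (simp add: frag_extend_minus_fun fmap_frag_extend flip: fmap_def)
    finally show ?case .
  qed
  have bd: "hbd (bar_bd G act gs w) = frag_extend (bar_bd G act gs) (wbd w)" for gs w
  proof (cases gs)
    case Nil
    then show ?thesis by (simp add: hbd_def frag_extend_eq_0)
  next
    case (Cons g hs)
    have "hbd (bar_bd G act (g # hs) w) = fmap (Pair hs) (wbd w) - frag_extend (bar_rest G act (g # hs)) (wbd w)"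
      using rest[of "g # hs" w] by (simp add: hbd_diff hbd_of del: bar_rest.simps)
    also have "\<dots> = frag_extend (\<lambda>u. bar_bd G act (g # hs) u) (wbd w)"
      by (simp add: frag_extend_minus_fun fmap_def del: bar_rest.simps)
    finally show ?thesis unfolding Cons .
  qed
  have "hbd (bar_d G act c) = frag_extend (\<lambda>w. hbd (bar_bd G act (fst w) (snd w))) c"
    by (simp add: hbd_def bar_d_def frag_extend_frag_extend)
  also have "\<dots> = bar_d G act (hbd c)"
    unfolding bd by (simp add: hbd_def bar_d_def frag_extend_frag_extend frag_extend_fmap)
  finally show ?thesis .
qed

lemma frag_extend_sum_fun:
  "finite I \<Longrightarrow> frag_extend (\<lambda>x. \<Sum>i\<in>I. f i x) c = (\<Sum>i\<in>I. frag_extend (f i) c)"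
  by (induction I rule: finite_induct) (auto simp: frag_extend_plus frag_extend_eq_0)

lemma bar_d_cmul: "bar_d G act (frag_cmul k c) = frag_cmul k (bar_d G act c)"
  by (simp add: bar_d_def frag_extend_cmul)

lemma bar_d_sum: "finite I \<Longrightarrow> bar_d G act (sum f I) = (\<Sum>i\<in>I. bar_d G act (f i))"
  by (simp add: bar_d_def frag_extend_of_sum)

definition slice :: "'a \<Rightarrow> ('a \<times> 'w \<Rightarrow>\<^sub>0 int) \<Rightarrow> 'w \<Rightarrow>\<^sub>0 int"
  where "slice g = frag_extend (\<lambda>w. if fst w = g then frag_of (snd w) else 0)"

lemma slice_decomposition:
  assumes "finite A" "fst ` supp c \<subseteq> A"
  shows "c = (\<Sum>g\<in>A. fmap (Pair g) (slice g c))"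
proof -
  have "(\<Sum>g\<in>A. fmap (Pair g) (slice g c)) = frag_extend (\<lambda>w. \<Sum>g\<in>A. if fst w = g then frag_of w else 0) c"
    unfolding slice_def fmap_frag_extend frag_extend_sum_fun[OF assms(1)]
    by (intro sum.cong refl frag_extend_eq) (auto simp: prod_eq_iff)
  also have "\<dots> = frag_extend frag_of c"
    by (rule frag_extend_eq) (use assms in \<open>auto simp: sum.delta\<close>)
  finally show ?thesis by (simp flip: frag_expansion)
qed

lemma slice_Pair: "slice g (fmap (Pair h) d) = (if h = g then d else 0)"
  by (auto simp: slice_def frag_extend_fmap frag_extend_eq_0 simp flip: frag_expansion)

lemma slice_hbd: "slice g (hbd c) = wbdry (slice g c)"
proof -
  have "slice g (hbd c) = frag_extend (\<lambda>w. slice g (fmap (Pair (fst w)) (wbd (snd w)))) c"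
    unfolding hbd_def slice_def frag_extend_frag_extend ..
  also have "\<dots> = frag_extend (\<lambda>w. if fst w = g then wbd (snd w) else 0) c"
    by (simp only: slice_Pair)
  also have "\<dots> = wbdry (slice g c)"
    unfolding slice_def frag_extend_frag_extend by (rule frag_extend_eq) auto
  finally show ?thesis .
qed

section \<open>The double complex of frames\<close>

definition fcol :: "nat \<Rightarrow> nat \<Rightarrow> nat \<Rightarrow> ((word \<Rightarrow> word) list \<times> (word \<times> word set) list \<Rightarrow>\<^sub>0 int) set"
  where "fcol n a q = {c. supp c \<subseteq> bar_simplices (Aut n) (frame_layer n a) q}"

lemma wbd_wact: "wbd (wact g w) = fmap (wact g) (wbd w)"
  by (simp add: wact_def wbd_map)

lemma delclosed_frame_words: "delclosed (frame_words n)"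
  unfolding frame_words_def by (intro delclosed_UN delclosed_inj_words)

lemma hbd_supp:
  assumes "supp c \<subseteq> bar_simplices (Aut n) (frame_layer n (Suc a)) q"
  shows "supp (hbd c) \<subseteq> bar_simplices (Aut n) (frame_layer n a) q"
  unfolding hbd_def
proof (intro supp_frag_extend supp_fmapI)
  fix w u assume w: "w \<in> supp c" and u: "u \<in> supp (wbd (snd w))"
  have w': "w \<in> bar_simplices (Aut n) (frame_layer n (Suc a)) q" using w assms by blast
  then have "snd w \<in> frame_words n" "length (snd w) = Suc a" by (auto simp: bar_simplices_def frame_layer_def)
  then have "u \<in> frame_layer n a"
    using u supp_wbd[OF delclosed_frame_words, of "snd w" n] by (auto simp: frame_layer_def)
  then show "(fst w, u) \<in> bar_simplices (Aut n) (frame_layer n a) q" using w' by (auto simp: bar_simplices_def)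
qed

lemma frame_double_complex: "double_complex (fcol n) hbd (bar_d (Aut n) wact)"
proof
  fix a q x y
  interpret group_action "Aut n" wact "frame_layer n a" by (rule frame_action)
  show "0 \<in> fcol n a q" by (simp add: fcol_def)
  show "x - y \<in> fcol n a q" if "x \<in> fcol n a q" "y \<in> fcol n a q" using that by (simp add: fcol_def supp_diff)
  show "hbd x \<in> fcol n a q" if "x \<in> fcol n (Suc a) q" using that hbd_supp by (simp add: fcol_def)
  show "bar_d (Aut n) wact x \<in> fcol n a q" if "x \<in> fcol n a (Suc q)" using that D_supp by (simp add: fcol_def)
  show "bar_d (Aut n) wact x = 0" if "x \<in> fcol n a 0" using that D_S0 by (simp add: fcol_def)
  show "bar_d (Aut n) wact (bar_d (Aut n) wact x) = 0" if "x \<in> fcol n a q" using that D_D by (simp add: fcol_def)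
  show "hbd (bar_d (Aut n) wact x) = bar_d (Aut n) wact (hbd x)" by (rule hbd_bar_d[OF wbd_wact])
  show "hbd x = 0" if "x \<in> fcol n 0 q"
    unfolding hbd_def
  proof (rule frag_extend_eq_0)
    fix w assume "w \<in> supp x"
    then have "w \<in> bar_simplices (Aut n) (frame_layer n 0) q" using that by (auto simp: fcol_def)
    then have "snd w = []" by (auto simp: bar_simplices_def frame_layer_def)
    then show "fmap (Pair (fst w)) (wbd (snd w)) = 0" by simp
  qed
qed (simp_all add: hbd_diff bar_d_diff hbd_hbd)

text \<open>The horizontal differential leaves the tuple of group elements alone, so a row is a
  direct sum of copies of the word complex, one for each tuple. A cycle is filled slice by
  slice.\<close>

lemma frame_row_exact:
  assumes "2 * a + 1 \<le> n"
  shows "double_complex.row_exact (fcol n) hbd a"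
proof -
  interpret double_complex "fcol n" hbd "bar_d (Aut n) wact" by (rule frame_double_complex)
  show ?thesis unfolding row_exact_def
  proof (intro allI ballI impI)
    fix q z assume z: "z \<in> fcol n a q" "hbd z = 0"
    let ?A = "fst ` supp z"
    have zs: "supp z \<subseteq> bar_simplices (Aut n) (frame_layer n a) q" using z by (simp add: fcol_def)
    have "\<exists>b. wchain (frame_words n) (Suc a) b \<and> wbdry b = slice g z" for g
    proof -
      have "wbdry (slice g z) = 0" using slice_hbd[of g z] z(2) by (simp add: slice_def)
      moreover have "wchain (frame_words n) a (slice g z)"
        unfolding wchain_def slice_def
      proof (rule supp_frag_extend)
        fix w assume "w \<in> supp z"
        then have "w \<in> bar_simplices (Aut n) (frame_layer n a) q" using zs by blast
        then have "snd w \<in> {w \<in> frame_words n. length w = a}" by (auto simp: bar_simplices_def frame_layer_def)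
        then show "supp (if fst w = g then frag_of (snd w) else 0) \<subseteq> {w \<in> frame_words n. length w = a}"
          by (simp add: keys_frag_of)
      qed
      ultimately show ?thesis using frame_words_acyc[OF assms] by (metis acyc_def)
    qed
    then obtain b where b: "\<And>g. wchain (frame_words n) (Suc a) (b g)" "\<And>g. wbdry (b g) = slice g z" by metis
    define y where "y = (\<Sum>g\<in>?A. fmap (Pair g) (b g))"
    have "hbd y = (\<Sum>g\<in>?A. hbd (fmap (Pair g) (b g)))" unfolding y_def hbd_def by (rule frag_extend_of_sum) simp
    also have "\<dots> = (\<Sum>g\<in>?A. fmap (Pair g) (slice g z))" by (simp add: hbd_Pair b)
    also have "\<dots> = z" by (rule slice_decomposition[symmetric]) auto
    finally have "hbd y = z" .
    moreover have "y \<in> fcol n (Suc a) q"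
      unfolding y_def fcol_def mem_Collect_eq
    proof (intro supp_sum supp_fmapI)
      fix g w assume g: "g \<in> ?A" and w: "w \<in> supp (b g)"
      have "length g = q" "set g \<subseteq> carrier (Aut n)" using g zs by (auto simp: bar_simplices_def)
      moreover have "w \<in> frame_layer n (Suc a)" using b(1)[of g] w by (auto simp: wchain_def frame_layer_def)
      ultimately show "(g, w) \<in> bar_simplices (Aut n) (frame_layer n (Suc a)) q" by (simp add: in_bar_simplices)
    qed
    ultimately show "\<exists>y\<in>fcol n (Suc a) q. hbd y = z" by blast
  qed
qed

abbreviation Bd :: "nat \<Rightarrow> ((word \<Rightarrow> word) list \<times> (word \<times> word set) list \<Rightarrow>\<^sub>0 int) \<Rightarrow> (word \<Rightarrow> word) list \<times> (word \<times> word set) list \<Rightarrow>\<^sub>0 int"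
  where "Bd n \<equiv> bar_d (Aut n) wact"

text \<open>The empty word serves as the one-point set. So the bar complex of the group itself is
  column 0, the augmentation column of the double complex.\<close>

abbreviation BS :: "nat \<Rightarrow> nat \<Rightarrow> ((word \<Rightarrow> word) list \<times> (word \<times> word set) list) set"
  where "BS n \<equiv> bar_simplices (Aut n) {[]}"

abbreviation stabc :: "nat \<Rightarrow> ((word \<Rightarrow> word) list \<times> (word \<times> word set) list \<Rightarrow>\<^sub>0 int) \<Rightarrow> (word \<Rightarrow> word) list \<times> (word \<times> word set) list \<Rightarrow>\<^sub>0 int"
  where "stabc m \<equiv> at_point (stab m) []"

definition stab_surj :: "nat \<Rightarrow> nat \<Rightarrow> bool" where
  "stab_surj m q \<longleftrightarrow> (\<forall>z. supp z \<subseteq> BS (Suc m) q \<longrightarrow> Bd (Suc m) z = 0 \<longrightarrow>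
     (\<exists>c b. supp c \<subseteq> BS m q \<and> Bd m c = 0 \<and> supp b \<subseteq> BS (Suc m) (Suc q) \<and> z = stabc m c + Bd (Suc m) b))"

definition stab_inj :: "nat \<Rightarrow> nat \<Rightarrow> bool" where
  "stab_inj m q \<longleftrightarrow> (\<forall>c b. supp c \<subseteq> BS m q \<longrightarrow> Bd m c = 0 \<longrightarrow> supp b \<subseteq> BS (Suc m) (Suc q) \<longrightarrow>
     stabc m c = Bd (Suc m) b \<longrightarrow> (\<exists>u. supp u \<subseteq> BS m (Suc q) \<and> c = Bd m u))"

lemma std_word_point_stabilizer:
  assumes "a \<le> n"
  shows "point_stabilizer (Aut n) wact (frame_layer n a) (Aut (n - a)) (ext (n - a) n) (std_word n a) wact []"
proof -
  interpret group_action "Aut n" wact "frame_layer n a" by (rule frame_action)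
  interpret K: group "Aut (n - a)" by (rule group_Aut)
  have "ext (n - a) n ` carrier (Aut (n - a)) = {g \<in> carrier (Aut n). wact g (std_word n a) = std_word n a}"
    using ext_Aut[of _ "n - a" n] ext_fixes_std_word[of _ "n - a" n a] std_word_stabilizer[OF _ assms] by auto
  then show ?thesis
    by unfold_locales (auto simp: ext_mult ext_inj std_word_in[OF assms] frame_layer_transitive)
qed

lemma alternating_sum: "(\<Sum>i<Suc a. frag_cmul ((-1) ^ i) y) = (if even a then y else 0)"
  by (induction a) auto

lemma hbd_at_point: "hbd (at_point s x c) = (\<Sum>i<length x. frag_cmul ((-1) ^ i) (at_point s (take i x @ drop (Suc i) x) c))"
proof -
  have "hbd (at_point s x c) = frag_extend (\<lambda>w. fmap (Pair (map s (fst w))) (wbd x)) c"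
    by (simp add: hbd_def at_point_def frag_extend_fmap)
  also have "\<dots> = frag_extend (\<lambda>w. \<Sum>i<length x. frag_cmul ((-1) ^ i) (frag_of (map s (fst w), take i x @ drop (Suc i) x))) c"
    unfolding wbd_sum by (simp add: fmap_sum fmap_cmul)
  also have "\<dots> = (\<Sum>i<length x. frag_cmul ((-1) ^ i) (at_point s (take i x @ drop (Suc i) x) c))"
    by (simp add: frag_extend_sum_fun frag_extend_cmul_fun at_point_def fmap_def)
  finally show ?thesis .
qed

text \<open>The \<open>a + 1\<close> faces contribute the same class with alternating signs. For
  even \<open>a\<close> one copy remains, so on vertical homology the horizontal map from column
  \<open>a + 1\<close> to column \<open>a\<close> is the stabilisation from rank
  \<open>n - a - 1\<close> to rank \<open>n - a\<close>.\<close>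

lemma hbd_std_word:
  assumes a: "Suc a \<le> n" "even a" and c: "supp c \<subseteq> BS (n - Suc a) q" "Bd (n - Suc a) c = 0"
  shows "\<exists>b\<in>fcol n a (Suc q). hbd (at_point (ext (n - Suc a) n) (std_word n (Suc a)) c) =
    at_point (ext (n - a) n) (std_word n a) (stabc (n - Suc a) c) + Bd n b"
proof -
  interpret group_action "Aut n" wact "frame_layer n a" by (rule frame_action)
  define m where "m = n - Suc a"
  have mn: "m \<le> n" "n - a = Suc m" "Suc m \<le> n" using a by (auto simp: m_def)
  let ?s = "ext m n" and ?x = "std_word n a" and ?X = "std_word n (Suc a)"
  have "\<exists>b. supp b \<subseteq> S (Suc q) \<and> at_point ?s (take i ?X @ drop (Suc i) ?X) c = at_point ?s ?x c + D b" if ia: "i \<le> a" for i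
  proof -
    obtain h where h: "h \<in> carrier (Aut n)" "\<And>\<phi>. \<phi> \<in> carrier (Aut m) \<Longrightarrow> h \<otimes>\<^bsub>Aut n\<^esub> ?s \<phi> = ?s \<phi> \<otimes>\<^bsub>Aut n\<^esub> h"
      "wact h ?x = take i ?X @ drop (Suc i) ?X"
      using std_word_face[OF a(1) ia] unfolding m_def[symmetric] by blast
    have "\<exists>b. supp b \<subseteq> S (Suc q) \<and> at_point ?s (wact h ?x) c = at_point ?s ?x c + D b"
    proof (rule conjugate_point[where K = "Aut m" and actK = wact and ?y0.0 = "[]"])
      show "?s k \<in> carrier (Aut n)" "wact (?s k) ?x = ?x" if "k \<in> carrier (Aut m)" for k
        using that ext_Aut[OF _ mn(1)] ext_fixes_std_word[of k m n a] mn by auto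
      show "?s (g \<otimes>\<^bsub>Aut m\<^esub> g') = ?s g \<otimes>\<^bsub>Aut n\<^esub> ?s g'" if "g \<in> carrier (Aut m)" "g' \<in> carrier (Aut m)" for g g'
        using that mn(1) by (rule ext_mult)
    qed (use h c std_word_in a in \<open>auto simp: m_def\<close>)
    then show ?thesis using h(3) by simp
  qed
  then obtain b where b: "\<And>i. i \<le> a \<Longrightarrow> supp (b i) \<subseteq> S (Suc q)"
      "\<And>i. i \<le> a \<Longrightarrow> at_point ?s (take i ?X @ drop (Suc i) ?X) c = at_point ?s ?x c + D (b i)" by metis
  define B where "B = (\<Sum>i<Suc a. frag_cmul ((-1) ^ i) (b i))"
  have "length ?X = Suc a" using a by (simp add: std_word_def)
  then have "hbd (at_point ?s ?X c) = (\<Sum>i<Suc a. frag_cmul ((-1) ^ i) (at_point ?s ?x c + D (b i)))"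
    unfolding hbd_at_point by (auto intro!: sum.cong simp: b)
  also have "\<dots> = (\<Sum>i<Suc a. frag_cmul ((-1) ^ i) (at_point ?s ?x c)) + D B"
    unfolding B_def by (simp add: frag_cmul_distrib2 sum.distrib bar_d_sum bar_d_cmul del: sum.lessThan_Suc)
  also have "(\<Sum>i<Suc a. frag_cmul ((-1) ^ i) (at_point ?s ?x c)) = at_point ?s ?x c"
    unfolding alternating_sum using a(2) by simp
  \<comment> \<open>Extension to rank \<open>n\<close> factors through rank \<open>m + 1\<close>,
    and the first factor is \<open>stab m\<close>.\<close>
  also have "at_point ?s ?x c = at_point (ext (Suc m) n) ?x (stabc m c)"
    unfolding at_point_def fmap_fmap
  proof (rule fmap_cong)
    fix w assume "w \<in> supp c"
    then have "w \<in> BS m q" using c(1) by (auto simp: m_def)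
    then have "set (fst w) \<subseteq> carrier (Aut m)" by (auto simp: bar_simplices_def)
    then show "(map ?s (fst w), ?x) = (map (ext (Suc m) n) (fst (map (stab m) (fst w), [])), ?x)"
      using ext_stab[OF _ mn(3)] by auto
  qed
  finally have "hbd (at_point ?s ?X c) = at_point (ext (Suc m) n) ?x (stabc m c) + D B" .
  moreover have "B \<in> fcol n a (Suc q)"
    unfolding B_def fcol_def mem_Collect_eq
  proof (rule supp_sum)
    fix i assume "i \<in> {..<Suc a}"
    then show "supp (frag_cmul ((-1) ^ i) (b i)) \<subseteq> S (Suc q)" using b(1)[of i] keys_cmul by fastforce
  qed
  ultimately show ?thesis using mn(2) unfolding m_def[symmetric] by auto
qed

lemma frame_layer_0: "frame_layer n 0 = {[]}"
  using id_basis[of n] by (auto simp: frame_layer_def frame_words_def inj_words_def)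

lemma fcol_0: "c \<in> fcol n 0 q \<longleftrightarrow> supp c \<subseteq> BS n q"
  by (simp add: fcol_def frame_layer_0)

lemma at_point_self:
  assumes "supp c \<subseteq> BS n q"
  shows "at_point (ext n n) (std_word n 0) c = c"
  unfolding at_point_def
proof (rule fmap_eq_self)
  fix w assume "w \<in> supp c"
  then have "w \<in> BS n q" using assms by blast
  then have "map (ext n n) (fst w) = fst w" "snd w = []"
    using ext_self by (auto simp: bar_simplices_def intro!: map_idI)
  then show "(map (ext n n) (fst w), std_word n 0) = w" by (simp add: std_word_def prod_eq_iff)
qed

lemma at_point_stab:
  assumes "supp c \<subseteq> BS m q"
  shows "supp (stabc m c) \<subseteq> BS (Suc m) q"
    "Bd (Suc m) (stabc m c) = stabc m (Bd m c)"
proof -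
  show "supp (stabc m c) \<subseteq> BS (Suc m) q"
    unfolding at_point_def
  proof (rule supp_fmapI)
    fix w assume "w \<in> supp c"
    then have "w \<in> BS m q" using assms by blast
    then show "(map (stab m) (fst w), []) \<in> BS (Suc m) q"
      using ext_Aut[of _ m "Suc m"] by (auto simp: bar_simplices_def stab_eq_ext)
  qed
  show "Bd (Suc m) (stabc m c) = stabc m (Bd m c)"
    unfolding at_point_def
    by (rule bar_d_equivariant[where X = "{[]}" and f = "\<lambda>_. []"]) (use assms in \<open>auto simp: stab_eq_ext ext_mult\<close>)
qed

section \<open>Passing between columns and group homology\<close>

context
  fixes n :: nat
begin

interpretation dc: double_complex "fcol n" hbd "Bd n"
  by (rule frame_double_complex)

text \<open>Shapiro's lemma replaces column \<open>a\<close> by the bar complex in rank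
  \<open>n - a\<close> and column \<open>a + 1\<close> by that in rank \<open>n - a - 1\<close>;
  \<open>hbd_std_word\<close> identifies the map between them. Vertical boundaries are collected
  along the way.\<close>

lemma hsurj_of_stab_surj:
  assumes a: "Suc a \<le> n" "even a" and surj: "stab_surj (n - Suc a) q"
  shows "dc.hsurj a q"
  unfolding dc.hsurj_def
proof (intro ballI impI)
  define m where "m = n - Suc a"
  have mn: "n - a = Suc m" "a \<le> n" using a by (auto simp: m_def)
  interpret A: point_stabilizer "Aut n" wact "frame_layer n a" "Aut (Suc m)" "ext (Suc m) n" "std_word n a" wact "[]"
    using std_word_point_stabilizer[OF mn(2)] by (simp add: mn)
  interpret A': point_stabilizer "Aut n" wact "frame_layer n (Suc a)" "Aut m" "ext m n" "std_word n (Suc a)" wact "[]"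
    using std_word_point_stabilizer[OF a(1)] by (simp add: m_def)
  fix z assume z: "z \<in> fcol n a q" "Bd n z = 0"
  then obtain z1 b1 where z1: "supp z1 \<subseteq> BS (Suc m) q" "Bd (Suc m) z1 = 0" "supp b1 \<subseteq> A.S (Suc q)" "z = A.iota z1 + Bd n b1"
    using A.shapiro_surj[of z q] unfolding fcol_def by blast
  obtain z2 b2 where z2: "supp z2 \<subseteq> BS m q" "Bd m z2 = 0" "supp b2 \<subseteq> BS (Suc m) (Suc q)"
      "z1 = stabc m z2 + Bd (Suc m) b2"
    using surj z1(1,2) unfolding stab_surj_def m_def[symmetric] by blast
  obtain b3 where b3: "b3 \<in> fcol n a (Suc q)"
      "hbd (A'.iota z2) = A.iota (stabc m z2) + Bd n b3"
    using hbd_std_word[OF a, of z2 q] z2(1,2) mn unfolding m_def[symmetric] by auto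
  have "z = hbd (A'.iota z2) + Bd n (A.iota b2 + b1 - b3)"
    unfolding z1(4) z2(4) b3(2) at_point_add bar_d_add bar_d_diff A.iota_D[OF z2(3)] by simp
  moreover have "A.iota b2 + b1 - b3 \<in> fcol n a (Suc q)"
    using A.iota_supp[OF z2(3)] z1(3) b3(1) by (simp add: fcol_def supp_add supp_diff)
  moreover have "A'.iota z2 \<in> fcol n (Suc a) q" using A'.iota_supp[OF z2(1)] by (simp add: fcol_def)
  moreover have "Bd n (A'.iota z2) = 0" using A'.iota_D[OF z2(1)] z2(2) by (simp add: at_point_def)
  ultimately show "\<exists>c\<in>fcol n (Suc a) q. Bd n c = 0 \<and> (\<exists>b\<in>fcol n a (Suc q). z = hbd c + Bd n b)" by blast
qed

lemma hinj_of_stab_inj: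
  assumes a: "Suc a \<le> n" "even a" and inj: "stab_inj (n - Suc a) q"
  shows "dc.hinj a q"
  unfolding dc.hinj_def
proof (intro ballI impI)
  define m where "m = n - Suc a"
  have mn: "n - a = Suc m" "a \<le> n" using a by (auto simp: m_def)
  interpret A: point_stabilizer "Aut n" wact "frame_layer n a" "Aut (Suc m)" "ext (Suc m) n" "std_word n a" wact "[]"
    using std_word_point_stabilizer[OF mn(2)] by (simp add: mn)
  interpret A': point_stabilizer "Aut n" wact "frame_layer n (Suc a)" "Aut m" "ext m n" "std_word n (Suc a)" wact "[]"
    using std_word_point_stabilizer[OF a(1)] by (simp add: m_def)
  fix c b assume c: "c \<in> fcol n (Suc a) q" "b \<in> fcol n a (Suc q)" "Bd n c = 0" "hbd c = Bd n b"
  then obtain c1 b1 where c1: "supp c1 \<subseteq> BS m q" "Bd m c1 = 0" "supp b1 \<subseteq> A'.S (Suc q)" "c = A'.iota c1 + Bd n b1"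
    using A'.shapiro_surj[of c q] unfolding fcol_def by blast
  obtain b3 where b3: "b3 \<in> fcol n a (Suc q)"
      "hbd (A'.iota c1) = A.iota (stabc m c1) + Bd n b3"
    using hbd_std_word[OF a, of c1 q] c1(1,2) mn unfolding m_def[symmetric] by auto
  have hb1: "hbd b1 \<in> fcol n a (Suc q)" using hbd_supp[OF c1(3)] by (simp add: fcol_def)
  have "hbd c = A.iota (stabc m c1) + Bd n b3 + Bd n (hbd b1)"
    unfolding c1(4) dc.dh_add b3(2) hbd_bar_d[OF wbd_wact] by simp
  then have "A.iota (stabc m c1) = Bd n (b - b3 - hbd b1)"
    using c(4) by (simp add: bar_d_diff bar_d_add algebra_simps)
  moreover have "supp (b - b3 - hbd b1) \<subseteq> A.S (Suc q)"
    using c(2) b3(1) hb1 by (simp add: fcol_def supp_diff)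
  ultimately obtain u where u: "supp u \<subseteq> BS (Suc m) (Suc q)" "stabc m c1 = Bd (Suc m) u"
    using A.shapiro_inj[OF at_point_stab(1)[OF c1(1)]] by blast
  obtain v where v: "supp v \<subseteq> BS m (Suc q)" "c1 = Bd m v"
    using inj c1(1,2) u unfolding stab_inj_def m_def[symmetric] by blast
  have "c = Bd n (A'.iota v + b1)"
    unfolding c1(4) v(2) by (simp add: bar_d_add A'.iota_D[OF v(1)])
  moreover have "A'.iota v + b1 \<in> fcol n (Suc a) (Suc q)"
    using A'.iota_supp[OF v(1)] c1(3) by (simp add: fcol_def supp_add)
  ultimately show "\<exists>u\<in>fcol n (Suc a) (Suc q). c = Bd n u" by blast
qed

lemma stab_surj_of_hsurj:
  assumes n: "0 < n" and surj: "dc.hsurj 0 q"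
  shows "stab_surj (n - 1) q"
  unfolding stab_surj_def
proof (intro allI impI)
  define m where "m = n - 1"
  have mn: "Suc m = n" "Suc 0 \<le> n" "n - Suc 0 = m" using n by (auto simp: m_def)
  interpret A': point_stabilizer "Aut n" wact "frame_layer n (Suc 0)" "Aut m" "ext m n" "std_word n (Suc 0)" wact "[]"
    using std_word_point_stabilizer[OF mn(2)] by (simp add: mn)
  fix z assume "supp z \<subseteq> BS (Suc (n - 1)) q" "Bd (Suc (n - 1)) z = 0"
  then have "z \<in> fcol n 0 q" "Bd n z = 0" using n by (auto simp: fcol_0)
  then obtain c b where c: "c \<in> fcol n (Suc 0) q" "Bd n c = 0" "b \<in> fcol n 0 (Suc q)" "z = hbd c + Bd n b"
    using surj unfolding dc.hsurj_def by blast
  obtain c1 b1 where c1: "supp c1 \<subseteq> BS m q" "Bd m c1 = 0" "supp b1 \<subseteq> A'.S (Suc q)" "c = A'.iota c1 + Bd n b1"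
    using A'.shapiro_surj[of c q] c(1,2) unfolding fcol_def by blast
  have st: "supp (stabc m c1) \<subseteq> BS n q" using at_point_stab(1)[OF c1(1)] mn by simp
  obtain b3 where b3: "b3 \<in> fcol n 0 (Suc q)" "hbd (A'.iota c1) = stabc m c1 + Bd n b3"
    using hbd_std_word[OF mn(2), of c1 q] c1(1,2) mn at_point_self[OF st] by auto
  have "z = stabc m c1 + Bd n (b3 + hbd b1 + b)"
    unfolding c(4) c1(4) dc.dh_add b3(2) hbd_bar_d[OF wbd_wact] bar_d_add by (simp add: algebra_simps)
  moreover have "hbd b1 \<in> fcol n 0 (Suc q)" using hbd_supp[OF c1(3)] by (simp add: fcol_def)
  ultimately show "\<exists>c b. supp c \<subseteq> BS (n - 1) q \<and> Bd (n - 1) c = 0 \<and> supp b \<subseteq> BS (Suc (n - 1)) (Suc q) \<and>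
      z = stabc (n - 1) c + Bd (Suc (n - 1)) b"
    using c1(1,2) b3(1) c(3) mn unfolding m_def[symmetric] fcol_0
    by (intro exI[of _ c1] exI[of _ "b3 + hbd b1 + b"]) (simp add: supp_add)
qed

lemma stab_inj_of_hinj:
  assumes n: "0 < n" and inj: "dc.hinj 0 q"
  shows "stab_inj (n - 1) q"
  unfolding stab_inj_def
proof (intro allI impI)
  define m where "m = n - 1"
  have mn: "Suc m = n" "Suc 0 \<le> n" "n - Suc 0 = m" using n by (auto simp: m_def)
  interpret A': point_stabilizer "Aut n" wact "frame_layer n (Suc 0)" "Aut m" "ext m n" "std_word n (Suc 0)" wact "[]"
    using std_word_point_stabilizer[OF mn(2)] by (simp add: mn)
  fix c b assume c': "supp c \<subseteq> BS (n - 1) q" "Bd (n - 1) c = 0" "supp b \<subseteq> BS (Suc (n - 1)) (Suc q)"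
    "stabc (n - 1) c = Bd (Suc (n - 1)) b"
  have c: "supp c \<subseteq> BS m q" "Bd m c = 0" "supp b \<subseteq> BS n (Suc q)" "stabc m c = Bd n b"
    using c' by (simp_all only: m_def[symmetric] mn(1))
  have st: "supp (stabc m c) \<subseteq> BS n q" using at_point_stab(1)[OF c(1)] mn by simp
  obtain b3 where b3: "b3 \<in> fcol n 0 (Suc q)" "hbd (A'.iota c) = stabc m c + Bd n b3"
    using hbd_std_word[OF mn(2), of c q] c(1,2) mn at_point_self[OF st] by auto
  have "hbd (A'.iota c) = Bd n (b + b3)" using b3(2) c(4) by (simp add: bar_d_add)
  moreover have "b + b3 \<in> fcol n 0 (Suc q)" using b3(1) c(3) by (simp add: fcol_0 supp_add)
  moreover have "A'.iota c \<in> fcol n (Suc 0) q" using A'.iota_supp[OF c(1)] by (simp add: fcol_def)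
  moreover have "Bd n (A'.iota c) = 0" using A'.iota_D[OF c(1)] c(2) by (simp add: at_point_def)
  ultimately obtain u where u: "u \<in> fcol n (Suc 0) (Suc q)" "A'.iota c = Bd n u"
    using inj unfolding dc.hinj_def by blast
  have "supp u \<subseteq> A'.S (Suc q)" using u(1) by (simp add: fcol_def)
  from A'.shapiro_inj[OF c(1) this u(2)]
  show "\<exists>u. supp u \<subseteq> BS (n - 1) (Suc q) \<and> c = Bd (n - 1) u" by (simp add: m_def)
qed

end

text \<open>The rows up to \<open>i\<close> are exact for \<open>2 * i + 1 \<le> n\<close>. The pair
  of columns \<open>2 * j\<close>, \<open>2 * j + 1\<close> calls for the same statement with
  \<open>n - 2 * j\<close> and degree \<open>i + 1 - 2 * j\<close>, which requires
  \<open>2 * i + 4 - 2 * j \<le> n\<close>. The worst case \<open>j = 1\<close> is exactly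
  \<open>2 * i + 2 \<le> n\<close>. Injectivity is stated one degree lower because the comparison of
  columns yields the two in this combination.\<close>

theorem stab_surj_inj:
  "2 * i + 2 \<le> n \<Longrightarrow> stab_surj (n - 1) i \<and> (0 < i \<longrightarrow> stab_inj (n - 1) (i - 1))"
proof (induction i arbitrary: n rule: less_induct)
  case (less i)
  interpret dc: double_complex "fcol n" hbd "Bd n"
    by (rule frame_double_complex)
  have IH: "stab_surj (n - Suc (2 * j)) (Suc i - 2 * j) \<and> (2 * j \<le> i \<longrightarrow> stab_inj (n - Suc (2 * j)) (i - 2 * j))"
    if j: "1 \<le> j" "2 * j \<le> Suc i" for j
  proof -
    have "Suc i - 2 * j < i" "2 * (Suc i - 2 * j) + 2 \<le> n - 2 * j" using j less.prems by auto
    from less.IH[OF this] show ?thesis using j by (auto simp: Suc_diff_le)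
  qed
  have "dc.row_exact a" if "a \<le> i" for a using that less.prems by (intro frame_row_exact) auto
  moreover have "dc.hsurj (2 * j) (Suc i - 2 * j)" if "1 \<le> j" "2 * j \<le> Suc i" for j
    using IH[OF that] that less.prems by (intro hsurj_of_stab_surj) auto
  moreover have "dc.hinj (2 * j) (i - 2 * j)" if "1 \<le> j" "2 * j \<le> i" for j
    using IH[of j] that less.prems by (intro hinj_of_stab_inj) auto
  ultimately have "dc.hsurj 0 i" "0 < i \<Longrightarrow> dc.hinj 0 (i - 1)"
    using dc.first_column_comparison[of i] by blast+
  then show ?case
    using stab_surj_of_hsurj[of n i] stab_inj_of_hinj[of n "i - 1"] less.prems by auto
qed

lemma stab_surj_0: "stab_surj m 0"
  unfolding stab_surj_def
proof (intro allI impI)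
  fix z assume z: "supp z \<subseteq> BS (Suc m) 0"
  then have z': "supp z \<subseteq> {([], [])}" by (auto simp: bar_simplices_def)
  then have "stabc m z = z" unfolding at_point_def by (intro fmap_eq_self) auto
  moreover have "Bd m z = 0" unfolding bar_d_def by (rule frag_extend_eq_0) (use z' in auto)
  moreover have "supp z \<subseteq> BS m 0" using z' by (auto simp: bar_simplices_def)
  ultimately show "\<exists>c b. supp c \<subseteq> BS m 0 \<and> Bd m c = 0 \<and> supp b \<subseteq> BS (Suc m) (Suc 0) \<and>
     z = stabc m c + Bd (Suc m) b"
    by (intro exI[of _ z] exI[of _ 0]) simp
qed

text \<open>The two faces of \<open>[g]\<close> coincide over a point, so degree 1 has zero boundary
  and no class in degree 0 can die.\<close>

lemma stab_inj_0: "stab_inj m 0"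
  unfolding stab_inj_def
proof (intro allI impI)
  fix c b assume c: "supp c \<subseteq> BS m 0" and b: "supp b \<subseteq> BS (Suc m) (Suc 0)" "stabc m c = Bd (Suc m) b"
  have "stabc m c = c"
    unfolding at_point_def by (intro fmap_eq_self) (use c in \<open>auto simp: bar_simplices_def\<close>)
  moreover have "Bd (Suc m) b = 0"
    unfolding bar_d_def
  proof (rule frag_extend_eq_0)
    fix w assume "w \<in> supp b"
    then have "w \<in> BS (Suc m) (Suc 0)" using b(1) by blast
    then obtain g where "w = ([g], [])" by (auto simp: bar_simplices_def length_Suc_conv)
    then show "bar_bd (Aut (Suc m)) wact (fst w) (snd w) = 0" by simp
  qed
  ultimately show "\<exists>u. supp u \<subseteq> BS m (Suc 0) \<and> c = Bd m u" using b(2) by (intro exI[of _ 0]) simp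
qed

section \<open>Comparison with the bar complex of functions with finite support\<close>

definition to_fun :: "('a list \<times> 'v list \<Rightarrow>\<^sub>0 int) \<Rightarrow> 'a list \<Rightarrow> int"
  where "to_fun c xs = poly_mapping.lookup c (xs, [])"

lemma to_fun_diff: "to_fun (a - b) = (\<lambda>xs. to_fun a xs - to_fun b xs)"
  by (auto simp: to_fun_def lookup_minus)

lemma to_fun_0 [simp]: "to_fun 0 = (\<lambda>_. 0)"
  by (auto simp: to_fun_def)

lemma to_fun_inj:
  assumes "to_fun a = to_fun b" "supp a \<subseteq> bar_simplices G {[]} k" "supp b \<subseteq> bar_simplices G {[]} k"
  shows "a = b"
proof (rule poly_mapping_eqI)
  fix w
  show "poly_mapping.lookup a w = poly_mapping.lookup b w"
  proof (cases "snd w = []")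
    case True
    then show ?thesis using fun_cong[OF assms(1), of "fst w"] by (simp add: to_fun_def flip: True)
  next
    case False
    then have "w \<notin> supp a" "w \<notin> supp b" using assms by (auto simp: bar_simplices_def)
    then show ?thesis by (simp add: in_keys_iff)
  qed
qed

lemma to_fun_support:
  assumes "supp c \<subseteq> bar_simplices G {[]} k"
  shows "supp c = (\<lambda>xs. (xs, [])) ` {xs. to_fun c xs \<noteq> 0}"
proof (intro equalityI subsetI)
  fix w assume w: "w \<in> supp c"
  then obtain xs where "w = (xs, [])" using assms by (auto simp: bar_simplices_def)
  then show "w \<in> (\<lambda>xs. (xs, [])) ` {xs. to_fun c xs \<noteq> 0}"
    using w by (auto simp: to_fun_def in_keys_iff)
qed (auto simp: to_fun_def in_keys_iff)

lemma chain_to_fun: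
  assumes "supp c \<subseteq> bar_simplices G {[]} k"
  shows "chain G k (to_fun c)"
proof -
  have "finite ((\<lambda>xs. (xs, [] :: 'b list)) ` {xs. to_fun c xs \<noteq> 0})"
    using to_fun_support[OF assms] finite_keys by metis
  then have "finite {xs. to_fun c xs \<noteq> 0}" by (rule finite_imageD) (simp add: inj_on_def)
  moreover have "length xs = k \<and> set xs \<subseteq> carrier G" if "to_fun c xs \<noteq> 0" for xs
  proof -
    have "(xs, []) \<in> supp c" using that by (simp add: to_fun_def in_keys_iff)
    then show ?thesis using assms by (auto simp: bar_simplices_def)
  qed
  ultimately show ?thesis by (simp add: chain_def)
qed

lemma chain_of_to_fun:
  assumes "chain G k f"
  obtains c :: "'a list \<times> 'v list \<Rightarrow>\<^sub>0 int" where "supp c \<subseteq> bar_simplices G {[]} k" "to_fun c = f"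
proof
  define c :: "'a list \<times> 'v list \<Rightarrow>\<^sub>0 int" where "c = Abs_poly_mapping (\<lambda>w. if snd w = [] then f (fst w) else 0)"
  have "{w. (if snd w = [] then f (fst w) else 0) \<noteq> 0} \<subseteq> (\<lambda>xs. (xs, [] :: 'v list)) ` {xs. f xs \<noteq> 0}"
    by (auto split: if_splits)
  then have "finite {w. (if snd w = ([] :: 'v list) then f (fst w) else 0) \<noteq> 0}"
    by (rule finite_subset) (use assms in \<open>simp add: chain_def\<close>)
  then have lk: "poly_mapping.lookup c w = (if snd w = [] then f (fst w) else 0)" for w
    unfolding c_def by (subst Abs_poly_mapping_inverse) auto
  show "to_fun c = f" by (auto simp: to_fun_def lk)
  show "supp c \<subseteq> bar_simplices G {[]} k"
    using assms by (auto simp: in_keys_iff lk bar_simplices_def chain_def split: if_splits)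
qed

lemma to_fun_frag_extend:
  assumes "supp c \<subseteq> bar_simplices G {[]} k"
  shows "to_fun (frag_extend f c) ys = (\<Sum>xs\<in>{xs. to_fun c xs \<noteq> 0}. to_fun c xs * to_fun (f (xs, [])) ys)"
proof -
  have "to_fun (frag_extend f c) ys = (\<Sum>w\<in>supp c. poly_mapping.lookup c w * poly_mapping.lookup (f w) (ys, []))"
    by (simp add: to_fun_def frag_extend_def lookup_sum)
  also have "\<dots> = (\<Sum>xs\<in>{xs. to_fun c xs \<noteq> 0}. to_fun c xs * to_fun (f (xs, [])) ys)"
    unfolding to_fun_support[OF assms] by (subst sum.reindex) (auto simp: inj_on_def to_fun_def)
  finally show ?thesis .
qed

text \<open>Unrolls the recursion into the explicit alternating sum of faces. The index starts at
  \<open>Suc i\<close> because face 0, which drops the first entry, is not part of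
  \<open>bar_rest\<close>.\<close>

lemma bar_rest_faces:
  assumes act: "\<And>g. act g x = x"
  shows "bar_rest G act gs x = (\<Sum>i<length gs. frag_cmul ((-1) ^ i) (frag_of (face G (Suc i) gs, x)))"
proof (induction gs)
  case (Cons g gs)
  have "mult_head G act g (gs, x) = (face G 1 (g # gs), x)"
    using act by (cases gs) (auto simp: face_def)
  moreover have "g # face G (Suc i) gs = face G (Suc (Suc i)) (g # gs)" if "i < length gs" for i
    using that by (auto simp: face_def)
  then have "fmap (cons_head g) (bar_rest G act gs x) =
      (\<Sum>i<length gs. frag_cmul ((-1) ^ i) (frag_of (face G (Suc (Suc i)) (g # gs), x)))"
    unfolding Cons.IH by (auto simp: fmap_sum fmap_cmul intro!: sum.cong)
  ultimately show ?case
    by (simp only: bar_rest.simps length_Cons sum.lessThan_Suc_shift) (simp flip: sum_negf)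
qed simp

lemma to_fun_bar_bd:
  assumes act: "\<And>g. act g [] = []"
  shows "to_fun (bar_bd G act xs []) ys = bd_basis G xs ys"
proof (cases xs)
  case Nil
  then show ?thesis by (simp add: bd_basis_def)
next
  case (Cons g gs)
  have "bar_bd G act xs [] = frag_of (face G 0 xs, []) - bar_rest G act xs []"
    unfolding Cons by (simp add: face_def del: bar_rest.simps)
  also have "\<dots> = frag_of (face G 0 xs, []) + (\<Sum>i<length xs. frag_cmul ((-1) ^ Suc i) (frag_of (face G (Suc i) xs, [])))"
    unfolding bar_rest_faces[of act "[]" G xs, OF act] by (simp flip: sum_negf)
  also have "\<dots> = (\<Sum>i<Suc (length xs). frag_cmul ((-1) ^ i) (frag_of (face G i xs, [])))"
    by (simp only: sum.lessThan_Suc_shift) simp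
  finally have "to_fun (bar_bd G act xs []) ys = (\<Sum>i<Suc (length xs). (-1) ^ i * (if face G i xs = ys then 1 else 0))"
    by (simp add: to_fun_def lookup_sum del: sum.lessThan_Suc) (auto intro!: sum.cong)
  then show ?thesis using Cons by (simp add: bd_basis_def lessThan_Suc_atMost atMost_atLeast0)
qed

lemma boundary_to_fun:
  assumes "\<And>g. act g [] = []" "supp c \<subseteq> bar_simplices G {[]} k"
  shows "boundary G (to_fun c) = to_fun (bar_d G act c)"
  unfolding boundary_def bar_d_def by (rule HOL.ext) (simp add: to_fun_frag_extend[OF assms(2)] to_fun_bar_bd[of act, OF assms(1)])

lemma push_to_fun:
  fixes c :: "'a list \<times> 'v list \<Rightarrow>\<^sub>0 int"
  assumes "supp c \<subseteq> bar_simplices G {[]} k"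
  shows "push f (to_fun c) = to_fun (at_point f ([] :: 'w list) c)"
proof
  fix ys
  have fin: "finite {xs. to_fun c xs \<noteq> 0}" using chain_to_fun[OF assms] by (simp add: chain_def)
  have "to_fun (at_point f ([] :: 'w list) c) ys = (\<Sum>xs\<in>{xs. to_fun c xs \<noteq> 0}. if map f xs = ys then to_fun c xs else 0)"
    unfolding at_point_def fmap_def to_fun_frag_extend[OF assms] by (rule sum.cong) (auto simp: to_fun_def)
  also have "\<dots> = push f (to_fun c) ys"
    unfolding push_def sum.inter_filter[OF fin, symmetric] by (rule sum.cong) auto
  finally show "push f (to_fun c) ys = to_fun (at_point f ([] :: 'w list) c) ys" by (rule sym)
qed

lemma induced_iso_of_stab:
  assumes "stab_surj n k" "stab_inj n k"
  shows "induced_iso_Hk (Aut n) (Aut (Suc n)) (stab n) k"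
  unfolding induced_iso_Hk_def
proof (intro conjI allI impI)
  have act: "wact g [] = []" for g by simp
  note bdry = boundary_to_fun[of wact, OF act]
  \<comment> \<open>\<open>to_fun\<close> sees only tuples at the empty word and is injective there;
    degree 0 is separate because no degree lies below it.\<close>
  have Bd_cyc: "Bd m c = 0" if c: "supp c \<subseteq> BS m k" "boundary (Aut m) (to_fun c) = (\<lambda>_. 0)" for m c
  proof -
    interpret group_action "Aut m" wact "{[]}"
      using frame_action[of m 0] by (simp add: frame_layer_0)
    have "to_fun (Bd m c) = to_fun 0" using bdry[OF c(1)] c(2) by simp
    then show ?thesis
    proof (cases k)
      case 0
      then show ?thesis using c(1) D_S0 by simp
    next
      case (Suc l)
      then have "supp (Bd m c) \<subseteq> BS m l" using c(1) D_supp by blast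
      then show ?thesis using to_fun_inj[OF \<open>to_fun (Bd m c) = to_fun 0\<close>] by simp
    qed
  qed
  {
    fix f assume "cycle (Aut (Suc n)) k f"
    then have f: "chain (Aut (Suc n)) k f" "boundary (Aut (Suc n)) f = (\<lambda>_. 0)" by (auto simp: cycle_def)
    obtain z where z: "supp z \<subseteq> BS (Suc n) k" "to_fun z = f" using chain_of_to_fun[OF f(1)] by blast
    have "Bd (Suc n) z = 0" using Bd_cyc[OF z(1)] f(2) z(2) by simp
    then obtain c b where c: "supp c \<subseteq> BS n k" "Bd n c = 0" "supp b \<subseteq> BS (Suc n) (Suc k)"
        "z = stabc n c + Bd (Suc n) b"
      using assms(1) z(1) unfolding stab_surj_def by blast
    have "cycle (Aut n) k (to_fun c)"
      using chain_to_fun[OF c(1)] bdry[OF c(1)] c(2) by (simp add: cycle_def)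
    moreover have "is_boundary (Aut (Suc n)) k (\<lambda>ys. push (stab n) (to_fun c) ys - f ys)"
      unfolding is_boundary_def
    proof (intro exI conjI)
      \<comment> \<open>The required difference is image minus cycle, while \<open>b\<close> bounds
        cycle minus image.\<close>
      have b: "supp (- b) \<subseteq> BS (Suc n) (Suc k)" using c(3) by simp
      show "chain (Aut (Suc n)) (Suc k) (to_fun (- b))" by (rule chain_to_fun[OF b])
      have p: "push (stab n) (to_fun c) = to_fun (stabc n c)" by (rule push_to_fun[OF c(1)])
      have "stabc n c - z = Bd (Suc n) (- b)" using c(4) by (simp add: bar_d_minus)
      from arg_cong[OF this, of to_fun]
      show "boundary (Aut (Suc n)) (to_fun (- b)) = (\<lambda>ys. push (stab n) (to_fun c) ys - f ys)"
        unfolding bdry[OF b] p z(2)[symmetric] by (simp add: to_fun_diff)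
    qed
    ultimately show "\<exists>z'. cycle (Aut n) k z' \<and> is_boundary (Aut (Suc n)) k (\<lambda>ys. push (stab n) z' ys - f ys)"
      by blast
  }
  {
    fix f assume "cycle (Aut n) k f" and B: "is_boundary (Aut (Suc n)) k (push (stab n) f)"
    then have f: "chain (Aut n) k f" "boundary (Aut n) f = (\<lambda>_. 0)" by (auto simp: cycle_def)
    obtain c where c: "supp c \<subseteq> BS n k" "to_fun c = f" using chain_of_to_fun[OF f(1)] by blast
    obtain g where g: "chain (Aut (Suc n)) (Suc k) g" "boundary (Aut (Suc n)) g = push (stab n) f"
      using B by (auto simp: is_boundary_def)
    obtain b where b: "supp b \<subseteq> BS (Suc n) (Suc k)" "to_fun b = g" using chain_of_to_fun[OF g(1)] by blast
    interpret group_action "Aut (Suc n)" wact "{[]}"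
      using frame_action[of "Suc n" 0] by (simp add: frame_layer_0)
    have p: "push (stab n) (to_fun c) = to_fun (stabc n c)" by (rule push_to_fun[OF c(1)])
    have "to_fun (stabc n c) = to_fun (Bd (Suc n) b)"
      using bdry[OF b(1)] g(2) p b(2) c(2) by simp
    then have "stabc n c = Bd (Suc n) b"
      by (rule to_fun_inj[OF _ at_point_stab(1)[OF c(1)] D_supp[OF b(1)]])
    moreover have "Bd n c = 0" using Bd_cyc[OF c(1)] c(2) f(2) by simp
    ultimately obtain u where u: "supp u \<subseteq> BS n (Suc k)" "c = Bd n u"
      using assms(2) c(1) b(1) unfolding stab_inj_def by blast
    have "boundary (Aut n) (to_fun u) = f" using bdry[OF u(1)] u(2) c(2) by simp
    then show "is_boundary (Aut n) k f" using chain_to_fun[OF u(1)] by (auto simp: is_boundary_def)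
  }
qed

theorem mainTheorem10:
  fixes k n :: nat
  assumes "n > 4 * k"
  shows "induced_iso_Hk (AutoGroup (free_group n)) (AutoGroup (free_group (Suc n))) (stab n) k"
proof (rule induced_iso_of_stab)
  show "stab_surj n k"
    using stab_surj_0 stab_surj_inj[of k "Suc n"] assms by (cases k) auto
  show "stab_inj n k"
  proof (cases k)
    case 0
    then show ?thesis using stab_inj_0 by simp
  next
    case (Suc j)
    \<comment> \<open>Injectivity in degree \<open>k\<close> needs \<open>n \<ge> 2 * k + 3\<close>,
      which follows from \<open>n > 4 * k\<close> as soon as \<open>k \<ge> 1\<close>. For
      \<open>k = 0\<close> it may fail, at \<open>n = 1\<close> and \<open>n = 2\<close>, whence the
      separate treatment of degree 0.\<close>
    then have "2 * Suc k + 2 \<le> Suc n" using assms by simp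
    then show ?thesis using stab_surj_inj[of "Suc k" "Suc n"] by simp
  qed
qed

end
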